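(* Let $\Sigma$ be a finite subset of $\mathbf{N}^*$ such that $|\Sigma|<q$. Then the image $\operatorname{Im}(\mathcal{G}_\Sigma)$ is the ideal of $\mathcal{Z}_\emptyset(K)$ generated by $\zeta_A(1)^{|\Sigma|}$.
   Context: Notation. $\mathbf{N}$ is the set of non-negative integers, $\mathbf{N}^*$ the set of positive integers. $\mathbf{F}_q$ is a finite field with $q$ elements, $A=\mathbf{F}_q[\theta]$, $A^+$ is the set of monic polynomials in $A$, $K=\mathbf{F}_q(\theta)$, $K_\infty=\mathbf{F}_q((1/\theta))$ is the completion of $K$ for the valuation $v_\infty(a/b)=\deg b-\deg a$, and $\mathbf{C}_\infty$ is the completion of an algebraic closure of $K_\infty$. Put $\ell_d=\prod_{i=1}^d(\theta-\theta^{q^i})$, $D_d=\prod_{i=0}^{d-1}(\theta^{q^d}-\theta^{q^i})$ for $d\in\mathbf{N}$ (empty products are $1$; empty sums are $0$). $\zeta_A(1)=\sum_{a\in A^+}1/a\in K_\infty$. Let $(t_i)_{i\in\mathbf{N}^*}$ and $(X_i)_{i\in\mathbf{N}^*}$ be sequences of independent indeterminates. For $a\in A$, $a(t_i)$ is obtained by replacing $\theta$ by $t_i$. For a finite subset $U\subset\mathbf{N}^*$ put $\chi_U(a)=\prod_{i\in U}a(t_i)$ and $X_U=\prod_{i\in U}X_i$. Fix a finite $\Sigma\subset\mathbf{N}^*$ with $|\Sigma|<q$. An admissible array of type $\Sigma$ and weight $w$ is $\mathtt{A}=\begin{pmatrix}\Sigma_1&\cdots&\Sigma_r\\ s_1&\cdots&s_r\end{pmatrix}$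 where $\Sigma_1,\dots,\Sigma_r$ are (possibly empty) pairwise disjoint sets with union $\Sigma$, and $s_1,\dots,s_r$ are positive integers with sum $w$ (for $\Sigma=\emptyset$ the empty array, with value $1$ and weight $0$, is also allowed). Define $$\zeta_A(\mathtt{A})=\sum\frac{\chi_{\Sigma_1}(a_1)\cdots\chi_{\Sigma_r}(a_r)}{a_1^{s_1}\cdots a_r^{s_r}},\qquad \lambda_A(\mathtt{A})=\sum\frac{X_{\Sigma_1}^{q^{\deg a_1}}\cdots X_{\Sigma_r}^{q^{\deg a_r}}}{a_1^{s_1}\cdots a_r^{s_r}},$$ both sums over $a_1,\dots,a_r\in A^+$ with $\deg a_1>\cdots>\deg a_r\ge 0$. The first (a Pellarin multiple zeta value) is an entire function of the variables $t_i$, $i\in\Sigma$; the second (a multiple polylogarithm) is an element of the Tate algebra over $\mathbf{C}_\infty$ in the variables $X_i$, $i\in\Sigma$. Let $\mathcal{Z}_\Sigma(K)$ (resp. $\mathcal{L}_\Sigma(K)$) be the $K$-vector space spanned by all $\zeta_A(\mathtt{A})$ (resp. $\lambda_A(\mathtt{A})$) with $\mathtt{A}$ admissible of type $\Sigma$, and $\mathcal{Z}_{\Sigma,n}(K)$ the subspace of $\mathcal{Z}_\Sigma(K)$ spanned by those of weight $n$. $\mathcal{Z}_\emptyset(K)=\mathcal{L}_\emptyset(K)$ is the $K$-algebra of Thakur's multiple zeta values, and $\mathcal{Z}_\Sigma(K)=\bigoplus_n\mathcal{Z}_{\Sigma,n}(K)$ and $\mathcal{L}_\Sigma(K)$ are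 graded (by weight) $\mathcal{Z}_\emptyset(K)$-modules under multiplication. For $\underline{k}=(k_i)_{i\in\Sigma}\in\mathbf{N}^{|\Sigma|}$ put $\theta^{q^{\underline{k}}}=(\theta^{q^{k_i}})_{i\in\Sigma}$. Trivial multiple zeta values: $\mathcal{Z}^{\mathrm{triv}}_{\Sigma,n}(K)$ is the set of $f\in\mathcal{Z}_{\Sigma,n}(K)$ with $f(\theta^{q^{\underline{k}}})=0$ for all but finitely many $\underline{k}\in\mathbf{N}^{|\Sigma|}$, and $\mathcal{Z}^{\mathrm{triv}}_\Sigma(K)=\bigoplus_{n\ge0}\mathcal{Z}^{\mathrm{triv}}_{\Sigma,n}(K)$, a $\mathcal{Z}_\emptyset(K)$-submodule of $\mathcal{Z}_\Sigma(K)$. The map $\mathcal{F}_\Sigma:\mathcal{Z}_\Sigma(K)\to\mathcal{L}_\Sigma(K)$ is $$\mathcal{F}_\Sigma(f)=\sum_{\underline{i}\in\mathbf{N}^{|\Sigma|}}\ \sum_{\underline{j}\le\underline{i}}\frac{f(\theta^{q^{\underline{j}}})}{D_{\underline{j}}\,\ell_{\underline{i}-\underline{j}}^{q^{\underline{j}}}}X_\Sigma^{q^{\underline{i}}},$$ where $\underline{j}\in\mathbf{N}^{|\Sigma|}$, $\le$ is componentwise, $X_\Sigma^{q^{\underline{i}}}=\prod_{r\in\Sigma}X_r^{q^{i_r}}$, $D_{\underline{j}}=\prod_{r\in\Sigma}D_{j_r}$, $\ell_{\underline{i}-\underline{j}}^{q^{\underline{j}}}=\prod_{r\in\Sigma}\ell_{i_r-j_r}^{q^{j_r}}$;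 it is known (Gezmis–Pellarin) that $\mathcal{F}_\Sigma$ is well defined and an isomorphism of graded $\mathcal{Z}_\emptyset(K)$-modules. Let $\mathrm{ev}:\mathcal{L}_\Sigma(K)\to\mathcal{Z}_\emptyset(K)$ be evaluation at $X_i=1$ for all $i\in\Sigma$, and $\mathcal{G}_\Sigma=\mathrm{ev}\circ\mathcal{F}_\Sigma|_{\mathcal{Z}^{\mathrm{triv}}_\Sigma(K)}:\mathcal{Z}^{\mathrm{triv}}_\Sigma(K)\to\mathcal{Z}_\emptyset(K)$. *)

theory Defs
  imports
    "HOL-Library.Cardinality"
    "HOL-Analysis.Infinite_Sum"
    "HOL-Algebra.Ideal"
    "HOL-Computational_Algebra.Computational_Algebra"
begin

section \<open>The fields\<close>

text \<open>
  The finite field \<open>F\<^sub>q\<close> is the type \<open>'a\<close>, so \<open>q = CARD('a)\<close>, the ring \<open>A\<close> is \<open>'a poly\<close>, and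
  \<open>K\<^sub>\<infinity> = F\<^sub>q((1/\<theta>))\<close> is \<open>'a fls\<close>, the series variable \<open>fls_X\<close> being \<open>1/\<theta>\<close>. The library metric
  on \<open>'a fls\<close> is \<open>dist a b = 2 powi (- v (a - b))\<close> with \<open>v = v\<^sub>\<infinity>\<close>, i.e. the metric of the
  \<open>\<infinity>\<close>-adic absolute value normalised by \<open>\<bar>\<theta>\<bar> = 2\<close>; the normalisation is immaterial.

  The completion \<open>C\<^sub>\<infinity>\<close> of an algebraic closure of \<open>K\<^sub>\<infinity>\<close> is given by its defining properties,
  which determine it up to isometric isomorphism over \<open>K\<^sub>\<infinity>\<close>: it is a complete valued field with
  an isometric embedding \<open>\<iota>\<close> of \<open>K\<^sub>\<infinity>\<close>, in which the elements algebraic over \<open>K\<^sub>\<infinity>\<close> form an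
  algebraically closed and dense subfield. The absolute value of \<open>x\<close> is \<open>dist x 0\<close>.
\<close>

locale C_infinity =
  fixes \<iota> :: "'a :: finite_field fls \<Rightarrow> 'c :: {field, complete_space}"
  assumes hom_add: "\<iota> (x + y) = \<iota> x + \<iota> y"
    and hom_mult: "\<iota> (x * y) = \<iota> x * \<iota> y"
    and hom_one: "\<iota> 1 = 1"
    and isometry: "dist (\<iota> x) (\<iota> y) = dist x y"
    and dist_diff: "\<And>u v :: 'c. dist u v = dist (u - v) 0"
    and abs_mult: "\<And>u v :: 'c. dist (u * v) 0 = dist u 0 * dist v 0"
    and abs_ultrametric: "\<And>u v :: 'c. dist (u + v) 0 \<le> max (dist u 0) (dist v 0)"
    and closure_alg_closed:
      "\<And>p :: 'c poly. degree p > 0 \<Longrightarrow>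
         (\<And>n. coeff p n \<in> {x. \<exists>g. g \<noteq> 0 \<and> poly (map_poly \<iota> g) x = 0}) \<Longrightarrow>
         \<exists>x \<in> {x. \<exists>g. g \<noteq> 0 \<and> poly (map_poly \<iota> g) x = 0}. poly p x = 0"
    and closure_dense: "closure {x. \<exists>g. g \<noteq> 0 \<and> poly (map_poly \<iota> g) x = 0} = UNIV"


section \<open>Admissible arrays and multi-indices\<close>

text \<open>
  An array is the list of its columns \<open>(\<Sigma>\<^sub>i, s\<^sub>i)\<close>. The empty list is admissible only for
  \<open>\<Sigma> = {}\<close>, since the union of its sets is empty.
\<close>

definition admissible :: "nat set \<Rightarrow> (nat set \<times> nat) list \<Rightarrow> bool" where
  "admissible \<Sigma> A \<longleftrightarrow>
     sorted_wrt (\<lambda>c d. fst c \<inter> fst d = {}) A \<and>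
     (\<Union>c\<in>set A. fst c) = \<Sigma> \<and>
     (\<forall>c\<in>set A. 0 < snd c)"

definition weight :: "(nat set \<times> nat) list \<Rightarrow> nat" where
  "weight A = (\<Sum>c\<leftarrow>A. snd c)"

text \<open>
  Elements of \<open>\<nat>\<^bsup>\<Sigma>\<^esup>\<close>, as functions vanishing outside \<open>\<Sigma>\<close>; also used for the exponents of
  monomials in the \<open>X\<^sub>r\<close>, \<open>r \<in> \<Sigma>\<close>.
\<close>

definition multi_idx :: "nat set \<Rightarrow> (nat \<Rightarrow> nat) set" where
  "multi_idx \<Sigma> = {k. \<forall>r. r \<notin> \<Sigma> \<longrightarrow> k r = 0}"

definition monic_polys :: "'a :: finite_field poly set" where
  "monic_polys = {a. lead_coeff a = 1}"

text \<open>The tuples \<open>(a\<^sub>1, \<dots>, a\<^sub>r)\<close> of monic polynomials with \<open>N > deg a\<^sub>1 > \<dots> > deg a\<^sub>r \<ge> 0\<close>.\<close>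

definition decreasing_tuples :: "nat \<Rightarrow> nat \<Rightarrow> 'a :: finite_field poly list set" where
  "decreasing_tuples r N =
     {as. length as = r \<and> set as \<subseteq> monic_polys \<and> (\<forall>a\<in>set as. degree a < N) \<and>
          sorted_wrt (\<lambda>a b. degree a > degree b) as}"

text \<open>
  A power series \<open>\<Sum>\<^sub>m g\<^sub>m X\<^sup>m\<close> in the variables \<open>X\<^sub>r\<close>, \<open>r \<in> \<Sigma>\<close>, is given by its coefficient function
  \<open>g\<close> on \<open>multi_idx \<Sigma>\<close>. For an element of the Tate algebra, i.e. when the coefficients tend to
  zero, the following series converges at every point of the closed unit polydisc.
\<close>

definition tate_eval ::
    "nat set \<Rightarrow> ((nat \<Rightarrow> nat) \<Rightarrow> 'c) \<Rightarrow> (nat \<Rightarrow> 'c :: {field, complete_space}) \<Rightarrow> 'c" where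
  "tate_eval \<Sigma> g x = (\<Sum>\<^sub>\<infinity>m\<in>multi_idx \<Sigma>. g m * (\<Prod>r\<in>\<Sigma>. x r ^ m r))"


section \<open>Multiple zeta values\<close>

context C_infinity
begin

definition q :: nat where
  "q = CARD('a)"

definition \<theta> :: 'c where
  "\<theta> = \<iota> fls_X_inv"

text \<open>
  \<open>eval_at a t\<close> is \<open>a(t)\<close>, the result of replacing \<open>\<theta>\<close> by \<open>t\<close> in \<open>a\<close>; in particular \<open>eval_at a \<theta>\<close> is \<open>a\<close> itself as
  an element of \<open>C\<^sub>\<infinity>\<close>.
\<close>

definition eval_at :: "'a poly \<Rightarrow> 'c \<Rightarrow> 'c" where
  "eval_at a t = poly (map_poly (\<lambda>c. \<iota> (fls_const c)) a) t"

definition K :: "'c set" where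
  "K = {eval_at a \<theta> / eval_at b \<theta> | a b. b \<noteq> 0}"

definition ell :: "nat \<Rightarrow> 'c" where
  "ell d = (\<Prod>i=1..d. \<theta> - \<theta> ^ (q ^ i))"

definition D :: "nat \<Rightarrow> 'c" where
  "D d = (\<Prod>i<d. \<theta> ^ (q ^ d) - \<theta> ^ (q ^ i))"

definition zeta_one :: 'c where
  "zeta_one = (\<Sum>\<^sub>\<infinity>a\<in>(monic_polys :: 'a poly set). 1 / eval_at a \<theta>)"

text \<open>
  The entire function \<open>\<zeta>\<^sub>A(A)\<close> of the variables \<open>t\<^sub>i\<close>, \<open>i \<in> \<Sigma>\<close>; it ignores the coordinates of its
  argument outside \<open>\<Sigma>\<close>. Away from the unit polydisc the individual terms of the series need not
  tend to zero (for instance \<open>a(t)/a = 1\<close> for \<open>t = \<theta>\<close>), and the sum is to be taken by degrees, as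
  the limit of the finite sums over \<open>deg a\<^sub>1 < N\<close>.
\<close>

definition mzv :: "(nat set \<times> nat) list \<Rightarrow> (nat \<Rightarrow> 'c) \<Rightarrow> 'c" where
  "mzv A t =
     lim (\<lambda>N. \<Sum>as\<in>decreasing_tuples (length A) N.
       \<Prod>k<length A. (\<Prod>j\<in>fst (A ! k). eval_at (as ! k) (t j)) / eval_at (as ! k) \<theta> ^ snd (A ! k))"

definition K_span :: "((nat \<Rightarrow> 'c) \<Rightarrow> 'c) set \<Rightarrow> ((nat \<Rightarrow> 'c) \<Rightarrow> 'c) set" where
  "K_span S = {(\<lambda>t. \<Sum>b\<in>B. c b * b t) | B c. finite B \<and> B \<subseteq> S \<and> c ` B \<subseteq> K}"

definition Z :: "nat set \<Rightarrow> ((nat \<Rightarrow> 'c) \<Rightarrow> 'c) set" where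
  "Z \<Sigma> = K_span {mzv A | A. admissible \<Sigma> A}"

definition Z_wt :: "nat set \<Rightarrow> nat \<Rightarrow> ((nat \<Rightarrow> 'c) \<Rightarrow> 'c) set" where
  "Z_wt \<Sigma> n = K_span {mzv A | A. admissible \<Sigma> A \<and> weight A = n}"

text \<open>
  For \<open>\<Sigma> = {}\<close> the functions in \<open>Z {}\<close> are constant, and are identified with their values in
  \<open>C\<^sub>\<infinity>\<close>: this is Thakur's algebra of multiple zeta values.
\<close>

definition MZV_ring :: "'c ring" where
  "MZV_ring = \<lparr>carrier = {z. (\<lambda>_. z) \<in> Z {}}, monoid.mult = (*), one = 1, zero = 0, add = (+)\<rparr>"


section \<open>Trivial multiple zeta values and the map \<open>G\<close>\<close>

definition \<theta>_pow :: "(nat \<Rightarrow> nat) \<Rightarrow> nat \<Rightarrow> 'c" where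
  "\<theta>_pow k = (\<lambda>r. \<theta> ^ (q ^ k r))"

definition Z_triv_wt :: "nat set \<Rightarrow> nat \<Rightarrow> ((nat \<Rightarrow> 'c) \<Rightarrow> 'c) set" where
  "Z_triv_wt \<Sigma> n = {f \<in> Z_wt \<Sigma> n. finite {k \<in> multi_idx \<Sigma>. f (\<theta>_pow k) \<noteq> 0}}"

definition Z_triv :: "nat set \<Rightarrow> ((nat \<Rightarrow> 'c) \<Rightarrow> 'c) set" where
  "Z_triv \<Sigma> = {(\<lambda>t. \<Sum>n\<in>N. h n t) | N h. finite N \<and> (\<forall>n\<in>N. h n \<in> Z_triv_wt \<Sigma> n)}"

definition F_coeff :: "nat set \<Rightarrow> ((nat \<Rightarrow> 'c) \<Rightarrow> 'c) \<Rightarrow> (nat \<Rightarrow> nat) \<Rightarrow> 'c" where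
  "F_coeff \<Sigma> f i =
     (\<Sum>j\<in>{j \<in> multi_idx \<Sigma>. \<forall>r. j r \<le> i r}.
        f (\<theta>_pow j) / ((\<Prod>r\<in>\<Sigma>. D (j r)) * (\<Prod>r\<in>\<Sigma>. ell (i r - j r) ^ (q ^ j r))))"

text \<open>
  The series \<open>\<Sum>\<^sub>i F_coeff \<Sigma> f i * X\<^sub>\<Sigma>\<^bsup>q^i\<^esup>\<close>: its coefficient at the monomial \<open>X\<^sup>m\<close> is the sum over the
  (at most one) \<open>i\<close> with \<open>m r = q ^ i r\<close> for all \<open>r \<in> \<Sigma>\<close>.
\<close>

definition F :: "nat set \<Rightarrow> ((nat \<Rightarrow> 'c) \<Rightarrow> 'c) \<Rightarrow> (nat \<Rightarrow> nat) \<Rightarrow> 'c" where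
  "F \<Sigma> f m = (\<Sum>i\<in>{i \<in> multi_idx \<Sigma>. \<forall>r\<in>\<Sigma>. q ^ i r = m r}. F_coeff \<Sigma> f i)"

definition G :: "nat set \<Rightarrow> ((nat \<Rightarrow> 'c) \<Rightarrow> 'c) \<Rightarrow> 'c" where
  "G \<Sigma> f = tate_eval \<Sigma> (F \<Sigma> f) (\<lambda>_. 1)"

end

end

theory Submission
  imports Defs
begin

text \<open>
  For a trivial \<open>f\<close> only finitely many values \<open>f(\<theta>\<^bsup>q^j\<^esup>)\<close> are nonzero. In the double series for \<open>G f\<close>
  the sum over \<open>i\<close> can then be carried out first, for each of these \<open>j\<close>. It factors over \<open>r \<in> \<Sigma>\<close> into
  \<open>q^j\<^sub>r\<close>-th powers of \<open>\<Sum>\<^sub>d 1/\<ell>\<^sub>d\<close>, and by Carlitz's formula \<open>1/\<ell>\<^sub>d\<close> is the sum of \<open>1/a\<close> over the monic \<open>a\<close> of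
  degree \<open>d\<close>. This gives lemma \<open>G_eq\<close>:
  \<open>G f = \<Sum>\<^sub>j f(\<theta>\<^bsup>q^j\<^esup>)/D\<^sub>j \<cdot> \<Prod>\<^sub>r \<zeta>\<^sub>A(1)\<^bsup>q^j\<^sub>r\<^esup>\<close>.

  Every term contains the factor \<open>\<zeta>\<^sub>A(1)\<^bsup>|\<Sigma>|\<^esup>\<close>. The values \<open>f(\<theta>\<^bsup>q^k\<^esup>)\<close> are themselves multiple zeta values
  (lemma \<open>Z_value_in_MZV\<close>): at such a point a column becomes a power sum in \<open>a\<close> with an integral
  exponent, and power sums with nonnegative exponent vanish in all large degrees. So the image is
  contained in the ideal.

  Conversely, \<open>f\<^sub>0 = \<zeta>\<^sub>A(\<Sigma>; |\<Sigma>|)\<close> has at \<open>\<theta>\<^bsup>q^k\<^esup>\<close> the value \<open>\<Sum>\<^sub>a a\<^sup>m\<close> with \<open>m = \<Sum>\<^sub>r (q^k\<^sub>r - 1)\<close>, summed by degrees.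
  Since \<open>q - 1\<close> divides \<open>m\<close>, this is \<open>0\<close> for \<open>m > 0\<close>, as for the trivial zeros of the Goss zeta function,
  and it is \<open>1\<close> for \<open>m = 0\<close>, i.e. for \<open>k = 0\<close>. Hence \<open>G (z f\<^sub>0) = z \<zeta>\<^sub>A(1)\<^bsup>|\<Sigma>|\<^esup>\<close> for every multiple zeta value \<open>z\<close>,
  and these elements exhaust the ideal.

  Two general facts support this argument. The first is that a product of multiple zeta values with
  disjoint sets of variables is a \<open>K\<close>-linear combination of multiple zeta values of the total weight
  (lemma \<open>mzv_mult_mzv\<close>). It makes \<open>z f\<^sub>0\<close> a trivial multiple zeta value, and it makes the multiple zeta
  values without variables a ring, so that the ideal consists of the multiples of its generator. The
  proof sorts the pairs \<open>(a, b)\<close> of polynomials by degree and, in equal degrees, expands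
  \<open>1/(a\<^sup>r b\<^sup>s)\<close> into partial fractions with denominators in \<open>a - b\<close>.

  The second fact is that the defining series converge at every point \<open>t\<close>, without which the product
  formula could not pass from truncations to the limit. The terms are large, and the convergence is due
  to cancellation in the sum over all monic \<open>a\<close> of degree \<open>d\<close>: a summand that does not involve one of
  the coefficients of \<open>a\<close> is counted \<open>q = 0\<close> times, and the \<open>i\<close>-th coefficient, where it is involved,
  contributes a factor of size \<open>2\<^bsup>i-d\<^esup>\<close>. Lemma \<open>sum_affine_products_bound\<close> makes this precise; it also shows
  that power sums with nonnegative exponent vanish in large degrees.
\<close>


section \<open>Finite fields\<close>

text \<open>
  The polynomial \<open>(X + 1)\<^sup>q - X\<^sup>q - 1\<close> has degree less than \<open>q\<close> and vanishes at all \<open>q\<close> elements of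
  the field, since \<open>c\<^sup>q = c\<close>; hence its coefficients are zero. This yields the additivity of the
  \<open>q\<close>-th power map without a presentation of \<open>q\<close> as a prime power.
\<close>

lemma binomial_card_eq_0:
  assumes "0 < k" "k < CARD('a::finite_field)"
  shows "of_nat (CARD('a) choose k) = (0 :: 'a)"
proof -
  let ?q = "CARD('a)"
  define P :: "'a poly" where "P = (\<Sum>i\<in>{1..<?q}. monom (of_nat (?q choose i)) i)"
  have q1: "?q > 1" using assms by simp
  have "poly P c = 0" for c
  proof -
    have "(c + 1) ^ ?q = (\<Sum>i\<le>?q. of_nat (?q choose i) * c ^ i)"
      by (simp add: binomial_ring)
    also have "{..?q} = insert 0 (insert ?q {1..<?q})" by auto
    also have "(\<Sum>i\<in>insert 0 (insert ?q {1..<?q}). of_nat (?q choose i) * c ^ i)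
       = 1 + c ^ ?q + (\<Sum>i\<in>{1..<?q}. of_nat (?q choose i) * c ^ i)"
      using q1 by (simp add: add.assoc)
    also have "(\<Sum>i\<in>{1..<?q}. of_nat (?q choose i) * c ^ i) = poly P c"
      by (simp add: P_def poly_sum poly_monom)
    finally show ?thesis
      by (simp add: finite_field_power_card_eq_same)
  qed
  hence roots: "{x. poly P x = 0} = UNIV" by auto
  have "degree P \<le> ?q - 1" unfolding P_def
    by (intro degree_sum_le) (auto intro: order.trans[OF degree_monom_le])
  have "P = 0"
  proof (rule ccontr)
    assume "P \<noteq> 0"
    hence "card {x. poly P x = 0} \<le> degree P" by (rule card_poly_roots_bound)
    with roots \<open>degree P \<le> ?q - 1\<close> q1 show False by simp
  qed
  hence "coeff P k = 0" by simp
  also have "coeff P k = of_nat (?q choose k)"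
    using assms by (simp add: P_def coeff_sum coeff_monom)
  finally show ?thesis .
qed

lemma card_finite_field_gt_1: "CARD('a::finite_field) > 1"
proof -
  have "card {0, 1 :: 'a} \<le> CARD('a)" by (intro card_mono) auto
  thus ?thesis by simp
qed

lemma of_nat_card_eq_0: "of_nat (CARD('a)) = (0 :: 'a :: finite_field)"
  using binomial_card_eq_0[of 1, where 'a = 'a] card_finite_field_gt_1[where 'a = 'a] by simp

lemma power_card_minus_1:
  fixes c :: "'a :: finite_field"
  assumes "c \<noteq> 0"
  shows "c ^ (CARD('a) - 1) = 1"
proof -
  have "c * c ^ (CARD('a) - 1) = c * 1"
    using finite_field_power_card_eq_same[of c] card_finite_field_gt_1[where 'a = 'a]
    by (metis Suc_diff_1 less_imp_Suc_add mult.right_neutral power_Suc zero_less_Suc)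
  thus ?thesis using assms by simp
qed

text \<open>
  The polynomial \<open>X\<^sup>k - 1\<close> has too few roots to vanish at all nonzero elements, and replacing \<open>c\<close> by
  \<open>e c\<close> with \<open>e\<^sup>k \<noteq> 1\<close> multiplies the sum by \<open>e\<^sup>k\<close>.
\<close>

lemma sum_finite_field_power_eq_0:
  assumes "k < CARD('a) - 1"
  shows "(\<Sum>c\<in>UNIV. c ^ k) = (0 :: 'a :: finite_field)"
proof (cases "k = 0")
  case True
  thus ?thesis by (simp add: of_nat_card_eq_0)
next
  case False
  define P :: "'a poly" where "P = monom 1 k - 1"
  have cP: "coeff P k = 1" using False by (simp add: P_def)
  have "P \<noteq> 0" using cP by auto
  have "degree P \<le> k" unfolding P_def
    by (intro degree_diff_le) (auto simp: degree_monom_le)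
  have "card {x. poly P x = 0} \<le> k"
    using card_poly_roots_bound[OF \<open>P \<noteq> 0\<close>] \<open>degree P \<le> k\<close> by simp
  moreover have "card (UNIV - {0 :: 'a}) = CARD('a) - 1" by (simp add: card_Diff_singleton)
  ultimately have "\<not> (UNIV - {0} \<subseteq> {x. poly P x = 0})"
    using assms card_mono[of "{x. poly P x = 0}" "UNIV - {0}"] by force
  then obtain e where "e \<noteq> 0" "poly P e \<noteq> 0" by auto
  hence e: "e \<noteq> 0" "e ^ k \<noteq> 1" by (simp_all add: P_def poly_monom)
  have "(\<Sum>c\<in>UNIV. c ^ k) = (\<Sum>c\<in>UNIV. (e * c) ^ k)"
    by (rule sum.reindex_bij_witness[of _ "\<lambda>c. e * c" "\<lambda>c. c / e"]) (use e in auto)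
  also have "\<dots> = e ^ k * (\<Sum>c\<in>UNIV. c ^ k)"
    by (simp add: power_mult_distrib sum_distrib_left)
  finally have "(1 - e ^ k) * (\<Sum>c\<in>UNIV. c ^ k) = 0" by (simp add: algebra_simps)
  thus ?thesis using e by simp
qed

lemma sum_nonzero_power_eq_minus_1:
  assumes "(CARD('a) - 1) dvd k"
  shows "(\<Sum>c\<in>UNIV-{0}. c ^ k) = (-1 :: 'a :: finite_field)"
proof -
  obtain m where m: "k = (CARD('a) - 1) * m" using assms by blast
  have "(\<Sum>c\<in>UNIV-{0}. c ^ k) = (\<Sum>c\<in>UNIV-{0 :: 'a}. 1 :: 'a)"
    by (intro sum.cong refl) (simp add: m power_mult power_card_minus_1 del: One_nat_def)
  also have "\<dots> = of_nat (CARD('a) - 1)" by (simp add: card_Diff_singleton)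
  also have "\<dots> = -1"
    using card_finite_field_gt_1[where 'a = 'a] by (simp add: of_nat_diff of_nat_card_eq_0)
  finally show ?thesis .
qed


section \<open>Absolute value and convergence\<close>

context C_infinity
begin

definition absv :: "'c \<Rightarrow> real" where "absv x = dist x 0"

definition cst :: "'a \<Rightarrow> 'c" where "cst c = \<iota> (fls_const c)"

lemma \<iota>_0 [simp]: "\<iota> 0 = 0"
  using hom_add[of 0 0] by (metis add_cancel_right_right add_0)

lemma cst_0 [simp]: "cst 0 = 0" and cst_1 [simp]: "cst 1 = 1"
  by (simp_all add: cst_def hom_one)

lemma cst_add: "cst (a + b) = cst a + cst b"
  by (simp add: cst_def hom_add flip: fls_plus_const)

lemma cst_mult: "cst (a * b) = cst a * cst b"
  by (simp add: cst_def hom_mult flip: fls_const_mult_const)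

lemma cst_uminus: "cst (- a) = - cst a"
  using cst_add[of a "-a"] by (simp add: eq_neg_iff_add_eq_0 add.commute)

lemma cst_power: "cst (a ^ n) = cst a ^ n"
  by (induction n) (simp_all add: cst_mult)

lemma cst_sum: "cst (sum f B) = (\<Sum>x\<in>B. cst (f x))"
  by (induction B rule: infinite_finite_induct) (simp_all add: cst_add)

lemma cst_of_nat: "cst (of_nat n) = of_nat n"
  by (induction n) (simp_all add: cst_add)

lemma absv_nonneg [simp]: "absv x \<ge> 0" by (simp add: absv_def)
lemma absv_0 [simp]: "absv 0 = 0" by (simp add: absv_def)
lemma absv_eq_0_iff [simp]: "absv x = 0 \<longleftrightarrow> x = 0" by (simp add: absv_def)
lemma absv_mult: "absv (x * y) = absv x * absv y"
  by (simp add: absv_def abs_mult)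

lemma absv_1 [simp]: "absv 1 = 1"
  using absv_mult[of 1 1] by simp

lemma absv_power: "absv (x ^ n) = absv x ^ n"
  by (induction n) (simp_all add: absv_mult)

lemma absv_uminus [simp]: "absv (- x) = absv x"
proof -
  have "absv (-1) ^ 2 = 1" by (simp flip: absv_power)
  hence "absv (-1) = 1" by (simp add: power2_eq_1_iff) (smt (verit) absv_nonneg)
  thus ?thesis using absv_mult[of "-1" x] by simp
qed

lemma absv_add_le: "absv (x + y) \<le> max (absv x) (absv y)"
  by (simp add: absv_def abs_ultrametric)

lemma absv_diff_le: "absv (x - y) \<le> max (absv x) (absv y)"
  using absv_add_le[of x "-y"] by simp

lemma absv_sum_le:
  assumes "\<And>x. x \<in> B \<Longrightarrow> absv (f x) \<le> M" "M \<ge> 0"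
  shows "absv (sum f B) \<le> M"
  using assms(1)
proof (induction B rule: infinite_finite_induct)
  case (insert x F)
  have "absv (f x + sum f F) \<le> max (absv (f x)) (absv (sum f F))" by (rule absv_add_le)
  also have "\<dots> \<le> M" using insert by simp
  finally show ?case using insert by simp
qed (use assms in auto)

lemma absv_prod: "absv (prod f B) = (\<Prod>x\<in>B. absv (f x))"
  by (induction B rule: infinite_finite_induct) (simp_all add: absv_mult)

lemma absv_inverse: "absv (inverse x) = inverse (absv x)"
proof (cases "x = 0")
  case False
  hence "absv x * absv (inverse x) = 1" by (simp flip: absv_mult)
  thus ?thesis by (metis inverse_unique)
qed simp

lemma absv_divide: "absv (x / y) = absv x / absv y"
  by (simp add: divide_inverse absv_mult absv_inverse)

lemma absv_add_eq_left:
  assumes "absv y < absv x"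
  shows "absv (x + y) = absv x"
proof (rule antisym)
  show "absv (x + y) \<le> absv x" using absv_add_le[of x y] assms by simp
  show "absv x \<le> absv (x + y)" using absv_diff_le[of "x + y" y] assms by simp
qed

lemma absv_\<theta>: "absv \<theta> = 2"
proof -
  have "absv \<theta> = dist (fls_X_inv :: 'a fls) 0"
    unfolding absv_def \<theta>_def using isometry[of fls_X_inv 0] by simp
  also have "\<dots> = 2" by (simp add: dist_fls_def)
  finally show ?thesis .
qed

lemma absv_cst: "c \<noteq> 0 \<Longrightarrow> absv (cst c) = 1"
  unfolding absv_def cst_def using isometry[of "fls_const c" 0] by (simp add: dist_fls_def)

lemma absv_cst_le: "absv (cst c) \<le> 1"
  by (cases "c = 0") (simp_all add: absv_cst)

lemma cst_eq_0_iff [simp]: "cst c = 0 \<longleftrightarrow> c = 0"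
  using absv_cst[of c] by (metis absv_0 cst_0 zero_neq_one)

lemma \<theta>_nonzero [simp]: "\<theta> \<noteq> 0"
  using absv_\<theta> by auto

text \<open>
  The type of \<open>C\<^sub>\<infinity>\<close> is a field and a metric space, with no type class that connects the two
  structures. The continuity of the field operations comes from the absolute value.
\<close>

lemma tendsto_iff_absv: "(f \<longlongrightarrow> L) Fi \<longleftrightarrow> ((\<lambda>x. absv (f x - L)) \<longlongrightarrow> 0) Fi"
  by (subst tendsto_dist_iff) (simp add: absv_def dist_diff[of _ L])

lemma tendsto_absv_le:
  assumes "eventually (\<lambda>x. absv (f x - L) \<le> g x) Fi" "(g \<longlongrightarrow> 0) Fi"
  shows "(f \<longlongrightarrow> L) Fi"
  unfolding tendsto_iff_absv
  by (rule tendsto_sandwich[OF _ assms(1) tendsto_const assms(2)]) simp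

lemma tendsto_plus:
  assumes "(f \<longlongrightarrow> a) Fi" "(g \<longlongrightarrow> b) Fi"
  shows "((\<lambda>x. f x + g x :: 'c) \<longlongrightarrow> a + b) Fi"
proof (rule tendsto_absv_le)
  show "((\<lambda>x. absv (f x - a) + absv (g x - b)) \<longlongrightarrow> 0) Fi"
    using assms by (auto simp: tendsto_iff_absv intro: tendsto_add_zero)
  show "\<forall>\<^sub>F x in Fi. absv (f x + g x - (a + b)) \<le> absv (f x - a) + absv (g x - b)"
  proof (rule always_eventually, rule allI)
    fix x
    have "absv (f x + g x - (a + b)) = absv ((f x - a) + (g x - b))" by (simp add: algebra_simps)
    also have "\<dots> \<le> max (absv (f x - a)) (absv (g x - b))" by (rule absv_add_le)
    finally show "absv (f x + g x - (a + b)) \<le> absv (f x - a) + absv (g x - b)"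
      using absv_nonneg[of "f x - a"] absv_nonneg[of "g x - b"] by linarith
  qed
qed

lemma tendsto_absv: "(f \<longlongrightarrow> a) Fi \<Longrightarrow> ((\<lambda>x. absv (f x)) \<longlongrightarrow> absv a) Fi"
  unfolding absv_def by (intro tendsto_intros)

lemma tendsto_times:
  assumes "(f \<longlongrightarrow> a) Fi" "(g \<longlongrightarrow> b) Fi"
  shows "((\<lambda>x. f x * g x :: 'c) \<longlongrightarrow> a * b) Fi"
proof (rule tendsto_absv_le)
  show "((\<lambda>x. absv (f x) * absv (g x - b) + absv (f x - a) * absv b) \<longlongrightarrow> 0) Fi"
    using tendsto_add[OF tendsto_mult[OF tendsto_absv[OF assms(1)] assms(2)[unfolded tendsto_iff_absv]]
      tendsto_mult[OF assms(1)[unfolded tendsto_iff_absv] tendsto_const[of "absv b"]]] by simp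
  show "\<forall>\<^sub>F x in Fi. absv (f x * g x - a * b) \<le> absv (f x) * absv (g x - b) + absv (f x - a) * absv b"
  proof (rule always_eventually, rule allI)
    fix x
    have "absv (f x * g x - a * b) = absv (f x * (g x - b) + (f x - a) * b)" by (simp add: algebra_simps)
    also have "\<dots> \<le> max (absv (f x * (g x - b))) (absv ((f x - a) * b))" by (rule absv_add_le)
    finally show "absv (f x * g x - a * b) \<le> absv (f x) * absv (g x - b) + absv (f x - a) * absv b"
      by (simp add: absv_mult) (smt (verit) absv_nonneg mult_nonneg_nonneg)
  qed
qed

lemma tendsto_pow: "(f \<longlongrightarrow> a) Fi \<Longrightarrow> ((\<lambda>x. f x ^ n :: 'c) \<longlongrightarrow> a ^ n) Fi"
  by (induction n) (auto intro: tendsto_times)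

lemma tendsto_Prod:
  "(\<And>i. i \<in> I \<Longrightarrow> (f i \<longlongrightarrow> a i) Fi) \<Longrightarrow> ((\<lambda>x. \<Prod>i\<in>I. f i x :: 'c) \<longlongrightarrow> (\<Prod>i\<in>I. a i)) Fi"
  by (induction I rule: infinite_finite_induct) (auto intro: tendsto_times)

lemma tendsto_Sum:
  "(\<And>i. i \<in> I \<Longrightarrow> (f i \<longlongrightarrow> a i) Fi) \<Longrightarrow> ((\<lambda>x. \<Sum>i\<in>I. f i x :: 'c) \<longlongrightarrow> (\<Sum>i\<in>I. a i)) Fi"
  by (induction I rule: infinite_finite_induct) (auto intro: tendsto_plus)

text \<open>
  By the ultrametric inequality a finite block of a series is no larger than its largest term.
\<close>

lemma convergent_partial_sums:
  assumes "f \<longlonglongrightarrow> 0"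
  shows "convergent (\<lambda>N. \<Sum>d<N. f d :: 'c)"
proof -
  have "Cauchy (\<lambda>N. \<Sum>d<N. f d)"
  proof (rule metric_CauchyI)
    fix e :: real assume e: "e > 0"
    have "(\<lambda>d. absv (f d)) \<longlonglongrightarrow> 0" using assms by (simp add: tendsto_iff_absv)
    hence "eventually (\<lambda>d. absv (f d) < e / 2) sequentially" using e by (intro order_tendstoD(2)[of _ 0]) auto
    then obtain M where M: "\<And>d. d \<ge> M \<Longrightarrow> absv (f d) < e / 2" by (auto simp: eventually_sequentially)
    have *: "dist (\<Sum>d<m. f d) (\<Sum>d<n. f d) < e" if "m \<ge> M" "m \<le> n" for m n
    proof -
      have "(\<Sum>d<n. f d) - (\<Sum>d<m. f d) = (\<Sum>d\<in>{m..<n}. f d)"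
        using that by (simp add: lessThan_atLeast0 sum_diff_nat_ivl)
      hence "dist (\<Sum>d<n. f d) (\<Sum>d<m. f d) = absv (\<Sum>d\<in>{m..<n}. f d)"
        by (subst dist_diff) (simp add: absv_def)
      also have "\<dots> \<le> e / 2" using e M that by (intro absv_sum_le) (auto intro: less_imp_le)
      also have "\<dots> < e" using e by simp
      finally show ?thesis by (simp add: dist_commute)
    qed
    show "\<exists>M. \<forall>m\<ge>M. \<forall>n\<ge>M. dist (\<Sum>d<m. f d) (\<Sum>d<n. f d) < e"
      by (rule exI[of _ M]) (metis * dist_commute nle_le)
  qed
  thus ?thesis by (rule Cauchy_convergent)
qed

text \<open>
  One exhausting sequence of finite sets decides about unordered summability: by the ultrametric
  inequality, adding any number of small terms changes a partial sum only a little.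
\<close>

lemma has_sum_nonarchimedean:
  assumes "\<And>N. finite (B N)" "\<And>N. B N \<subseteq> I" "(\<lambda>N. sum g (B N)) \<longlonglongrightarrow> L"
    and "\<And>e. e > 0 \<Longrightarrow> eventually (\<lambda>N. \<forall>i\<in>I - B N. absv (g i) \<le> e) sequentially"
  shows "(g has_sum L) I"
  unfolding has_sum_def
proof (rule tendstoI)
  fix e :: real assume e: "e > 0"
  have "eventually (\<lambda>N. absv (sum g (B N) - L) < e/2) sequentially"
    using assms(3) e unfolding tendsto_iff_absv by (intro order_tendstoD(2)[of _ 0]) auto
  moreover have "eventually (\<lambda>N. \<forall>i\<in>I - B N. absv (g i) \<le> e/2) sequentially"
    using assms(4)[of "e/2"] e by simp
  ultimately have "eventually (\<lambda>N. absv (sum g (B N) - L) < e/2 \<and> (\<forall>i\<in>I - B N. absv (g i) \<le> e/2)) sequentially"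
    by (rule eventually_conj)
  then obtain N where N: "absv (sum g (B N) - L) < e/2" "\<forall>i\<in>I - B N. absv (g i) \<le> e/2"
    by (auto simp: eventually_sequentially)
  show "\<forall>\<^sub>F X in finite_subsets_at_top I. dist (sum g X) L < e"
    unfolding eventually_finite_subsets_at_top
  proof (intro exI[of _ "B N"] conjI allI impI)
    fix X assume X: "finite X \<and> B N \<subseteq> X \<and> X \<subseteq> I"
    have "sum g X = sum g (B N) + sum g (X - B N)"
      using X by (metis sum.subset_diff add.commute)
    hence "dist (sum g X) L = absv ((sum g (B N) - L) + sum g (X - B N))"
      by (subst dist_diff) (simp add: absv_def algebra_simps)
    also have "\<dots> \<le> max (absv (sum g (B N) - L)) (absv (sum g (X - B N)))" by (rule absv_add_le)
    also have "\<dots> \<le> e / 2" using N e X by (intro max.boundedI absv_sum_le) auto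
    finally show "dist (sum g X) L < e" using e by simp
  qed (use assms in auto)
qed


section \<open>The Frobenius map and evaluation of polynomials\<close>

lemma q_gt_1: "q > 1"
  unfolding q_def by (rule card_finite_field_gt_1)

lemma q_pos [simp]: "q > 0" using q_gt_1 by linarith

lemma of_nat_q [simp]: "of_nat q = (0 :: 'c)"
  using of_nat_card_eq_0[where 'a = 'a] cst_of_nat[of q] by (simp add: q_def)

lemma cst_power_q [simp]: "cst c ^ q = cst c"
  by (simp add: q_def finite_field_power_card_eq_same flip: cst_power)

lemma cst_power_q_power [simp]: "cst c ^ (q ^ n) = cst c"
  by (induction n) (simp_all add: power_mult)

lemma add_power_q: "(x + y :: 'c) ^ q = x ^ q + y ^ q"
proof -
  have "(x + y) ^ q = (\<Sum>i\<le>q. of_nat (q choose i) * x ^ i * y ^ (q - i))"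
    by (rule binomial_ring)
  also have "\<dots> = (\<Sum>i\<in>{0, q}. of_nat (q choose i) * x ^ i * y ^ (q - i))"
  proof (rule sum.mono_neutral_right)
    show "\<forall>i\<in>{..q} - {0, q}. of_nat (q choose i) * x ^ i * y ^ (q - i) = 0"
    proof
      fix i assume "i \<in> {..q} - {0, q}"
      hence "of_nat (q choose i) = (0 :: 'a)"
        unfolding q_def by (intro binomial_card_eq_0) auto
      hence "of_nat (q choose i) = (0 :: 'c)" by (metis cst_of_nat cst_0)
      thus "of_nat (q choose i) * x ^ i * y ^ (q - i) = 0" by simp
    qed
  qed auto
  also have "\<dots> = x ^ q + y ^ q" using q_gt_1 by simp
  finally show ?thesis .
qed

lemma add_power_q_power: "(x + y :: 'c) ^ (q ^ n) = x ^ (q ^ n) + y ^ (q ^ n)"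
  by (induction n) (simp_all add: power_mult add_power_q mult.commute[of q])

lemma uminus_power_q: "(- x :: 'c) ^ q = - (x ^ q)"
  using add_power_q[of x "-x"] by (simp add: zero_power eq_neg_iff_add_eq_0 add.commute)

lemma diff_power_q: "(x - y :: 'c) ^ q = x ^ q - y ^ q"
  using add_power_q[of x "-y"] by (simp add: uminus_power_q)

lemma eval_at_eq: "eval_at a t = poly (map_poly cst a) t"
proof -
  have "(\<lambda>c. \<iota> (fls_const c)) = cst" by (auto simp: cst_def)
  thus ?thesis by (simp add: eval_at_def)
qed

lemma eval_at_pCons [simp]: "eval_at (pCons a p) t = cst a + t * eval_at p t"
  by (cases "pCons a p = 0") (auto simp: eval_at_eq map_poly_pCons)

lemma eval_at_0 [simp]: "eval_at 0 t = 0"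
  by (simp add: eval_at_eq)

lemma eval_at_1 [simp]: "eval_at 1 t = 1"
  unfolding one_pCons by (simp)

lemma eval_at_add: "eval_at (a + b) t = eval_at a t + eval_at b t"
  by (induction a b rule: poly_induct2) (simp_all add: cst_add algebra_simps)

lemma eval_at_smult: "eval_at (smult c a) t = cst c * eval_at a t"
  by (induction a) (simp_all add: cst_mult algebra_simps)

lemma eval_at_uminus: "eval_at (- a) t = - eval_at a t"
  using eval_at_smult[of "-1" a t] by (simp add: cst_uminus)

lemma eval_at_diff: "eval_at (a - b) t = eval_at a t - eval_at b t"
  using eval_at_add[of a "-b"] by (simp add: eval_at_uminus)

lemma eval_at_mult: "eval_at (a * b) t = eval_at a t * eval_at b t"
  by (induction a) (simp_all add: eval_at_add eval_at_smult algebra_simps)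

lemma eval_at_sum: "eval_at (sum f B) t = (\<Sum>x\<in>B. eval_at (f x) t)"
  by (induction B rule: infinite_finite_induct) (simp_all add: eval_at_add)

lemma eval_at_monom: "eval_at (monom c n) t = cst c * t ^ n"
  by (induction n) (simp_all add: monom_0 monom_Suc algebra_simps)

lemma eval_at_power_q_power: "eval_at a (t ^ (q ^ n)) = eval_at a t ^ (q ^ n)"
  by (induction a) (simp_all add: zero_power add_power_q_power power_mult_distrib)

lemma absv_eval_at: "a \<noteq> 0 \<Longrightarrow> absv (eval_at a \<theta>) = 2 ^ degree a"
proof (induction a)
  case (pCons c p)
  show ?case
  proof (cases "p = 0")
    case True
    with pCons show ?thesis by (simp add: absv_cst)
  next
    case False
    have "absv (cst c) < absv (\<theta> * eval_at p \<theta>)"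
      using pCons.IH[OF False] absv_cst_le[of c] one_le_power[of "2::real" "degree p"]
      unfolding absv_mult absv_\<theta> by linarith
    from absv_add_eq_left[OF this] show ?thesis
      using pCons.IH False by (simp add: absv_mult absv_\<theta> add.commute)
  qed
qed simp

lemma eval_at_\<theta>_eq_0_iff [simp]: "eval_at a \<theta> = 0 \<longleftrightarrow> a = 0"
proof
  assume "eval_at a \<theta> = 0"
  thus "a = 0" using absv_eval_at[of a] by (metis absv_0 power_eq_0_iff zero_neq_numeral)
qed simp

lemma K_eval_at: "eval_at a \<theta> \<in> K"
  unfolding K_def by (intro CollectI exI[of _ a] exI[of _ 1]) simp

lemma K_0 [simp]: "0 \<in> K" and K_1 [simp]: "1 \<in> K" and K_\<theta> [simp]: "\<theta> \<in> K"
  and K_cst [simp]: "cst c \<in> K"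
  using K_eval_at[of 0] K_eval_at[of 1] K_eval_at[of "[:0,1:]"] K_eval_at[of "[:c:]"] by simp_all

lemma K_mult: "x \<in> K \<Longrightarrow> y \<in> K \<Longrightarrow> x * y \<in> K"
proof -
  assume "x \<in> K" "y \<in> K"
  then obtain a b c d where "x = eval_at a \<theta> / eval_at b \<theta>" "b \<noteq> 0" "y = eval_at c \<theta> / eval_at d \<theta>" "d \<noteq> 0"
    unfolding K_def by auto
  thus ?thesis unfolding K_def
    by (intro CollectI exI[of _ "a * c"] exI[of _ "b * d"]) (simp add: eval_at_mult)
qed

lemma K_add: "x \<in> K \<Longrightarrow> y \<in> K \<Longrightarrow> x + y \<in> K"
proof -
  assume "x \<in> K" "y \<in> K"
  then obtain a b c d where "x = eval_at a \<theta> / eval_at b \<theta>" "b \<noteq> 0" "y = eval_at c \<theta> / eval_at d \<theta>" "d \<noteq> 0"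
    unfolding K_def by auto
  thus ?thesis unfolding K_def
    by (intro CollectI exI[of _ "a * d + c * b"] exI[of _ "b * d"])
      (simp add: eval_at_mult eval_at_add add_frac_eq)
qed

lemma K_inverse: "x \<in> K \<Longrightarrow> inverse x \<in> K"
proof -
  assume "x \<in> K"
  then obtain a b where ab: "x = eval_at a \<theta> / eval_at b \<theta>" "b \<noteq> 0"
    unfolding K_def by auto
  show ?thesis
  proof (cases "a = 0")
    case False
    hence "inverse x = eval_at b \<theta> / eval_at a \<theta>" by (simp add: ab)
    thus ?thesis unfolding K_def using False by blast
  qed (use ab in simp)
qed

lemma K_uminus: "x \<in> K \<Longrightarrow> - x \<in> K"
  using K_mult[OF K_cst[of "-1"], of x] by (simp add: cst_uminus del: K_cst)

lemma K_diff: "x \<in> K \<Longrightarrow> y \<in> K \<Longrightarrow> x - y \<in> K"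
  using K_add[of x "-y"] K_uminus by simp

lemma K_divide: "x \<in> K \<Longrightarrow> y \<in> K \<Longrightarrow> x / y \<in> K"
  by (simp add: divide_inverse K_mult K_inverse)

lemma K_power: "x \<in> K \<Longrightarrow> x ^ n \<in> K"
  by (induction n) (auto intro: K_mult)

lemma K_sum: "(\<And>i. i \<in> I \<Longrightarrow> f i \<in> K) \<Longrightarrow> sum f I \<in> K"
  by (induction I rule: infinite_finite_induct) (auto intro: K_add)

lemma K_prod: "(\<And>i. i \<in> I \<Longrightarrow> f i \<in> K) \<Longrightarrow> prod f I \<in> K"
  by (induction I rule: infinite_finite_induct) (auto intro: K_mult)

end


section \<open>Polynomials of bounded degree\<close>

definition polys_lt :: "nat \<Rightarrow> 'a :: finite_field poly set" where
  "polys_lt d = {p. \<forall>i\<ge>d. coeff p i = 0}"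

definition monics :: "nat \<Rightarrow> 'a :: finite_field poly set" where
  "monics d = {a \<in> monic_polys. degree a = d}"

lemma polys_lt_0 [simp]: "polys_lt 0 = {0}"
  by (auto simp: polys_lt_def intro: poly_eqI)

lemma polys_lt_iff: "p \<in> polys_lt d \<longleftrightarrow> p = 0 \<or> degree p < d"
proof -
  have "p = 0 \<or> degree p < d" if "\<forall>i\<ge>d. coeff p i = 0"
    using that by (metis leading_coeff_0_iff not_le)
  thus ?thesis by (auto simp: polys_lt_def coeff_eq_0)
qed

lemma bij_betw_polys_lt_Suc:
  "bij_betw (\<lambda>(c, b). b + monom c d) (UNIV \<times> polys_lt d) (polys_lt (Suc d) :: 'a :: finite_field poly set)"
proof (rule bij_betw_byWitness[where f' = "\<lambda>p. (coeff p d, p - monom (coeff p d) d)"])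
  show "\<forall>a\<in>UNIV \<times> polys_lt d.
       (coeff (case a of (c, b) \<Rightarrow> b + monom c d) d,
        (case a of (c, b) \<Rightarrow> b + monom c d) - monom (coeff (case a of (c, b) \<Rightarrow> b + monom c d) d) d) = a"
    by (auto simp: polys_lt_def)
qed (auto simp: polys_lt_def coeff_monom)

lemma sum_polys_lt_Suc:
  "sum g (polys_lt (Suc d)) = (\<Sum>c\<in>UNIV. \<Sum>b\<in>polys_lt d. g (b + monom c d))"
  by (simp add: sum.cartesian_product sum.reindex_bij_betw[OF bij_betw_polys_lt_Suc, symmetric]
      case_prod_unfold)

lemma finite_polys_lt [simp]: "finite (polys_lt d :: 'a :: finite_field poly set)"
proof (induction d)
  case (Suc d)
  hence "finite ((UNIV :: 'a set) \<times> (polys_lt d :: 'a poly set))" by simp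
  thus ?case using bij_betw_finite[OF bij_betw_polys_lt_Suc[of d, where 'a = 'a]] by blast
qed simp

lemma bij_betw_monics:
  "bij_betw (\<lambda>b. monom 1 d + b) (polys_lt d) (monics d :: 'a :: finite_field poly set)"
proof (rule bij_betw_byWitness[where f' = "\<lambda>p. p - monom 1 d"])
  show "(\<lambda>b. monom 1 d + b) ` polys_lt d \<subseteq> (monics d :: 'a poly set)"
  proof safe
    fix b :: "'a poly" assume "b \<in> polys_lt d"
    hence "b = 0 \<or> degree b < d" by (simp add: polys_lt_iff)
    hence "degree (monom 1 d + b) = d"
      by (metis add.right_neutral degree_add_eq_left degree_monom_eq zero_neq_one)
    moreover have "coeff (monom 1 d + b) d = 1" using \<open>b \<in> polys_lt d\<close> by (simp add: polys_lt_def)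
    ultimately show "monom 1 d + b \<in> monics d" by (simp add: monics_def monic_polys_def)
  qed
  show "(\<lambda>p. p - monom 1 d) ` monics d \<subseteq> (polys_lt d :: 'a poly set)"
    by (auto simp: monics_def monic_polys_def polys_lt_def coeff_monom coeff_eq_0)
qed auto

lemma sum_monics: "sum g (monics d) = (\<Sum>b\<in>polys_lt d. g (monom 1 d + b))"
  by (simp add: sum.reindex_bij_betw[OF bij_betw_monics])

lemma finite_monics [simp]: "finite (monics d :: 'a :: finite_field poly set)"
  using bij_betw_finite[OF bij_betw_monics[of d, where 'a = 'a]] by simp

lemma monics_nonzero: "a \<in> monics d \<Longrightarrow> a \<noteq> 0"
  by (auto simp: monics_def monic_polys_def)

lemma sum_polys_lt_nonzero:
  "sum g (polys_lt d - {0 :: 'a :: finite_field poly}) =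
     (\<Sum>c\<in>UNIV-{0}. \<Sum>e<d. \<Sum>n\<in>monics e. g (smult c n))"
proof -
  have "bij_betw (\<lambda>(c, n). smult c n) ((UNIV - {0}) \<times> (\<Union>e<d. monics e)) (polys_lt d - {0 :: 'a poly})"
    by (rule bij_betw_byWitness[where f' = "\<lambda>p. (lead_coeff p, smult (inverse (lead_coeff p)) p)"])
       (auto simp: monics_def monic_polys_def polys_lt_iff)
  hence "sum g (polys_lt d - {0}) =
    (\<Sum>(c, n)\<in>(UNIV - {0}) \<times> (\<Union>e<d. monics e). g (smult c n))"
    by (subst sum.reindex_bij_betw[symmetric]) (auto simp: case_prod_unfold)
  also have "\<dots> = (\<Sum>c\<in>UNIV-{0}. \<Sum>n\<in>(\<Union>e<d. monics e). g (smult c n))"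
    by (simp add: sum.cartesian_product)
  also have "\<dots> = (\<Sum>c\<in>UNIV-{0}. \<Sum>e<d. \<Sum>n\<in>monics e. g (smult c n))"
    by (intro sum.cong refl sum.UNION_disjoint ballI finite_monics) (auto simp: monics_def)
  finally show ?thesis .
qed


section \<open>Cancellation in sums of products of affine forms\<close>

context C_infinity
begin

text \<open>
  Affine functions of the coefficients of \<open>b\<close>. The size \<open>M\<close> of the form is kept apart from the weights
  \<open>\<epsilon> i\<close> of the coefficients, which are common to all forms of a product: in the bounds below, the
  sizes of the forms multiply, and each weight occurs once.
\<close>

definition bounded_form :: "nat \<Rightarrow> (nat \<Rightarrow> real) \<Rightarrow> real \<Rightarrow> ('a poly \<Rightarrow> 'c) \<Rightarrow> bool" where
  "bounded_form d \<epsilon> M f \<longleftrightarrow> (\<exists>\<alpha> \<beta>. absv \<alpha> \<le> M \<and> (\<forall>i<d. absv (\<beta> i) \<le> M * \<epsilon> i) \<and>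
     (\<forall>b\<in>polys_lt d. f b = \<alpha> + (\<Sum>i<d. cst (coeff b i) * \<beta> i)))"

text \<open>
  The source of all cancellation. Expand the product in powers of the top coefficient \<open>c\<close> of \<open>b\<close>. The
  term free of \<open>c\<close> is multiplied by \<open>\<Sum>\<^sub>c 1 = q = 0\<close>, and every other term contains some \<open>\<beta> l d\<close> and
  thereby gains the factor \<open>\<epsilon> d\<close>; the sum over the remaining coefficients of \<open>b\<close> has the same shape,
  with fewer forms.
\<close>

lemma sum_affine_products_bound:
  fixes L :: "'l set"
  assumes "finite L" "\<And>l. l \<in> L \<Longrightarrow> absv (\<alpha> l) \<le> M l"
    and "\<And>l i. l \<in> L \<Longrightarrow> i < d \<Longrightarrow> absv (\<beta> l i) \<le> M l * \<epsilon> i"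
    and "\<And>i. i < d \<Longrightarrow> 0 \<le> \<epsilon> i \<and> \<epsilon> i \<le> 1"
  shows "absv (\<Sum>b\<in>polys_lt d. \<Prod>l\<in>L. \<alpha> l + (\<Sum>i<d. cst (coeff b i) * \<beta> l i))
           \<le> (\<Prod>l\<in>L. M l) * (\<Prod>i<d. \<epsilon> i)"
  using assms
proof (induction d arbitrary: L)
  case 0
  thus ?case by (auto simp: absv_prod intro: prod_mono)
next
  case (Suc d)
  have Mnn: "M l \<ge> 0" if "l \<in> L" for l using Suc.prems(2)[OF that] absv_nonneg[of "\<alpha> l"] by linarith
  define A where "A = (\<lambda>b l. \<alpha> l + (\<Sum>i<d. cst (coeff b i) * \<beta> l i))"
  define E where "E = (\<Prod>i<d. \<epsilon> i)"
  have E0: "E \<ge> 0" unfolding E_def using Suc.prems(4) by (intro prod_nonneg) auto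
  have "(\<Sum>b\<in>polys_lt (Suc d). \<Prod>l\<in>L. \<alpha> l + (\<Sum>i<Suc d. cst (coeff b i) * \<beta> l i))
    = (\<Sum>c\<in>UNIV. \<Sum>b\<in>polys_lt d. \<Prod>l\<in>L. cst c * \<beta> l d + A b l)"
    unfolding sum_polys_lt_Suc
    by (intro sum.cong prod.cong refl)
       (auto simp: A_def coeff_monom polys_lt_def algebra_simps intro!: sum.cong)
  also have "\<dots> = (\<Sum>c\<in>UNIV. \<Sum>b\<in>polys_lt d. \<Sum>X\<in>Pow L.
      cst c ^ card X * (\<Prod>l\<in>X. \<beta> l d) * (\<Prod>l\<in>L-X. A b l))"
    by (simp add: prod_add[OF Suc.prems(1)] prod.distrib)
  also have "\<dots> = (\<Sum>X\<in>Pow L. (\<Sum>c\<in>UNIV. cst c ^ card X) * (\<Prod>l\<in>X. \<beta> l d) * (\<Sum>b\<in>polys_lt d. \<Prod>l\<in>L-X. A b l))"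
  proof -
    have "(\<Sum>c\<in>UNIV. \<Sum>b\<in>polys_lt d. \<Sum>X\<in>Pow L. g c b X) =
      (\<Sum>X\<in>Pow L. \<Sum>c\<in>UNIV. \<Sum>b\<in>polys_lt d. g c b X)" for g :: "'a \<Rightarrow> 'a poly \<Rightarrow> 'l set \<Rightarrow> 'c"
      by (subst sum.swap[of _ "UNIV" "Pow L"]) (intro sum.cong refl sum.swap)
    thus ?thesis by (simp add: sum_distrib_left sum_distrib_right mult_ac)
  qed
  also have "absv \<dots> \<le> (\<Prod>l\<in>L. M l) * (\<Prod>i<Suc d. \<epsilon> i)"
  proof (rule absv_sum_le)
    fix X assume "X \<in> Pow L"
    hence X: "X \<subseteq> L" "finite X" using Suc.prems(1) finite_subset by auto
    show "absv ((\<Sum>c\<in>UNIV. cst c ^ card X) * (\<Prod>l\<in>X. \<beta> l d) * (\<Sum>b\<in>polys_lt d. \<Prod>l\<in>L-X. A b l))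
      \<le> (\<Prod>l\<in>L. M l) * (\<Prod>i<Suc d. \<epsilon> i)"
    proof (cases "X = {}")
      case True
      have "of_nat CARD('a) = (0 :: 'c)" using of_nat_q by (simp add: q_def)
      thus ?thesis using True Mnn Suc.prems(4) by (auto intro!: mult_nonneg_nonneg prod_nonneg)
    next
      case False
      have e: "0 \<le> \<epsilon> d" "\<epsilon> d \<le> 1" using Suc.prems(4) by auto
      have "absv (\<Sum>c\<in>UNIV. cst c ^ card X) \<le> 1"
        by (intro absv_sum_le) (auto simp: absv_power absv_cst_le intro: power_le_one)
      moreover have "absv (\<Prod>l\<in>X. \<beta> l d) \<le> (\<Prod>l\<in>X. M l) * \<epsilon> d"
      proof -
        have "absv (\<Prod>l\<in>X. \<beta> l d) \<le> (\<Prod>l\<in>X. M l * \<epsilon> d)"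
          unfolding absv_prod using X Suc.prems(3) by (intro prod_mono) auto
        also have "\<dots> = (\<Prod>l\<in>X. M l) * \<epsilon> d ^ card X" by (simp add: prod.distrib)
        also have "\<dots> \<le> (\<Prod>l\<in>X. M l) * \<epsilon> d"
        proof (intro mult_left_mono prod_nonneg)
          have "card X > 0" using False X by (simp add: card_gt_0_iff)
          thus "\<epsilon> d ^ card X \<le> \<epsilon> d" using e power_decreasing[of 1 "card X" "\<epsilon> d"] by simp
        qed (use X Mnn in auto)
        finally show ?thesis .
      qed
      moreover have "absv (\<Sum>b\<in>polys_lt d. \<Prod>l\<in>L-X. A b l) \<le> (\<Prod>l\<in>L-X. M l) * E"
        unfolding A_def E_def using Suc.prems by (intro Suc.IH) auto
      ultimately have "absv (\<Sum>c\<in>UNIV. cst c ^ card X) * absv (\<Prod>l\<in>X. \<beta> l d) * absv (\<Sum>b\<in>polys_lt d. \<Prod>l\<in>L-X. A b l)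
        \<le> 1 * ((\<Prod>l\<in>X. M l) * \<epsilon> d) * ((\<Prod>l\<in>L-X. M l) * E)"
        using X Mnn e by (intro mult_mono) (auto intro!: mult_nonneg_nonneg prod_nonneg)
      also have "\<dots> = ((\<Prod>l\<in>X. M l) * (\<Prod>l\<in>L-X. M l)) * (E * \<epsilon> d)" by simp
      also have "(\<Prod>l\<in>X. M l) * (\<Prod>l\<in>L-X. M l) = (\<Prod>l\<in>L. M l)"
        using prod.subset_diff[OF X(1) Suc.prems(1), of M] by (simp add: mult.commute)
      finally show ?thesis by (simp add: absv_mult E_def)
    qed
  qed (use Mnn Suc.prems(4) in \<open>auto intro!: mult_nonneg_nonneg prod_nonneg\<close>)
  finally show ?case .
qed

lemma sum_forms_bound:
  assumes "finite L" "\<And>l. l \<in> L \<Longrightarrow> bounded_form d \<epsilon> (M l) (f l)"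
    and "\<And>i. i < d \<Longrightarrow> 0 \<le> \<epsilon> i \<and> \<epsilon> i \<le> 1"
  shows "absv (\<Sum>b\<in>polys_lt d. \<Prod>l\<in>L. f l b) \<le> (\<Prod>l\<in>L. M l) * (\<Prod>i<d. \<epsilon> i)"
proof -
  define W where "W = (\<lambda>l \<alpha> \<beta>. absv \<alpha> \<le> M l \<and> (\<forall>i<d. absv (\<beta> i) \<le> M l * \<epsilon> i) \<and>
     (\<forall>b\<in>polys_lt d. f l b = \<alpha> + (\<Sum>i<d. cst (coeff b i) * \<beta> i)))"
  have "\<forall>l\<in>L. \<exists>\<alpha> \<beta>. W l \<alpha> \<beta>" using assms(2) by (auto simp: W_def bounded_form_def)
  then obtain \<alpha> \<beta> where "\<And>l. l \<in> L \<Longrightarrow> W l (\<alpha> l) (\<beta> l)" by metis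
  hence *: "\<And>l. l \<in> L \<Longrightarrow> absv (\<alpha> l) \<le> M l"
    "\<And>l i. l \<in> L \<Longrightarrow> i < d \<Longrightarrow> absv (\<beta> l i) \<le> M l * \<epsilon> i"
    "\<And>l b. l \<in> L \<Longrightarrow> b \<in> polys_lt d \<Longrightarrow> f l b = \<alpha> l + (\<Sum>i<d. cst (coeff b i) * \<beta> l i)"
    by (simp_all add: W_def)
  have "(\<Sum>b\<in>polys_lt d. \<Prod>l\<in>L. f l b) = (\<Sum>b\<in>polys_lt d. \<Prod>l\<in>L. \<alpha> l + (\<Sum>i<d. cst (coeff b i) * \<beta> l i))"
    by (intro sum.cong prod.cong refl) (simp add: *)
  thus ?thesis using sum_affine_products_bound[OF assms(1) *(1,2) assms(3)] by simp
qed

text \<open>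
  Multiplying the sizes of the forms by \<open>N\<close> and dividing the weights by \<open>N\<close> preserves the hypotheses of
  the bound, and multiplies the bound by a negative power of \<open>N\<close> when there are fewer forms than
  coefficients.
\<close>

lemma sum_few_forms_eq_0:
  assumes L: "finite L" "card L < d"
    and f: "\<And>l b. l \<in> L \<Longrightarrow> b \<in> polys_lt d \<Longrightarrow> f l b = \<alpha> l + (\<Sum>i<d. cst (coeff b i) * \<beta> l i)"
  shows "(\<Sum>b\<in>polys_lt d. \<Prod>l\<in>L. f l b) = 0"
proof -
  define Y where "Y = insert 0 ((absv \<circ> \<alpha>) ` L \<union> (\<lambda>(l, i). absv (\<beta> l i)) ` (L \<times> {..<d}))"
  define B where "B = Max Y"
  have "finite Y" unfolding Y_def using L by auto
  hence B: "\<And>x. x \<in> Y \<Longrightarrow> x \<le> B" unfolding B_def by auto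
  have B0: "B \<ge> 0" by (rule B) (simp add: Y_def)
  have Ba: "absv (\<alpha> l) \<le> B" if "l \<in> L" for l using that by (intro B) (auto simp: Y_def)
  have Bb: "absv (\<beta> l i) \<le> B" if "l \<in> L" "i < d" for l i using that by (intro B) (auto simp: Y_def image_iff intro!: bexI[of _ "(l, i)"])
  let ?V = "absv (\<Sum>b\<in>polys_lt d. \<Prod>l\<in>L. f l b)"
  \<comment> \<open>Sizes \<open>B N\<close> and weights \<open>1/N\<close>, where \<open>B\<close> bounds all coefficients of the forms.\<close>
  have V: "?V \<le> B ^ card L * inverse (real (Suc n))" for n
  proof -
    let ?N = "real (Suc n)"
    have "?V \<le> (\<Prod>l\<in>L. B * ?N) * (\<Prod>i<d. inverse ?N)"
    proof (rule sum_forms_bound[OF L(1)])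
      fix l assume l: "l \<in> L"
      have "B * 1 \<le> B * ?N" using B0 by (intro mult_left_mono) auto
      moreover have BN: "B * ?N * inverse ?N = B" by (simp del: of_nat_Suc)
      ultimately show "bounded_form d (\<lambda>_. inverse ?N) (B * ?N) (f l)"
        unfolding bounded_form_def BN
        by (intro exI[of _ "\<alpha> l"] exI[of _ "\<beta> l"] conjI allI impI ballI)
           (use Ba[OF l] Bb[OF l] f[OF l] in auto)
    qed (auto simp: inverse_le_1_iff)
    also have "\<dots> = B ^ card L * (?N ^ card L * inverse ?N ^ d)"
      by (simp add: power_mult_distrib)
    also have "inverse ?N ^ d = inverse ?N ^ card L * inverse ?N ^ (d - card L)"
      using L by (simp flip: power_add)
    also have "?N ^ card L * (inverse ?N ^ card L * inverse ?N ^ (d - card L)) = inverse ?N ^ (d - card L)"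
      by (simp add: power_inverse del: of_nat_Suc)
    also have "B ^ card L * inverse ?N ^ (d - card L) \<le> B ^ card L * inverse ?N ^ 1"
      using L B0 by (intro mult_left_mono power_decreasing) (auto simp: inverse_le_1_iff)
    finally show ?thesis by simp
  qed
  have "(\<lambda>n. B ^ card L * inverse (real (Suc n))) \<longlonglongrightarrow> B ^ card L * 0"
    by (intro tendsto_mult tendsto_const LIMSEQ_inverse_real_of_nat)
  hence "?V \<le> 0" using V by (intro LIMSEQ_le_const) auto
  thus ?thesis using absv_nonneg[of "\<Sum>b\<in>polys_lt d. \<Prod>l\<in>L. f l b"] by (simp add: order.antisym)
qed

lemma eval_at_polys_lt: "b \<in> polys_lt d \<Longrightarrow> eval_at b t = (\<Sum>i<d. cst (coeff b i) * t ^ i)"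
proof -
  assume b: "b \<in> polys_lt d"
  have "b = (\<Sum>i<d. monom (coeff b i) i)"
    by (rule poly_eqI) (use b in \<open>auto simp: coeff_sum coeff_monom polys_lt_def\<close>)
  hence "eval_at b t = eval_at (\<Sum>i<d. monom (coeff b i) i) t" by simp
  thus ?thesis by (simp add: eval_at_sum eval_at_monom)
qed

lemma sum_polys_lt_power_eq_0:
  assumes "m < d"
  shows "(\<Sum>b\<in>polys_lt d. eval_at b t ^ m) = 0"
proof -
  have "(\<Sum>b\<in>polys_lt d. \<Prod>l\<in>{..<m}. eval_at b t) = 0"
    by (rule sum_few_forms_eq_0[where \<alpha> = "\<lambda>_. 0" and \<beta> = "\<lambda>_ i. t ^ i"])
       (use assms in \<open>auto simp only: eval_at_polys_lt finite_lessThan card_lessThan add_0_left\<close>)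
  thus ?thesis by simp
qed

lemma sum_monics_power_eq_0:
  assumes "m < d"
  shows "(\<Sum>a\<in>monics d. eval_at a t ^ m) = 0"
proof -
  have "(\<Sum>b\<in>polys_lt d. \<Prod>l\<in>{..<m}. eval_at (monom 1 d + b) t) = 0"
    by (rule sum_few_forms_eq_0[where \<alpha> = "\<lambda>_. t ^ d" and \<beta> = "\<lambda>_ i. t ^ i"])
       (use assms in \<open>auto simp only: eval_at_polys_lt finite_lessThan card_lessThan
          eval_at_add eval_at_monom cst_1 mult_1_left\<close>)
  thus ?thesis by (simp add: sum_monics)
qed

text \<open>
  Functions that can be inserted into a sum of products of forms without spoiling its bound. They
  make the bound applicable to \<open>1 / a\<^sup>s\<close>, which is not a product of forms but a limit of sums of such
  products. The forms are indexed by natural numbers, as are the variables \<open>t\<^sub>j\<close>.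
\<close>

definition multiplier :: "nat \<Rightarrow> (nat \<Rightarrow> real) \<Rightarrow> ('a poly \<Rightarrow> 'c) \<Rightarrow> bool" where
  "multiplier d \<epsilon> \<phi> \<longleftrightarrow> (\<forall>(L :: nat set) M f. finite L \<longrightarrow> (\<forall>l\<in>L. bounded_form d \<epsilon> (M l) (f l)) \<longrightarrow>
     absv (\<Sum>b\<in>polys_lt d. \<phi> b * (\<Prod>l\<in>L. f l b)) \<le> (\<Prod>l\<in>L. M l) * (\<Prod>i<d. \<epsilon> i))"

lemma bounded_form_nonneg: "bounded_form d \<epsilon> M f \<Longrightarrow> M \<ge> 0"
  unfolding bounded_form_def by (auto intro: order.trans[OF absv_nonneg])

lemma multiplierD:
  fixes L :: "nat set"
  assumes "multiplier d \<epsilon> \<phi>" "finite L" "\<And>l. l \<in> L \<Longrightarrow> bounded_form d \<epsilon> (M l) (f l)"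
  shows "absv (\<Sum>b\<in>polys_lt d. \<phi> b * (\<Prod>l\<in>L. f l b)) \<le> (\<Prod>l\<in>L. M l) * (\<Prod>i<d. \<epsilon> i)"
  using assms(1)[unfolded multiplier_def, rule_format, of L M f] assms(2,3) by blast

text \<open>
  The form \<open>u\<close> joins the product under an index that is not yet in use.
\<close>

lemma multiplier_times_form:
  assumes "multiplier d \<epsilon> \<phi>" "bounded_form d \<epsilon> 1 u"
  shows "multiplier d \<epsilon> (\<lambda>b. u b * \<phi> b)"
  unfolding multiplier_def
proof (intro allI impI)
  fix L :: "nat set" and M f
  assume L: "finite L" "\<forall>l\<in>L. bounded_form d \<epsilon> (M l) (f l)"
  obtain k where k: "k \<notin> L" using ex_new_if_finite[OF infinite_UNIV_nat L(1)] by blast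
  have "absv (\<Sum>b\<in>polys_lt d. \<phi> b * (\<Prod>l\<in>insert k L. (f(k := u)) l b))
      \<le> (\<Prod>l\<in>insert k L. (M(k := 1)) l) * (\<Prod>i<d. \<epsilon> i)"
  proof (rule multiplierD[OF assms(1)])
    fix l assume "l \<in> insert k L"
    thus "bounded_form d \<epsilon> ((M(k := 1)) l) ((f(k := u)) l)" using L(2) assms(2) by (cases "l = k") simp_all
  qed (use L in simp)
  moreover have "(\<Prod>l\<in>L. (f(k := u)) l b) = (\<Prod>l\<in>L. f l b)" for b
    using k by (intro prod.cong) auto
  moreover have "(\<Prod>l\<in>L. (M(k := 1)) l) = (\<Prod>l\<in>L. M l)"
    using k by (intro prod.cong) auto
  ultimately show "absv (\<Sum>b\<in>polys_lt d. u b * \<phi> b * (\<Prod>l\<in>L. f l b)) \<le> prod M L * prod \<epsilon> {..<d}"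
    by (simp only: prod.insert[OF L(1) k] fun_upd_same mult.left_commute[of "\<phi> _"] mult.assoc mult_1_left)
qed

text \<open>
  By the geometric series, \<open>\<phi> / (1 + u)\<close> is a combination of the multipliers \<open>u\<^sup>k \<phi>\<close>, \<open>k < n\<close>, up to an
  error of size \<open>O(2\<^sup>-\<^sup>n)\<close>. The number of summands does not enter an ultrametric bound, and \<open>n\<close> is
  arbitrary.
\<close>

lemma multiplier_divide:
  assumes \<phi>: "multiplier d \<epsilon> \<phi>" and u: "bounded_form d \<epsilon> 1 u"
    and half: "\<And>b. b \<in> polys_lt d \<Longrightarrow> absv (u b) \<le> 1/2"
    and \<epsilon>: "\<And>i. i < d \<Longrightarrow> 0 \<le> \<epsilon> i"
  shows "multiplier d \<epsilon> (\<lambda>b. \<phi> b / (1 + u b))"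
  unfolding multiplier_def
proof (intro allI impI)
  fix L :: "nat set" and M f
  assume L: "finite L" "\<forall>l\<in>L. bounded_form d \<epsilon> (M l) (f l)"
  define P where "P = (\<lambda>b. \<Prod>l\<in>L. f l b)"
  let ?B = "prod M L * prod \<epsilon> {..<d}"
  have B0: "?B \<ge> 0" using L bounded_form_nonneg \<epsilon> by (intro mult_nonneg_nonneg prod_nonneg) auto
  let ?V = "\<Sum>b\<in>polys_lt d. \<phi> b / (1 + u b) * P b"
  define C where "C = Max (insert 0 ((\<lambda>b. absv (\<phi> b / (1 + u b) * P b)) ` polys_lt d))"
  have C: "absv (\<phi> b / (1 + u b) * P b) \<le> C" if "b \<in> polys_lt d" for b
    unfolding C_def using that by (intro Max_ge) auto
  have C0: "C \<ge> 0" unfolding C_def by (intro Max_ge) auto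
  have pow: "multiplier d \<epsilon> (\<lambda>b. u b ^ k * \<phi> b)" for k
    by (induction k) (use \<phi> multiplier_times_form[OF _ u] in \<open>auto simp: mult.assoc\<close>)
  have nz: "1 + u b \<noteq> 0" if "b \<in> polys_lt d" for b
  proof
    assume "1 + u b = 0"
    hence "u b = -1" by (simp add: eq_neg_iff_add_eq_0 add.commute)
    thus False using half[OF that] by simp
  qed
  have V: "absv ?V \<le> max ?B (C * (1/2) ^ n)" for n
  proof -
    have eq: "\<phi> b / (1 + u b) * P b =
       (\<Sum>k<n. (-1) ^ k * (u b ^ k * \<phi> b * P b)) + (- u b) ^ n * (\<phi> b / (1 + u b) * P b)"
      if b: "b \<in> polys_lt d" for b
    proof -
      have "(1 - (- u b)) * (\<Sum>k<n. (- u b) ^ k) = 1 - (- u b) ^ n"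
        by (metis one_diff_power_eq)
      hence "1 = (1 + u b) * (\<Sum>k<n. (- u b) ^ k) + (- u b) ^ n" by simp
      hence "\<phi> b / (1 + u b) * P b * 1 = \<phi> b / (1 + u b) * P b * ((1 + u b) * (\<Sum>k<n. (- u b) ^ k) + (- u b) ^ n)"
        by (rule arg_cong)
      also have "\<dots> = \<phi> b * P b * (\<Sum>k<n. (- u b) ^ k) + (- u b) ^ n * (\<phi> b / (1 + u b) * P b)"
        using nz[OF b] by (simp add: distrib_left)
      also have "\<phi> b * P b * (\<Sum>k<n. (- u b) ^ k) = (\<Sum>k<n. (-1) ^ k * (u b ^ k * \<phi> b * P b))"
        unfolding sum_distrib_left by (intro sum.cong refl) (simp add: power_minus[of "u b"] mult_ac)
      finally show ?thesis unfolding mult_1_right .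
    qed
    have "?V = (\<Sum>b\<in>polys_lt d. (\<Sum>k<n. (-1) ^ k * (u b ^ k * \<phi> b * P b)) + (- u b) ^ n * (\<phi> b / (1 + u b) * P b))"
      by (intro sum.cong refl eq)
    also have "\<dots> = (\<Sum>k<n. (-1) ^ k * (\<Sum>b\<in>polys_lt d. u b ^ k * \<phi> b * P b)) +
        (\<Sum>b\<in>polys_lt d. (- u b) ^ n * (\<phi> b / (1 + u b) * P b))"
      by (simp add: sum.distrib sum_distrib_left sum.swap[of _ "{..<n}"])
    also have "absv \<dots> \<le> max ?B (C * (1/2) ^ n)"
    proof (rule order.trans[OF absv_add_le], rule max.mono)
      show "absv (\<Sum>k<n. (-1) ^ k * (\<Sum>b\<in>polys_lt d. u b ^ k * \<phi> b * P b)) \<le> ?B"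
      proof (rule absv_sum_le[OF _ B0])
        fix k
        show "absv ((-1) ^ k * (\<Sum>b\<in>polys_lt d. u b ^ k * \<phi> b * P b)) \<le> ?B"
          using pow[of k] L unfolding multiplier_def P_def by (simp add: absv_mult absv_power)
      qed
      show "absv (\<Sum>b\<in>polys_lt d. (- u b) ^ n * (\<phi> b / (1 + u b) * P b)) \<le> C * (1/2) ^ n"
      proof (rule absv_sum_le)
        fix b :: "'a poly" assume b: "b \<in> polys_lt d"
        have "absv (u b) ^ n * absv (\<phi> b / (1 + u b) * P b) \<le> (1/2) ^ n * C"
          using half[OF b] C[OF b] by (intro mult_mono power_mono) auto
        thus "absv ((- u b) ^ n * (\<phi> b / (1 + u b) * P b)) \<le> C * (1/2) ^ n"
          unfolding absv_mult[of "(- u b) ^ n"] absv_power absv_uminus by (simp add: mult_ac)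
      qed (use C0 in auto)
    qed
    finally show ?thesis .
  qed
  have "(\<lambda>n. max ?B (C * (1/2) ^ n)) \<longlonglongrightarrow> max ?B (C * 0)"
    by (intro tendsto_max tendsto_const tendsto_mult LIMSEQ_power_zero) auto
  hence "absv ?V \<le> max ?B (C * 0)" using V by (intro LIMSEQ_le_const) auto
  thus "absv (\<Sum>b\<in>polys_lt d. \<phi> b / (1 + u b) * (\<Prod>l\<in>L. f l b)) \<le> ?B"
    using B0 by (simp add: P_def)
qed

lemma multiplier_inverse_power:
  assumes u: "bounded_form d \<epsilon> 1 u"
    and half: "\<And>b. b \<in> polys_lt d \<Longrightarrow> absv (u b) \<le> 1/2"
    and \<epsilon>: "\<And>i. i < d \<Longrightarrow> 0 \<le> \<epsilon> i \<and> \<epsilon> i \<le> 1"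
  shows "multiplier d \<epsilon> (\<lambda>b. 1 / (1 + u b) ^ s)"
proof (induction s)
  case 0
  show ?case unfolding multiplier_def using \<epsilon> by (auto intro!: sum_forms_bound)
next
  case (Suc s)
  from multiplier_divide[OF this u half] \<epsilon> show ?case by (simp add: mult_ac)
qed


section \<open>Power sums and their decay\<close>

definition power_sum :: "nat set \<Rightarrow> nat \<Rightarrow> (nat \<Rightarrow> 'c) \<Rightarrow> nat \<Rightarrow> 'c" where
  "power_sum U s t d = (\<Sum>a\<in>monics d. (\<Prod>j\<in>U. eval_at a (t j)) / eval_at a \<theta> ^ s)"

text \<open>
  Write \<open>a = \<theta>\<^sup>d + b = \<theta>\<^sup>d (1 + u)\<close>. With the weights \<open>\<epsilon> i = 2\<^bsup>i-d\<^esup>\<close>, the quotient \<open>u = b/\<theta>\<^sup>d\<close> is a form of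
  size \<open>1\<close> and \<open>a(t\<^sub>j)\<close> is a form of size \<open>(2 R\<^sub>j)\<^sup>d\<close>, the factor \<open>2\<^sup>d\<close> compensating the weights.
\<close>

lemma absv_power_sum_le:
  assumes "finite U" "\<And>j. j \<in> U \<Longrightarrow> absv (t j) \<le> R j" "\<And>j. j \<in> U \<Longrightarrow> R j \<ge> 1"
  shows "absv (power_sum U s t d) \<le> (\<Prod>j\<in>U. 2 * R j) ^ d * (\<Prod>i<d. 2 ^ i / 2 ^ d) / 2 ^ (d * s)"
proof -
  define \<epsilon> :: "nat \<Rightarrow> real" where "\<epsilon> = (\<lambda>i. 2 ^ i / 2 ^ d)"
  define u where "u = (\<lambda>b. \<Sum>i<d. cst (coeff b i) * (\<theta> ^ i / \<theta> ^ d))"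
  have \<epsilon>_half: "\<epsilon> i \<le> 1/2" if "i < d" for i
  proof -
    have "2 * (2::real) ^ i \<le> 2 ^ d" using that power_increasing[of "Suc i" d "2::real"] by simp
    thus ?thesis by (simp add: \<epsilon>_def field_simps)
  qed
  have u: "bounded_form d \<epsilon> 1 u"
    unfolding bounded_form_def
    by (intro exI[of _ 0] exI[of _ "\<lambda>i. \<theta> ^ i / \<theta> ^ d"])
       (auto simp: u_def absv_divide absv_power absv_\<theta> \<epsilon>_def)
  have half: "absv (u b) \<le> 1/2" for b
    unfolding u_def
  proof (rule absv_sum_le)
    fix i assume "i \<in> {..<d}"
    hence "absv (cst (coeff b i)) * absv (\<theta> ^ i / \<theta> ^ d) \<le> 1 * (1/2)"
      using \<epsilon>_half[of i] absv_cst_le by (intro mult_mono) (auto simp: absv_divide absv_power absv_\<theta> \<epsilon>_def)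
    thus "absv (cst (coeff b i) * (\<theta> ^ i / \<theta> ^ d)) \<le> 1/2" by (subst absv_mult) linarith
  qed simp
  have mult: "multiplier d \<epsilon> (\<lambda>b. 1 / (1 + u b) ^ s)"
  proof (rule multiplier_inverse_power[OF u half])
    fix i assume "i < d"
    with \<epsilon>_half[of i] show "0 \<le> \<epsilon> i \<and> \<epsilon> i \<le> 1" by (simp add: \<epsilon>_def)
  qed
  have form: "bounded_form d \<epsilon> ((2 * R j) ^ d) (\<lambda>b. eval_at (monom 1 d + b) (t j))" if j: "j \<in> U" for j
    unfolding bounded_form_def
  proof (intro exI[of _ "t j ^ d"] exI[of _ "\<lambda>i. t j ^ i"] conjI allI impI ballI)
    have R: "absv (t j) \<le> R j" "1 \<le> R j" using assms j by auto
    have *: "absv (t j) ^ i \<le> R j ^ d" if "i \<le> d" for i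
    proof -
      have "absv (t j) ^ i \<le> R j ^ i" using R by (intro power_mono) auto
      also have "\<dots> \<le> R j ^ d" using R that by (intro power_increasing) auto
      finally show ?thesis .
    qed
    have "R j ^ d * 1 \<le> R j ^ d * 2 ^ d" using R by (intro mult_left_mono) auto
    thus "absv (t j ^ d) \<le> (2 * R j) ^ d" using *[of d] by (simp add: absv_power power_mult_distrib mult_ac)
    fix i assume i: "i < d"
    have "R j ^ d * 1 \<le> R j ^ d * 2 ^ i" using R by (intro mult_left_mono) auto
    thus "absv (t j ^ i) \<le> (2 * R j) ^ d * \<epsilon> i"
      using *[of i] i by (simp add: absv_power power_mult_distrib \<epsilon>_def)
  next
    fix b :: "'a poly" assume "b \<in> polys_lt d"
    thus "eval_at (monom 1 d + b) (t j) = t j ^ d + (\<Sum>i<d. cst (coeff b i) * t j ^ i)"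
      by (simp add: eval_at_add eval_at_monom eval_at_polys_lt)
  qed
  have \<theta>: "eval_at (monom 1 d + b) \<theta> = \<theta> ^ d * (1 + u b)" if "b \<in> polys_lt d" for b
    using that by (simp add: eval_at_add eval_at_monom eval_at_polys_lt u_def sum_distrib_left distrib_left mult_ac)
  have "power_sum U s t d = (\<Sum>b\<in>polys_lt d. (\<Prod>j\<in>U. eval_at (monom 1 d + b) (t j)) / (\<theta> ^ d * (1 + u b)) ^ s)"
    unfolding power_sum_def sum_monics by (intro sum.cong refl) (simp add: \<theta>)
  also have "\<dots> = (\<Sum>b\<in>polys_lt d. 1 / (1 + u b) ^ s * (\<Prod>j\<in>U. eval_at (monom 1 d + b) (t j))) / \<theta> ^ (d * s)"
    by (simp add: sum_divide_distrib power_mult_distrib power_mult mult_ac)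
  also have "absv \<dots> = absv (\<Sum>b\<in>polys_lt d. 1 / (1 + u b) ^ s * (\<Prod>j\<in>U. eval_at (monom 1 d + b) (t j))) / 2 ^ (d * s)"
    by (simp add: absv_divide absv_power absv_\<theta>)
  also have "\<dots> \<le> (\<Prod>j\<in>U. (2 * R j) ^ d) * (\<Prod>i<d. \<epsilon> i) / 2 ^ (d * s)"
    by (intro divide_right_mono multiplierD[OF mult assms(1)] form) auto
  finally show ?thesis by (simp add: \<epsilon>_def prod_power_distrib)
qed

text \<open>
  The product of the weights is \<open>2\<^bsup>-d(d+1)/2\<^esup>\<close>, which outweighs the geometric growth of the terms at an
  arbitrary point \<open>t\<close>. For \<open>t\<close> outside of the unit polydisc the individual terms need not be small.
\<close>

lemma power_sum_tendsto_0:
  assumes "finite U"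
  shows "power_sum U s t \<longlonglongrightarrow> 0"
proof (rule tendsto_absv_le)
  define R where "R = (\<lambda>j. max 1 (absv (t j)))"
  \<comment> \<open>The terms grow at most like \<open>2\<^bsup>md\<^esup>\<close>, and \<open>d(d+1)/2 \<ge> md + d\<close> as soon as \<open>d \<ge> 2m + 1\<close>.\<close>
  obtain m where m: "(\<Prod>j\<in>U. 2 * R j) < 2 ^ m" using real_arch_pow[of 2 "\<Prod>j\<in>U. 2 * R j"] by auto
  have "absv (power_sum U s t d) \<le> (1/2) ^ d" if d: "d \<ge> 2 * m + 1" for d
  proof -
    have e: "(\<Prod>i<d. 2 ^ i / 2 ^ d :: real) * 2 ^ (\<Sum>i<d. d - i) = 1"
    proof -
      have "(\<Prod>i<d. 2 ^ i / 2 ^ d :: real) * 2 ^ (\<Sum>i<d. d - i) = (\<Prod>i<d. 2 ^ i / 2 ^ d * 2 ^ (d - i))"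
        by (simp only: power_sum prod.distrib)
      also have "\<dots> = (\<Prod>i<d. 1)"
        by (intro prod.cong refl) (simp flip: power_add)
      finally show ?thesis by simp
    qed
    have sum: "2 * (\<Sum>i<d. d - i) = d * (d + 1)"
    proof -
      have "(\<Sum>i<d. d - i) = (\<Sum>i<d. Suc i)"
        by (rule sum.reindex_bij_witness[of _ "\<lambda>i. d - Suc i" "\<lambda>i. d - Suc i"]) auto
      also have "2 * \<dots> = d * (d + 1)" by (induction d) auto
      finally show ?thesis .
    qed
    have "2 * (m * d + d) = d * (2 * m + 2)" by (simp add: algebra_simps)
    also have "\<dots> \<le> d * (d + 1)" using d by (intro mult_left_mono) auto
    finally have le: "m * d + d \<le> (\<Sum>i<d. d - i)" unfolding sum[symmetric] by simp
    have "absv (power_sum U s t d) \<le> (\<Prod>j\<in>U. 2 * R j) ^ d * (\<Prod>i<d. 2 ^ i / 2 ^ d) / 2 ^ (d * s)"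
      by (rule absv_power_sum_le[OF assms]) (auto simp: R_def)
    also have "\<dots> \<le> (\<Prod>j\<in>U. 2 * R j) ^ d * (\<Prod>i<d. 2 ^ i / 2 ^ d) / 1"
      by (intro divide_left_mono mult_nonneg_nonneg zero_le_power prod_nonneg) (auto simp: R_def)
    also have "\<dots> \<le> (2 ^ m) ^ d * (\<Prod>i<d. 2 ^ i / 2 ^ d) / 1"
      using m by (intro divide_right_mono mult_right_mono power_mono prod_nonneg) (auto simp: R_def)
    also have "\<dots> = 2 ^ (m * d) / 2 ^ (\<Sum>i<d. d - i)"
      using e by (simp add: field_simps flip: power_mult)
    also have "\<dots> \<le> 2 ^ (m * d) / 2 ^ (m * d + d)"
      using le by (intro divide_left_mono power_increasing) auto
    also have "\<dots> = (1/2) ^ d" by (simp add: power_add power_divide)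
    finally show ?thesis .
  qed
  thus "\<forall>\<^sub>F d in sequentially. absv (power_sum U s t d - 0) \<le> (1/2) ^ d"
    unfolding eventually_sequentially by (intro exI[of _ "2 * m + 1"]) auto
qed (intro LIMSEQ_power_zero, simp)

end


section \<open>Truncated multiple zeta values\<close>

text \<open>
  The sum of \<open>f\<^sub>1(d\<^sub>1) \<cdots> f\<^sub>r(d\<^sub>r)\<close> over \<open>N > d\<^sub>1 > \<cdots> > d\<^sub>r \<ge> 0\<close>.
\<close>

primrec nested_sum :: "(nat \<Rightarrow> 'b :: comm_semiring_1) list \<Rightarrow> nat \<Rightarrow> 'b" where
  "nested_sum [] N = 1"
| "nested_sum (f # fs) N = (\<Sum>d<N. f d * nested_sum fs d)"

lemma decreasing_tuples_0: "decreasing_tuples 0 N = {[]}"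
  by (auto simp: decreasing_tuples_def)

lemma decreasing_tuples_Suc:
  "decreasing_tuples (Suc r) N = (\<lambda>(a, as). a # as) ` (SIGMA a:(\<Union>d<N. monics d). decreasing_tuples r (degree a))"
  by (auto simp: decreasing_tuples_def monics_def length_Suc_conv image_iff intro: less_trans)

lemma finite_decreasing_tuples [simp]:
  "finite (decreasing_tuples r N :: 'a :: finite_field poly list set)"
  by (induction r arbitrary: N) (auto simp: decreasing_tuples_0 decreasing_tuples_Suc)

lemma sum_decreasing_tuples_Suc:
  "sum g (decreasing_tuples (Suc r) N) = (\<Sum>d<N. \<Sum>a\<in>monics d. \<Sum>as\<in>decreasing_tuples r d. g (a # as))"
proof -
  have "sum g (decreasing_tuples (Suc r) N) =
     (\<Sum>(a, as)\<in>(SIGMA a:(\<Union>d<N. monics d). decreasing_tuples r (degree a)). g (a # as))"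
    unfolding decreasing_tuples_Suc
    by (subst sum.reindex) (auto simp: inj_on_def case_prod_unfold)
  also have "\<dots> = (\<Sum>a\<in>(\<Union>d<N. monics d). \<Sum>as\<in>decreasing_tuples r (degree a). g (a # as))"
    by (subst sum.Sigma) auto
  also have "\<dots> = (\<Sum>d<N. \<Sum>a\<in>monics d. \<Sum>as\<in>decreasing_tuples r (degree a). g (a # as))"
    by (intro sum.UNION_disjoint ballI finite_monics) (auto simp: monics_def)
  also have "\<dots> = (\<Sum>d<N. \<Sum>a\<in>monics d. \<Sum>as\<in>decreasing_tuples r d. g (a # as))"
    by (intro sum.cong refl) (auto simp: monics_def)
  finally show ?thesis .
qed

lemma monics_iff: "a \<in> monics d \<longleftrightarrow> a - monom 1 d \<in> polys_lt d"
proof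
  assume "a \<in> monics d"
  then obtain b where "a = monom 1 d + b" "b \<in> polys_lt d"
    using bij_betw_imp_surj_on[OF bij_betw_monics[of d]] by blast
  thus "a - monom 1 d \<in> polys_lt d" by simp
next
  assume "a - monom 1 d \<in> polys_lt d"
  hence "monom 1 d + (a - monom 1 d) \<in> monics d"
    using bij_betwE[OF bij_betw_monics[of d]] by blast
  thus "a \<in> monics d" by simp
qed

definition arrays_wt :: "nat set \<Rightarrow> nat \<Rightarrow> (nat set \<times> nat) list set" where
  "arrays_wt \<Sigma> w = {A. admissible \<Sigma> A \<and> weight A = w}"

lemma admissible_Nil [simp]: "admissible \<Sigma> [] \<longleftrightarrow> \<Sigma> = {}"
  by (auto simp: admissible_def)

lemma admissible_Cons:
  "admissible \<Sigma> ((U, i) # A) \<longleftrightarrow> (\<exists>\<Sigma>'. admissible \<Sigma>' A \<and> U \<inter> \<Sigma>' = {} \<and> \<Sigma> = U \<union> \<Sigma>' \<and> 0 < i)"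
  by (auto simp: admissible_def)

lemma arrays_wt_Nil: "[] \<in> arrays_wt \<Sigma> w \<longleftrightarrow> \<Sigma> = {} \<and> w = 0"
  by (auto simp: arrays_wt_def weight_def)

lemma arrays_wt_Cons:
  "(U, i) # A \<in> arrays_wt \<Sigma> w \<longleftrightarrow> (\<exists>\<Sigma>' w'. A \<in> arrays_wt \<Sigma>' w' \<and> U \<inter> \<Sigma>' = {} \<and> \<Sigma> = U \<union> \<Sigma>' \<and> 0 < i \<and> w = i + w')"
  by (auto simp: arrays_wt_def admissible_Cons weight_def)

lemma admissible_imp_finite: "admissible \<Sigma> A \<Longrightarrow> finite \<Sigma> \<Longrightarrow> c \<in> set A \<Longrightarrow> finite (fst c)"
  unfolding admissible_def by (auto intro: finite_subset)

lemma sum_mult_sum_lessThan: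
  fixes f g :: "nat \<Rightarrow> 'b :: comm_ring_1"
  shows "(\<Sum>d<N. f d) * (\<Sum>d<N. g d) =
    (\<Sum>d<N. f d * (\<Sum>e<d. g e) + g d * (\<Sum>e<d. f e) + f d * g d)"
  by (induction N) (simp_all add: algebra_simps)

context C_infinity
begin

definition trunc_mzv :: "(nat set \<times> nat) list \<Rightarrow> (nat \<Rightarrow> 'c) \<Rightarrow> nat \<Rightarrow> 'c" where
  "trunc_mzv A t = nested_sum (map (\<lambda>c. power_sum (fst c) (snd c) t) A)"

lemma trunc_mzv_Nil [simp]: "trunc_mzv [] t N = 1"
  by (simp add: trunc_mzv_def)

lemma trunc_mzv_Cons: "trunc_mzv ((U, i) # A) t N = (\<Sum>d<N. power_sum U i t d * trunc_mzv A t d)"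
  by (simp add: trunc_mzv_def)

lemma sum_decreasing_tuples_eq_trunc_mzv:
  "(\<Sum>as\<in>decreasing_tuples (length A) N.
     \<Prod>k<length A. (\<Prod>j\<in>fst (A ! k). eval_at (as ! k) (t j)) / eval_at (as ! k) \<theta> ^ snd (A ! k)) = trunc_mzv A t N"
proof (induction A arbitrary: N)
  case (Cons c A)
  obtain U i where c: "c = (U, i)" by force
  show ?case
    unfolding length_Cons sum_decreasing_tuples_Suc c trunc_mzv_Cons prod.lessThan_Suc_shift
    by (simp only: nth_Cons_0 nth_Cons_Suc fst_conv snd_conv sum_distrib_left[symmetric] Cons.IH
        power_sum_def sum_distrib_right)
qed (simp add: decreasing_tuples_0)

text \<open>
  The inner sums converge by induction, so the terms of the outer sum tend to zero, and this is
  enough over an ultrametric field.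
\<close>

lemma convergent_nested_sum:
  "(\<And>f. f \<in> set fs \<Longrightarrow> f \<longlonglongrightarrow> (0 :: 'c)) \<Longrightarrow> convergent (nested_sum fs)"
proof (induction fs)
  case (Cons f fs)
  then obtain L where "nested_sum fs \<longlonglongrightarrow> L" by (auto simp: convergent_def)
  hence "(\<lambda>d. f d * nested_sum fs d) \<longlonglongrightarrow> 0 * L" using Cons.prems by (intro tendsto_times) auto
  hence "convergent (\<lambda>N. \<Sum>d<N. f d * nested_sum fs d)" by (intro convergent_partial_sums) simp
  thus ?case by simp
next
  case Nil
  have "nested_sum [] = (\<lambda>_. 1 :: 'c)" by auto
  thus ?case by (simp add: convergent_const)
qed

lemma trunc_mzv_tendsto_mzv:
  assumes "admissible \<Sigma> A" "finite \<Sigma>"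
  shows "trunc_mzv A t \<longlonglongrightarrow> mzv A t"
proof -
  have "convergent (trunc_mzv A t)" unfolding trunc_mzv_def
    using admissible_imp_finite[OF assms] by (intro convergent_nested_sum) (auto intro!: power_sum_tendsto_0)
  thus ?thesis unfolding mzv_def sum_decreasing_tuples_eq_trunc_mzv
    by (simp add: convergent_LIMSEQ_iff)
qed


section \<open>Linear combinations over \<open>K\<close>\<close>

text \<open>
  Linear combinations are built up one term at a time, so that linear statements are proved by
  induction. The domain \<open>'i\<close> is arbitrary: it consists of points \<open>t\<close>, of truncation degrees \<open>N\<close>, or of
  pairs of both.
\<close>

inductive K_comb :: "('i \<Rightarrow> 'c) set \<Rightarrow> ('i \<Rightarrow> 'c) \<Rightarrow> bool" for B where
  K_comb_0: "K_comb B (\<lambda>_. 0)"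
| K_comb_Cons: "K_comb B h \<Longrightarrow> c \<in> K \<Longrightarrow> b \<in> B \<Longrightarrow> K_comb B (\<lambda>x. h x + c * b x)"

lemma K_comb_cong: "K_comb B h \<Longrightarrow> (\<And>x. h x = h' x) \<Longrightarrow> K_comb B h'"
proof -
  assume "K_comb B h" "\<And>x. h x = h' x"
  moreover from this(2) have "h = h'" by (rule ext)
  ultimately show ?thesis by simp
qed

lemma K_comb_basis: "b \<in> B \<Longrightarrow> K_comb B b"
  using K_comb_Cons[OF K_comb_0, of 1 b] by simp

lemma K_comb_add: "K_comb B h \<Longrightarrow> K_comb B h' \<Longrightarrow> K_comb B (\<lambda>x. h x + h' x)"
proof (induction rule: K_comb.induct)
  case (K_comb_Cons h c b)
  have "K_comb B (\<lambda>x. (h x + h' x) + c * b x)"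
    by (intro K_comb.K_comb_Cons K_comb_Cons)
  thus ?case by (simp add: algebra_simps)
qed simp

lemma K_comb_scale: "K_comb B h \<Longrightarrow> c \<in> K \<Longrightarrow> K_comb B (\<lambda>x. c * h x)"
proof (induction rule: K_comb.induct)
  case (K_comb_Cons h c' b)
  have "K_comb B (\<lambda>x. c * h x + (c * c') * b x)"
    by (intro K_comb.K_comb_Cons K_comb_Cons K_mult)
  thus ?case by (simp add: algebra_simps)
qed (simp add: K_comb_0)

lemma K_comb_diff: "K_comb B h \<Longrightarrow> K_comb B h' \<Longrightarrow> K_comb B (\<lambda>x. h x - h' x)"
  using K_comb_add[of B h "\<lambda>x. (-1) * h' x"] K_comb_scale[of B h' "-1"] K_uminus[OF K_1] by simp

lemma K_comb_sum: "(\<And>i. i \<in> I \<Longrightarrow> K_comb B (h i)) \<Longrightarrow> K_comb B (\<lambda>x. \<Sum>i\<in>I. h i x)"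
  by (induction I rule: infinite_finite_induct) (auto intro: K_comb_add K_comb_0)

text \<open>
  A linear map can be checked on the spanning set.
\<close>

lemma K_comb_map:
  assumes "K_comb B h"
    and "\<And>y. \<Phi> (\<lambda>_. 0) y = 0"
    and "\<And>h c b y. \<Phi> (\<lambda>x. h x + c * b x) y = \<Phi> h y + c * \<Phi> b y"
    and "\<And>b. b \<in> B \<Longrightarrow> K_comb B' (\<Phi> b)"
  shows "K_comb B' (\<Phi> h)"
  using assms(1)
proof (induction rule: K_comb.induct)
  case K_comb_0
  show ?case by (rule K_comb_cong[OF K_comb.K_comb_0]) (simp add: assms)
next
  case (K_comb_Cons h c b)
  have "K_comb B' (\<lambda>y. \<Phi> h y + c * \<Phi> b y)"
    by (intro K_comb_add K_comb_scale K_comb_Cons assms(4))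
  thus ?case by (rule K_comb_cong) (simp add: assms)
qed

lemma K_comb_mono: "K_comb B h \<Longrightarrow> B \<subseteq> B' \<Longrightarrow> K_comb B' h"
  by (induction rule: K_comb.induct) (auto intro: K_comb.intros)

lemma K_span_eq: "K_span B = {h. K_comb B h}"
proof (intro equalityI subsetI CollectI)
  fix h assume "h \<in> K_span B"
  then obtain B' c where h: "h = (\<lambda>t. \<Sum>b\<in>B'. c b * b t)" "B' \<subseteq> B" "c ` B' \<subseteq> K"
    by (auto simp: K_span_def)
  show "K_comb B h" unfolding h using h by (intro K_comb_sum K_comb_scale K_comb_basis) auto
next
  fix h assume "h \<in> {h. K_comb B h}"
  hence "K_comb B h" by simp
  thus "h \<in> K_span B"
  proof (induction rule: K_comb.induct)
    case K_comb_0
    show ?case unfolding K_span_def by (auto intro!: exI[of _ "{}"])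
  next
    case (K_comb_Cons h c b)
    then obtain B' e where h: "h = (\<lambda>t. \<Sum>b\<in>B'. e b * b t)" "finite B'" "B' \<subseteq> B" "e ` B' \<subseteq> K"
      by (auto simp: K_span_def)
    define e' where "e' = (\<lambda>b'. (if b' \<in> B' then e b' else 0) + (if b' = b then c else 0))"
    have "(\<Sum>b'\<in>insert b B'. e' b' * b' t) = h t + c * b t" for t
    proof -
      have "(\<Sum>b'\<in>insert b B'. e' b' * b' t) =
         (\<Sum>b'\<in>insert b B'. (if b' \<in> B' then e b' else 0) * b' t) +
         (\<Sum>b'\<in>insert b B'. (if b' = b then c else 0) * b' t)"
        by (simp add: e'_def algebra_simps sum.distrib)
      also have "(\<Sum>b'\<in>insert b B'. (if b' = b then c else 0) * b' t) = (\<Sum>b'\<in>{b}. c * b' t)"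
        by (rule sum.mono_neutral_cong_right) (use h in auto)
      also have "(\<Sum>b'\<in>insert b B'. (if b' \<in> B' then e b' else 0) * b' t) = h t"
        unfolding h(1) by (rule sum.mono_neutral_cong_right) (use h in auto)
      finally show ?thesis by simp
    qed
    hence "(\<lambda>t. h t + c * b t) = (\<lambda>t. \<Sum>b'\<in>insert b B'. e' b' * b' t)" by simp
    moreover have "e' ` insert b B' \<subseteq> K" using h K_comb_Cons by (auto simp: e'_def intro!: K_add)
    ultimately show ?case unfolding K_span_def using h K_comb_Cons
      by (intro CollectI exI[of _ "insert b B'"] exI[of _ e']) auto
  qed
qed


section \<open>Products of multiple zeta values\<close>

abbreviation trunc_mzvs :: "nat set \<Rightarrow> nat \<Rightarrow> ((nat \<Rightarrow> 'c) \<times> nat \<Rightarrow> 'c) set" where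
  "trunc_mzvs \<Sigma> w \<equiv> (\<lambda>A x. trunc_mzv A (fst x) (snd x)) ` arrays_wt \<Sigma> w"

text \<open>
  The part of a truncated multiple zeta value in which \<open>a\<^sub>1\<close> has a given degree, as a function of this
  degree. Products of truncated values are computed on this level and then summed.
\<close>

definition leading_terms :: "nat set \<Rightarrow> nat \<Rightarrow> ((nat \<Rightarrow> 'c) \<times> nat \<Rightarrow> 'c) set" where
  "leading_terms \<Sigma> w = {\<lambda>x. power_sum U i (fst x) (snd x) * trunc_mzv A (fst x) (snd x) | U i A. (U, i) # A \<in> arrays_wt \<Sigma> w}"

lemma sum_leading_terms:
  assumes "K_comb (leading_terms \<Sigma> w) k"
  shows "K_comb (trunc_mzvs \<Sigma> w) (\<lambda>x. \<Sum>d<snd x. k (fst x, d))"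
  using assms
proof (rule K_comb_map)
  fix b assume "b \<in> leading_terms \<Sigma> w"
  then obtain U i A where A: "(U, i) # A \<in> arrays_wt \<Sigma> w"
    "b = (\<lambda>x. power_sum U i (fst x) (snd x) * trunc_mzv A (fst x) (snd x))" by (auto simp: leading_terms_def)
  have "(\<lambda>x. \<Sum>d<snd x. b (fst x, d)) = (\<lambda>x. trunc_mzv ((U, i) # A) (fst x) (snd x))"
    by (simp add: A trunc_mzv_Cons)
  thus "K_comb (trunc_mzvs \<Sigma> w) (\<lambda>x. \<Sum>d<snd x. b (fst x, d))" using A by (auto intro: K_comb_basis)
qed (simp_all add: sum.distrib sum_distrib_left)

lemma power_sum_times_trunc_mzvs:
  assumes "K_comb (trunc_mzvs \<Sigma> w) h" "U \<inter> \<Sigma> = {}" "i > 0"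
  shows "K_comb (leading_terms (U \<union> \<Sigma>) (i + w)) (\<lambda>x. power_sum U i (fst x) (snd x) * h x)"
  using assms(1)
proof (rule K_comb_map)
  fix b assume "b \<in> trunc_mzvs \<Sigma> w"
  then obtain A where A: "A \<in> arrays_wt \<Sigma> w" "b = (\<lambda>x. trunc_mzv A (fst x) (snd x))" by auto
  thus "K_comb (leading_terms (U \<union> \<Sigma>) (i + w)) (\<lambda>x. power_sum U i (fst x) (snd x) * b x)"
    unfolding leading_terms_def using assms
    by (intro K_comb_basis CollectI exI[of _ U] exI[of _ i] exI[of _ A] conjI) (auto simp: arrays_wt_Cons)
qed (simp_all add: algebra_simps)

definition offdiag :: "nat \<Rightarrow> ('a poly \<times> 'a poly) set" where
  "offdiag d = {(a, b). a \<in> monics d \<and> b \<in> monics d \<and> a \<noteq> b}"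

text \<open>
  The contribution of the pairs \<open>a \<noteq> b\<close> to a product of two power sums, with an additional power of
  \<open>a - b\<close> in the denominator that accumulates in the partial fraction expansion.
\<close>

definition offdiag_sum :: "nat set \<Rightarrow> nat set \<Rightarrow> nat \<Rightarrow> nat \<Rightarrow> nat \<Rightarrow> (nat \<Rightarrow> 'c) \<Rightarrow> nat \<Rightarrow> 'c" where
  "offdiag_sum U V r s j t d = (\<Sum>(a, b)\<in>offdiag d. (\<Prod>u\<in>U. eval_at a (t u)) * (\<Prod>v\<in>V. eval_at b (t v)) /
     (eval_at a \<theta> ^ r * eval_at b \<theta> ^ s * eval_at (a - b) \<theta> ^ j))"

lemma finite_offdiag [simp]: "finite (offdiag d)"
proof -
  have "offdiag d \<subseteq> monics d \<times> monics d" by (auto simp: offdiag_def)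
  thus ?thesis by (rule finite_subset) simp
qed

lemma power_sum_mult_power_sum:
  assumes "finite U" "finite V" "U \<inter> V = {}"
  shows "power_sum U r t d * power_sum V s t d = power_sum (U \<union> V) (r + s) t d + offdiag_sum U V r s 0 t d"
proof -
  let ?g = "\<lambda>(a, b). (\<Prod>u\<in>U. eval_at a (t u)) * (\<Prod>v\<in>V. eval_at b (t v)) /
     (eval_at a \<theta> ^ r * eval_at b \<theta> ^ s)"
  have "power_sum U r t d * power_sum V s t d = sum ?g (monics d \<times> monics d)"
    by (simp add: power_sum_def sum_product sum.cartesian_product)
  also have "monics d \<times> monics d = (\<lambda>a. (a, a)) ` monics d \<union> offdiag d"
    by (auto simp: offdiag_def)
  also have "sum ?g \<dots> = sum ?g ((\<lambda>a. (a, a)) ` monics d) + sum ?g (offdiag d)"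
    by (rule sum.union_disjoint) (simp, rule finite_offdiag, auto simp: offdiag_def)
  also have "sum ?g ((\<lambda>a. (a, a)) ` monics d) = power_sum (U \<union> V) (r + s) t d"
    by (subst sum.reindex) (auto simp: inj_on_def power_sum_def power_add prod.union_disjoint[OF assms])
  also have "sum ?g (offdiag d) = offdiag_sum U V r s 0 t d" by (simp add: offdiag_sum_def)
  finally show ?thesis .
qed

lemma offdiag_sum_swap: "offdiag_sum U V r s j t d = (-1) ^ j * offdiag_sum V U s r j t d"
proof -
  have "offdiag_sum U V r s j t d = (\<Sum>(a, b)\<in>offdiag d. (\<Prod>u\<in>U. eval_at b (t u)) * (\<Prod>v\<in>V. eval_at a (t v)) /
     (eval_at b \<theta> ^ r * eval_at a \<theta> ^ s * eval_at (b - a) \<theta> ^ j))"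
    unfolding offdiag_sum_def by (rule sum.reindex_bij_witness[of _ prod.swap prod.swap]) (auto simp: offdiag_def)
  also have "\<dots> = (\<Sum>x\<in>offdiag d. (-1) ^ j * (case x of (a, b) \<Rightarrow> (\<Prod>u\<in>V. eval_at a (t u)) * (\<Prod>v\<in>U. eval_at b (t v)) /
     (eval_at a \<theta> ^ s * eval_at b \<theta> ^ r * eval_at (a - b) \<theta> ^ j)))"
  proof (intro sum.cong refl, clarify)
    fix a b :: "'a poly" assume "(a, b) \<in> offdiag d"
    have "eval_at (b - a) \<theta> ^ j = (-1) ^ j * eval_at (a - b) \<theta> ^ j"
      by (simp add: eval_at_diff flip: power_mult_distrib)
    moreover have "x / (y * ((-1) ^ j * z)) = (-1) ^ j * (x / (y * z))" for x y z :: 'c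
      by (cases "even j") auto
    ultimately have "(\<Prod>u\<in>U. eval_at b (t u)) * (\<Prod>v\<in>V. eval_at a (t v)) /
     (eval_at b \<theta> ^ r * eval_at a \<theta> ^ s * eval_at (b - a) \<theta> ^ j) =
     (-1) ^ j * ((\<Prod>u\<in>U. eval_at b (t u)) * (\<Prod>v\<in>V. eval_at a (t v)) /
     (eval_at b \<theta> ^ r * eval_at a \<theta> ^ s * eval_at (a - b) \<theta> ^ j))"
      by (simp only:)
    thus "(\<Prod>u\<in>U. eval_at b (t u)) * (\<Prod>v\<in>V. eval_at a (t v)) /
     (eval_at b \<theta> ^ r * eval_at a \<theta> ^ s * eval_at (b - a) \<theta> ^ j) =
     (-1) ^ j * ((\<Prod>u\<in>V. eval_at a (t u)) * (\<Prod>v\<in>U. eval_at b (t v)) /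
     (eval_at a \<theta> ^ s * eval_at b \<theta> ^ r * eval_at (a - b) \<theta> ^ j))"
      by (simp only: mult_ac)
  qed
  finally show ?thesis by (simp add: offdiag_sum_def sum_distrib_left)
qed

text \<open>
  This is \<open>1/(a b) = (1/b - 1/a)/(a - b)\<close>.
\<close>

lemma offdiag_sum_partial_fractions:
  "offdiag_sum U V (Suc r) (Suc s) j t d = offdiag_sum U V r (Suc s) (Suc j) t d - offdiag_sum U V (Suc r) s (Suc j) t d"
  unfolding offdiag_sum_def sum_subtractf[symmetric]
proof (intro sum.cong refl, clarify)
  fix a b :: "'a poly" assume ab: "(a, b) \<in> offdiag d"
  have *: "z / (x ^ Suc r * y ^ Suc s * n ^ j) = z / (x ^ r * y ^ Suc s * n ^ Suc j) - z / (x ^ Suc r * y ^ s * n ^ Suc j)"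
    if "n = x - y" "n \<noteq> 0" "x \<noteq> 0" "y \<noteq> 0" for x y n z :: 'c
  proof -
    define P where "P = x ^ r * y ^ s * n ^ j"
    have "z / (P * y * n) = z * x / (P * x * y * n)" "z / (P * x * n) = z * y / (P * x * y * n)"
      using that(3,4) by (simp_all add: mult.assoc mult.left_commute[of P])
    hence "z / (P * y * n) - z / (P * x * n) = z * n / (P * x * y * n)"
      by (simp only: that(1) right_diff_distrib diff_divide_distrib)
    also have "\<dots> = z / (P * x * y)" using that(2) by simp
    finally show ?thesis by (simp only: P_def power_Suc mult_ac)
  qed
  have "a \<noteq> 0" "b \<noteq> 0" "a - b \<noteq> 0" using ab monics_nonzero by (auto simp: offdiag_def)
  thus "(\<Prod>u\<in>U. eval_at a (t u)) * (\<Prod>v\<in>V. eval_at b (t v)) /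
       (eval_at a \<theta> ^ Suc r * eval_at b \<theta> ^ Suc s * eval_at (a - b) \<theta> ^ j) =
       (\<Prod>u\<in>U. eval_at a (t u)) * (\<Prod>v\<in>V. eval_at b (t v)) /
       (eval_at a \<theta> ^ r * eval_at b \<theta> ^ Suc s * eval_at (a - b) \<theta> ^ Suc j) -
       (\<Prod>u\<in>U. eval_at a (t u)) * (\<Prod>v\<in>V. eval_at b (t v)) /
       (eval_at a \<theta> ^ Suc r * eval_at b \<theta> ^ s * eval_at (a - b) \<theta> ^ Suc j)"
    by (intro *) (simp_all only: eval_at_diff[symmetric] eval_at_\<theta>_eq_0_iff not_False_eq_True)
qed

lemma sum_offdiag:
  "(\<Sum>(a, b)\<in>offdiag d. g a b) = (\<Sum>a\<in>monics d. \<Sum>n\<in>polys_lt d - {0}. g a (a - n))"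
proof -
  have eq: "a - n \<in> monics d" if "a \<in> monics d" "n \<in> polys_lt d" for a n :: "'a poly"
    using that unfolding monics_iff by (simp add: polys_lt_def)
  have eq': "a - b \<in> polys_lt d" if "a \<in> monics d" "b \<in> monics d" for a b :: "'a poly"
    using that unfolding monics_iff by (simp add: polys_lt_def)
  show ?thesis
    unfolding sum.cartesian_product
    by (rule sum.reindex_bij_witness[of _ "\<lambda>(a, n). (a, a - n)" "\<lambda>(a, b). (a, a - b)"])
       (auto simp: offdiag_def eq eq')
qed

text \<open>
  When \<open>b\<close> has left the denominator, substitute \<open>b = a - n\<close> with \<open>n\<close> nonzero of degree less than \<open>d\<close>.
  Expanding \<open>\<chi>\<^sub>V(a - n) = \<Prod>\<^sub>v (a(t\<^sub>v) - n(t\<^sub>v))\<close> over the subsets \<open>X\<close> of \<open>V\<close> separates the variables. The sum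
  over \<open>a\<close> is a power sum with variables \<open>U \<union> X\<close>. In the sum over \<open>n\<close>, the leading coefficients of \<open>n\<close>
  contribute a constant \<open>\<kappa> X\<close>, and what is left is a truncated value with variables \<open>V - X\<close>.
\<close>

lemma offdiag_sum_base:
  assumes "finite U" "finite V" "U \<inter> V = {}" "r > 0" "j > 0"
  shows "K_comb (leading_terms (U \<union> V) (r + j)) (\<lambda>x. offdiag_sum U V r 0 j (fst x) (snd x))"
proof -
  define \<kappa> where "\<kappa> = (\<lambda>X. \<Sum>c\<in>UNIV-{0}. cst ((- c) ^ card (V - X) / c ^ j))"
  have neg: "(\<Sum>n\<in>polys_lt d - {0}. (\<Prod>v\<in>V-X. eval_at (- n) (t v)) / eval_at n \<theta> ^ j) =
    \<kappa> X * trunc_mzv [(V - X, j)] t d" for X t d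
  proof -
    have cdiv: "cst (x / y) = cst x / cst y" for x y :: 'a
    proof (cases "y = 0")
      case False
      have "cst (x / y) * cst y = cst x" using False by (simp flip: cst_mult)
      thus ?thesis using False by (simp add: field_simps)
    qed simp
    have "(\<Sum>n\<in>polys_lt d - {0}. (\<Prod>v\<in>V-X. eval_at (- n) (t v)) / eval_at n \<theta> ^ j) =
      (\<Sum>c\<in>UNIV-{0}. \<Sum>e<d. \<Sum>n\<in>monics e. (\<Prod>v\<in>V-X. eval_at (- smult c n) (t v)) / eval_at (smult c n) \<theta> ^ j)"
      by (rule sum_polys_lt_nonzero)
    also have "\<dots> = (\<Sum>c\<in>UNIV-{0}. \<Sum>e<d. \<Sum>n\<in>monics e.
       cst ((- c) ^ card (V - X) / c ^ j) * ((\<Prod>v\<in>V-X. eval_at n (t v)) / eval_at n \<theta> ^ j))"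
      by (intro sum.cong refl)
         (simp add: eval_at_smult prod.distrib power_mult_distrib cdiv cst_power flip: smult_minus_left)
    also have "\<dots> = \<kappa> X * (\<Sum>e<d. power_sum (V - X) j t e)"
      by (simp only: \<kappa>_def power_sum_def sum_distrib_left[symmetric] sum_distrib_right[symmetric])
    finally show ?thesis by (simp add: trunc_mzv_Cons)
  qed
  have "offdiag_sum U V r 0 j t d = (\<Sum>X\<in>Pow V. \<kappa> X * (power_sum (U \<union> X) r t d * trunc_mzv [(V - X, j)] t d))" for t d
  proof -
    have "offdiag_sum U V r 0 j t d = (\<Sum>a\<in>monics d. \<Sum>n\<in>polys_lt d - {0}. (\<Prod>u\<in>U. eval_at a (t u)) *
       (\<Prod>v\<in>V. eval_at a (t v) + eval_at (- n) (t v)) / (eval_at a \<theta> ^ r * eval_at n \<theta> ^ j))"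
      unfolding offdiag_sum_def sum_offdiag by (simp add: eval_at_diff eval_at_uminus)
    also have "\<dots> = (\<Sum>a\<in>monics d. \<Sum>n\<in>polys_lt d - {0}. \<Sum>X\<in>Pow V.
       ((\<Prod>u\<in>U\<union>X. eval_at a (t u)) / eval_at a \<theta> ^ r) * ((\<Prod>v\<in>V-X. eval_at (- n) (t v)) / eval_at n \<theta> ^ j))"
    proof (intro sum.cong refl)
      fix a n :: "'a poly"
      have "(\<Prod>u\<in>U\<union>X. eval_at a (t u)) = (\<Prod>u\<in>U. eval_at a (t u)) * (\<Prod>u\<in>X. eval_at a (t u))" if "X \<in> Pow V" for X
        using that assms by (intro prod.union_disjoint) (auto intro: finite_subset)
      thus "(\<Prod>u\<in>U. eval_at a (t u)) * (\<Prod>v\<in>V. eval_at a (t v) + eval_at (- n) (t v)) / (eval_at a \<theta> ^ r * eval_at n \<theta> ^ j)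
        = (\<Sum>X\<in>Pow V. ((\<Prod>u\<in>U\<union>X. eval_at a (t u)) / eval_at a \<theta> ^ r) * ((\<Prod>v\<in>V-X. eval_at (- n) (t v)) / eval_at n \<theta> ^ j))"
        by (simp add: prod_add[OF assms(2)] sum_distrib_left sum_divide_distrib mult_ac)
    qed
    also have "\<dots> = (\<Sum>X\<in>Pow V. \<Sum>a\<in>monics d. \<Sum>n\<in>polys_lt d - {0}.
       ((\<Prod>u\<in>U\<union>X. eval_at a (t u)) / eval_at a \<theta> ^ r) * ((\<Prod>v\<in>V-X. eval_at (- n) (t v)) / eval_at n \<theta> ^ j))"
      by (subst sum.swap[of _ "monics d" "Pow V"]) (intro sum.cong refl sum.swap)
    also have "\<dots> = (\<Sum>X\<in>Pow V. power_sum (U \<union> X) r t d * (\<kappa> X * trunc_mzv [(V - X, j)] t d))"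
      by (simp only: power_sum_def neg[symmetric] sum_product)
    finally show ?thesis by (simp add: mult_ac)
  qed
  moreover have "K_comb (leading_terms (U \<union> V) (r + j)) (\<lambda>x. \<Sum>X\<in>Pow V. \<kappa> X * (power_sum (U \<union> X) r (fst x) (snd x) * trunc_mzv [(V - X, j)] (fst x) (snd x)))"
  proof (intro K_comb_sum K_comb_scale K_comb_basis)
    fix X assume "X \<in> Pow V"
    thus "(\<lambda>x. power_sum (U \<union> X) r (fst x) (snd x) * trunc_mzv [(V - X, j)] (fst x) (snd x)) \<in> leading_terms (U \<union> V) (r + j)"
      unfolding leading_terms_def using assms
      by (intro CollectI exI[of _ "U \<union> X"] exI[of _ r] exI[of _ "[(V - X, j)]"]) (auto simp: arrays_wt_Cons arrays_wt_Nil)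
  qed (auto simp: \<kappa>_def intro: K_sum)
  ultimately show ?thesis by simp
qed

text \<open>
  Partial fractions lower \<open>r + s\<close> until one of the two exponents is zero, and by then the exponent of
  \<open>a - b\<close> is positive.
\<close>

lemma offdiag_sum_in_span:
  assumes "finite U" "finite V" "U \<inter> V = {}" "r + s > 0" "r = 0 \<or> s = 0 \<Longrightarrow> j > 0"
  shows "K_comb (leading_terms (U \<union> V) (r + s + j)) (\<lambda>x. offdiag_sum U V r s j (fst x) (snd x))"
  using assms(4,5)
proof (induction "r + s" arbitrary: r s j rule: less_induct)
  case less
  consider "s = 0" | "r = 0" "s > 0" | r' s' where "r = Suc r'" "s = Suc s'"
    by (cases r; cases s) auto
  thus ?case
  proof cases
    case 1
    thus ?thesis using offdiag_sum_base[of U V r j] assms less.prems by simp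
  next
    case 2
    have "K_comb (leading_terms (V \<union> U) (s + j)) (\<lambda>x. offdiag_sum V U s 0 j (fst x) (snd x))"
      using 2 assms less.prems by (intro offdiag_sum_base) auto
    hence "K_comb (leading_terms (V \<union> U) (s + j)) (\<lambda>x. (-1) ^ j * offdiag_sum V U s 0 j (fst x) (snd x))"
      by (rule K_comb_scale) (intro K_power K_uminus K_1)
    thus ?thesis using 2 by (simp add: offdiag_sum_swap[of U V] Un_commute)
  next
    case 3
    have "K_comb (leading_terms (U \<union> V) (r' + s + Suc j)) (\<lambda>x. offdiag_sum U V r' s (Suc j) (fst x) (snd x))"
      using 3 by (intro less.hyps) auto
    moreover have "K_comb (leading_terms (U \<union> V) (r + s' + Suc j)) (\<lambda>x. offdiag_sum U V r s' (Suc j) (fst x) (snd x))"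
      using 3 by (intro less.hyps) auto
    moreover have "r' + s + Suc j = r + s + j" "r + s' + Suc j = r + s + j" using 3 by auto
    ultimately have "K_comb (leading_terms (U \<union> V) (r + s + j))
      (\<lambda>x. offdiag_sum U V r' s (Suc j) (fst x) (snd x) - offdiag_sum U V r s' (Suc j) (fst x) (snd x))"
      by (simp only: K_comb_diff)
    thus ?thesis by (simp only: 3 offdiag_sum_partial_fractions)
  qed
qed

text \<open>
  The diagonal \<open>a = b\<close> contributes the column \<open>(U \<union> V, r + s)\<close>.
\<close>

lemma power_sum_mult_power_sum_in_span:
  assumes "finite U" "finite V" "U \<inter> V = {}" "r > 0" "s > 0"
  shows "K_comb (leading_terms (U \<union> V) (r + s)) (\<lambda>x. power_sum U r (fst x) (snd x) * power_sum V s (fst x) (snd x))"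
proof -
  have "(U \<union> V, r + s) # [] \<in> arrays_wt (U \<union> V) (r + s)" using assms by (simp add: arrays_wt_Cons arrays_wt_Nil)
  hence "(\<lambda>x. power_sum (U \<union> V) (r + s) (fst x) (snd x) * trunc_mzv [] (fst x) (snd x)) \<in> leading_terms (U \<union> V) (r + s)"
    unfolding leading_terms_def by blast
  hence "K_comb (leading_terms (U \<union> V) (r + s)) (\<lambda>x. power_sum (U \<union> V) (r + s) (fst x) (snd x) * trunc_mzv [] (fst x) (snd x))"
    by (rule K_comb_basis)
  moreover have "K_comb (leading_terms (U \<union> V) (r + s + 0)) (\<lambda>x. offdiag_sum U V r s 0 (fst x) (snd x))"
    using assms by (intro offdiag_sum_in_span) auto
  ultimately have "K_comb (leading_terms (U \<union> V) (r + s)) (\<lambda>x. power_sum (U \<union> V) (r + s) (fst x) (snd x) * trunc_mzv [] (fst x) (snd x)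
     + offdiag_sum U V r s 0 (fst x) (snd x))" unfolding add_0_right by (rule K_comb_add)
  thus ?thesis by (simp only: power_sum_mult_power_sum[OF assms(1-3)] trunc_mzv_Nil mult_1_right)
qed

text \<open>
  Sort the terms of the product by the degrees of the leading polynomials of the two factors. If
  the degrees differ, the leading column of one factor stays in front of a product of smaller weight.
  If they agree, the product of the two leading power sums is a combination of terms
  \<open>power_sum X k * trunc_mzv C\<close> with \<open>k > 0\<close>, and \<open>power_sum X k\<close> is in front of a product of three
  factors. The weight of this product is smaller by \<open>k\<close>, so induction on the total weight applies to it,
  twice.
\<close>

lemma trunc_mzv_mult_trunc_mzv:
  assumes "A \<in> arrays_wt \<Sigma> w" "B \<in> arrays_wt \<Sigma>' w'" "finite \<Sigma>" "finite \<Sigma>'" "\<Sigma> \<inter> \<Sigma>' = {}"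
  shows "K_comb (trunc_mzvs (\<Sigma> \<union> \<Sigma>') (w + w')) (\<lambda>x. trunc_mzv A (fst x) (snd x) * trunc_mzv B (fst x) (snd x))"
  using assms
proof (induction "w + w'" arbitrary: A B \<Sigma> \<Sigma>' w w' rule: less_induct)
  case less
  show ?case
  proof (cases "A = [] \<or> B = []")
    case True
    thus ?thesis using less.prems by (auto simp: arrays_wt_Nil intro!: K_comb_basis)
  next
    case False
    then obtain U i A' V j B' where AB: "A = (U, i) # A'" "B = (V, j) # B'"
      by (metis list.exhaust surj_pair)
    from less.prems AB obtain \<Sigma>1 w1 where A': "A' \<in> arrays_wt \<Sigma>1 w1" "U \<inter> \<Sigma>1 = {}" "\<Sigma> = U \<union> \<Sigma>1" "0 < i" "w = i + w1"
      by (auto simp: arrays_wt_Cons)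
    from less.prems AB obtain \<Sigma>2 w2 where B': "B' \<in> arrays_wt \<Sigma>2 w2" "V \<inter> \<Sigma>2 = {}" "\<Sigma>' = V \<union> \<Sigma>2" "0 < j" "w' = j + w2"
      by (auto simp: arrays_wt_Cons)
    have fin: "finite U" "finite V" "finite \<Sigma>1" "finite \<Sigma>2" using A' B' less.prems by auto
    \<comment> \<open>The induction hypothesis extends by linearity to combinations in the second factor.\<close>
    have span_mult: "K_comb (trunc_mzvs (\<Sigma>a \<union> \<Sigma>b) (wa + wb)) (\<lambda>x. trunc_mzv C (fst x) (snd x) * h x)"
      if "C \<in> arrays_wt \<Sigma>a wa" "K_comb (trunc_mzvs \<Sigma>b wb) h" "finite \<Sigma>a" "finite \<Sigma>b" "\<Sigma>a \<inter> \<Sigma>b = {}" "wa + wb < w + w'"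
      for C \<Sigma>a wa \<Sigma>b wb h
      using that(2)
    proof (rule K_comb_map)
      fix b assume "b \<in> trunc_mzvs \<Sigma>b wb"
      then obtain E where "E \<in> arrays_wt \<Sigma>b wb" "b = (\<lambda>x. trunc_mzv E (fst x) (snd x))" by auto
      thus "K_comb (trunc_mzvs (\<Sigma>a \<union> \<Sigma>b) (wa + wb)) (\<lambda>x. trunc_mzv C (fst x) (snd x) * b x)"
        using less.hyps[of wa wb C \<Sigma>a E \<Sigma>b] that by simp
    qed (simp_all add: algebra_simps)
    let ?\<Sigma> = "\<Sigma> \<union> \<Sigma>'" and ?w = "w + w'"
    \<comment> \<open>Terms in which the leading degree of \<open>A\<close> is the larger one.\<close>
    have "K_comb (leading_terms (U \<union> (\<Sigma>1 \<union> \<Sigma>')) (i + (w1 + w'))) (\<lambda>x. power_sum U i (fst x) (snd x) * (trunc_mzv A' (fst x) (snd x) * trunc_mzv B (fst x) (snd x)))"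
      using A' less.prems by (intro power_sum_times_trunc_mzvs less.hyps) auto
    hence 1: "K_comb (leading_terms ?\<Sigma> ?w) (\<lambda>x. power_sum U i (fst x) (snd x) * (trunc_mzv A' (fst x) (snd x) * trunc_mzv B (fst x) (snd x)))"
      using A' by (simp add: Un_assoc add.assoc)
    \<comment> \<open>Terms in which the leading degree of \<open>B\<close> is the larger one.\<close>
    have "K_comb (leading_terms (V \<union> (\<Sigma>2 \<union> \<Sigma>)) (j + (w2 + w))) (\<lambda>x. power_sum V j (fst x) (snd x) * (trunc_mzv B' (fst x) (snd x) * trunc_mzv A (fst x) (snd x)))"
      using B' less.prems by (intro power_sum_times_trunc_mzvs less.hyps) auto
    moreover have "V \<union> (\<Sigma>2 \<union> \<Sigma>) = ?\<Sigma>" "j + (w2 + w) = ?w" using B' by auto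
    ultimately have 2: "K_comb (leading_terms ?\<Sigma> ?w) (\<lambda>x. power_sum V j (fst x) (snd x) * (trunc_mzv B' (fst x) (snd x) * trunc_mzv A (fst x) (snd x)))"
      by simp
    \<comment> \<open>Terms with equal leading degrees.\<close>
    define h where "h = (\<lambda>x. trunc_mzv A' (fst x) (snd x) * trunc_mzv B' (fst x) (snd x))"
    have h: "K_comb (trunc_mzvs (\<Sigma>1 \<union> \<Sigma>2) (w1 + w2)) h" unfolding h_def
      using A' B' less.prems by (intro less.hyps) auto
    have "K_comb (leading_terms (U \<union> V) (i + j)) (\<lambda>x. power_sum U i (fst x) (snd x) * power_sum V j (fst x) (snd x))"
      using A' B' fin less.prems by (intro power_sum_mult_power_sum_in_span) auto
    hence 3: "K_comb (leading_terms ?\<Sigma> ?w) (\<lambda>x. (power_sum U i (fst x) (snd x) * power_sum V j (fst x) (snd x)) * h x)"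
    proof (rule K_comb_map)
      fix b assume "b \<in> leading_terms (U \<union> V) (i + j)"
      then obtain X k C where C: "b = (\<lambda>x. power_sum X k (fst x) (snd x) * trunc_mzv C (fst x) (snd x))"
        "(X, k) # C \<in> arrays_wt (U \<union> V) (i + j)" by (auto simp: leading_terms_def)
      then obtain \<Sigma>c wc where C': "C \<in> arrays_wt \<Sigma>c wc" "X \<inter> \<Sigma>c = {}" "U \<union> V = X \<union> \<Sigma>c" "0 < k" "i + j = k + wc"
        by (auto simp: arrays_wt_Cons)
      have sub: "X \<subseteq> U \<union> V" "\<Sigma>c \<subseteq> U \<union> V" using C'(3) by auto
      have "finite \<Sigma>c" using sub(2) by (rule finite_subset) (use fin in auto)
      have disj: "(U \<union> V) \<inter> (\<Sigma>1 \<union> \<Sigma>2) = {}" using A' B' less.prems by auto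
      have "K_comb (leading_terms (X \<union> (\<Sigma>c \<union> (\<Sigma>1 \<union> \<Sigma>2))) (k + (wc + (w1 + w2))))
         (\<lambda>x. power_sum X k (fst x) (snd x) * (trunc_mzv C (fst x) (snd x) * h x))"
      proof (intro power_sum_times_trunc_mzvs span_mult)
        show "\<Sigma>c \<inter> (\<Sigma>1 \<union> \<Sigma>2) = {}" "X \<inter> (\<Sigma>c \<union> (\<Sigma>1 \<union> \<Sigma>2)) = {}" using sub disj C' by auto
        show "wc + (w1 + w2) < w + w'" using A' B' C' by simp
      qed (use A' B' C' h fin \<open>finite \<Sigma>c\<close> in auto)
      moreover have "X \<union> (\<Sigma>c \<union> (\<Sigma>1 \<union> \<Sigma>2)) = ?\<Sigma>" using C'(3) A' B' by auto
      moreover have "k + (wc + (w1 + w2)) = ?w" using C'(5) A' B' by simp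
      ultimately show "K_comb (leading_terms ?\<Sigma> ?w) (\<lambda>x. b x * h x)" by (simp add: C mult.assoc)
    qed (simp_all add: algebra_simps)
    have "K_comb (trunc_mzvs ?\<Sigma> ?w) (\<lambda>x. \<Sum>d<snd x.
         power_sum U i (fst x) d * (trunc_mzv A' (fst x) d * trunc_mzv B (fst x) d) +
         power_sum V j (fst x) d * (trunc_mzv B' (fst x) d * trunc_mzv A (fst x) d) +
         (power_sum U i (fst x) d * power_sum V j (fst x) d) * h (fst x, d))"
      using sum_leading_terms[OF K_comb_add[OF K_comb_add[OF 1 2] 3]] by simp
    moreover have "trunc_mzv A t N * trunc_mzv B t N = (\<Sum>d<N.
         power_sum U i t d * (trunc_mzv A' t d * trunc_mzv B t d) +
         power_sum V j t d * (trunc_mzv B' t d * trunc_mzv A t d) +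
         (power_sum U i t d * power_sum V j t d) * h (t, d))" for t N
      unfolding AB trunc_mzv_Cons by (subst sum_mult_sum_lessThan) (simp add: h_def mult_ac)
    ultimately show ?thesis by simp
  qed
qed

lemma trunc_mzv_comb_tendsto:
  assumes "K_comb (trunc_mzvs \<Sigma> w) h" "finite \<Sigma>"
  obtains g where "K_comb (mzv ` arrays_wt \<Sigma> w) g" "\<And>t. (\<lambda>N. h (t, N)) \<longlonglongrightarrow> g t"
proof -
  have "\<exists>g. K_comb (mzv ` arrays_wt \<Sigma> w) g \<and> (\<forall>t. (\<lambda>N. h (t, N)) \<longlonglongrightarrow> g t)"
    using assms(1)
  proof (induction rule: K_comb.induct)
    case K_comb_0
    show ?case by (intro exI[of _ "\<lambda>_. 0"] conjI K_comb.K_comb_0) auto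
  next
    case (K_comb_Cons h c b)
    then obtain g A where g: "K_comb (mzv ` arrays_wt \<Sigma> w) g" "\<And>t. (\<lambda>N. h (t, N)) \<longlonglongrightarrow> g t"
      and A: "A \<in> arrays_wt \<Sigma> w" "b = (\<lambda>x. trunc_mzv A (fst x) (snd x))" by auto
    have "(\<lambda>N. trunc_mzv A t N) \<longlonglongrightarrow> mzv A t" for t
      using A assms(2) by (auto simp: arrays_wt_def intro: trunc_mzv_tendsto_mzv)
    hence "(\<lambda>N. h (t, N) + c * b (t, N)) \<longlonglongrightarrow> g t + c * mzv A t" for t
      using g(2) by (intro tendsto_plus tendsto_times tendsto_const) (auto simp: A)
    moreover have "K_comb (mzv ` arrays_wt \<Sigma> w) (\<lambda>t. g t + c * mzv A t)"
      using g A K_comb_Cons by (intro K_comb.K_comb_Cons) auto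
    ultimately show ?case by (intro exI[of _ "\<lambda>t. g t + c * mzv A t"] conjI allI)
  qed
  thus ?thesis using that by blast
qed

lemma mzv_mult_mzv:
  assumes "A \<in> arrays_wt \<Sigma> w" "B \<in> arrays_wt \<Sigma>' w'" "finite \<Sigma>" "finite \<Sigma>'" "\<Sigma> \<inter> \<Sigma>' = {}"
  shows "K_comb (mzv ` arrays_wt (\<Sigma> \<union> \<Sigma>') (w + w')) (\<lambda>t. mzv A t * mzv B t)"
proof -
  obtain g where g: "K_comb (mzv ` arrays_wt (\<Sigma> \<union> \<Sigma>') (w + w')) g"
    "\<And>t. (\<lambda>N. trunc_mzv A t N * trunc_mzv B t N) \<longlonglongrightarrow> g t"
    using trunc_mzv_comb_tendsto[OF trunc_mzv_mult_trunc_mzv[OF assms]] assms by auto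
  have "(\<lambda>N. trunc_mzv A t N * trunc_mzv B t N) \<longlonglongrightarrow> mzv A t * mzv B t" for t
    using assms by (intro tendsto_times) (auto simp: arrays_wt_def intro: trunc_mzv_tendsto_mzv)
  hence "g t = mzv A t * mzv B t" for t using g(2)[of t] by (intro LIMSEQ_unique)
  thus ?thesis by (rule K_comb_cong[OF g(1)])
qed

end


section \<open>Carlitz's formula\<close>

context C_infinity
begin

lemma \<theta>_power_q_neq: "i < d \<Longrightarrow> \<theta> ^ (q ^ d) \<noteq> \<theta> ^ (q ^ i)"
proof
  assume "i < d" "\<theta> ^ (q ^ d) = \<theta> ^ (q ^ i)"
  from this(2) have "(2::real) ^ (q ^ d) = 2 ^ (q ^ i)" by (metis absv_power absv_\<theta>)
  hence "q ^ d = q ^ i" by simp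
  thus False using \<open>i < d\<close> q_gt_1 by simp
qed

lemma D_0 [simp]: "D 0 = 1"
  by (simp add: D_def)

lemma D_Suc: "D (Suc d) = (\<theta> ^ (q ^ Suc d) - \<theta>) * D d ^ q"
proof -
  have "D (Suc d) = (\<theta> ^ (q ^ Suc d) - \<theta> ^ (q ^ 0)) * (\<Prod>i<d. \<theta> ^ (q ^ Suc d) - \<theta> ^ (q ^ Suc i))"
    unfolding D_def by (rule prod.lessThan_Suc_shift)
  also have "(\<Prod>i<d. \<theta> ^ (q ^ Suc d) - \<theta> ^ (q ^ Suc i)) = (\<Prod>i<d. (\<theta> ^ (q ^ d) - \<theta> ^ (q ^ i)) ^ q)"
    by (intro prod.cong refl) (simp add: diff_power_q mult.commute flip: power_mult)
  also have "\<dots> = D d ^ q" by (simp add: D_def prod_power_distrib)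
  finally show ?thesis by simp
qed

lemma D_nonzero [simp]: "D d \<noteq> 0"
  by (auto simp: D_def \<theta>_power_q_neq)

lemma ell_0 [simp]: "ell 0 = 1"
  by (simp add: ell_def)

lemma ell_Suc: "ell (Suc d) = ell d * (\<theta> - \<theta> ^ (q ^ Suc d))"
  by (simp add: ell_def)

lemma bracket_nonzero: "\<theta> ^ (q ^ Suc d) - \<theta> \<noteq> 0"
  using \<theta>_power_q_neq[of 0 "Suc d"] by simp

lemma ell_nonzero [simp]: "ell d \<noteq> 0"
proof (induction d)
  case (Suc d)
  have "\<theta> - \<theta> ^ (q ^ Suc d) \<noteq> 0" using bracket_nonzero[of d] by (metis eq_iff_diff_eq_0)
  thus ?case using Suc by (simp add: ell_Suc)
qed simp

lemma D_in_K: "D d \<in> K"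
  unfolding D_def by (intro K_prod K_diff K_power K_\<theta>)

text \<open>
  The polynomial \<open>e\<^sub>d(x) = \<Prod>(x - a)\<close>, where \<open>a\<close> runs through the polynomials of degree less than \<open>d\<close>,
  given by the recursion that makes its additivity evident.
\<close>

primrec carlitz :: "nat \<Rightarrow> 'c \<Rightarrow> 'c" where
  "carlitz 0 x = x"
| "carlitz (Suc d) x = carlitz d x ^ q - D d ^ (q - 1) * carlitz d x"

lemma carlitz_add: "carlitz d (x + y) = carlitz d x + carlitz d y"
  by (induction d) (simp_all add: add_power_q algebra_simps)

lemma carlitz_cst_mult: "carlitz d (cst c * x) = cst c * carlitz d x"
  by (induction d) (simp_all add: power_mult_distrib algebra_simps)

lemma power_q_minus_1_mult: "(x :: 'c) ^ (q - 1) * x = x ^ q"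
  using q_gt_1 by (metis power_minus_mult q_pos)

text \<open>
  This functional equation determines \<open>e\<^sub>d(\<theta>\<^sup>d)\<close> by induction on \<open>d\<close>.
\<close>

lemma carlitz_\<theta>_mult:
  "carlitz (Suc d) (\<theta> * x) = \<theta> * carlitz (Suc d) x + (\<theta> ^ (q ^ Suc d) - \<theta>) * carlitz d x ^ q"
proof (induction d)
  case 0
  show ?case by (simp add: power_mult_distrib algebra_simps)
next
  case (Suc d)
  define a where "a = carlitz (Suc d) x"
  define b where "b = carlitz d x"
  define B where "B = \<theta> ^ (q ^ Suc d) - \<theta>"
  define E where "E = D (Suc d)"
  have ab: "a = b ^ q - D d ^ (q - 1) * b" by (simp add: a_def b_def)
  have aq: "a ^ q = (b ^ q) ^ q - (D d ^ (q - 1)) ^ q * b ^ q"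
    unfolding ab by (simp add: diff_power_q power_mult_distrib)
  have Bq: "B ^ q = \<theta> ^ (q ^ Suc (Suc d)) - \<theta> ^ q"
    by (simp add: B_def diff_power_q mult_ac flip: power_mult)
  have EB: "E ^ (q - 1) * B = B ^ q * (D d ^ (q - 1)) ^ q"
  proof -
    have "E ^ (q - 1) * B = (B ^ (q - 1) * B) * (D d ^ q) ^ (q - 1)"
      by (simp add: E_def D_Suc B_def power_mult_distrib)
    also have "(D d ^ q) ^ (q - 1) = (D d ^ (q - 1)) ^ q" by (metis mult.commute power_mult)
    finally show ?thesis by (simp only: power_q_minus_1_mult)
  qed
  have "carlitz (Suc (Suc d)) (\<theta> * x) = (\<theta> * a + B * b ^ q) ^ q - E ^ (q - 1) * (\<theta> * a + B * b ^ q)"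
    by (simp only: carlitz.simps(2)[of "Suc d"] Suc.IH a_def b_def B_def E_def)
  also have "\<dots> = \<theta> ^ q * a ^ q + B ^ q * (b ^ q) ^ q - E ^ (q - 1) * \<theta> * a - (E ^ (q - 1) * B) * b ^ q"
    by (simp add: add_power_q power_mult_distrib algebra_simps)
  also have "\<dots> = \<theta> ^ q * a ^ q + B ^ q * ((b ^ q) ^ q - (D d ^ (q - 1)) ^ q * b ^ q) - E ^ (q - 1) * \<theta> * a"
    unfolding EB by (simp add: algebra_simps)
  also have "\<dots> = \<theta> * (a ^ q - E ^ (q - 1) * a) + (\<theta> ^ (q ^ Suc (Suc d)) - \<theta>) * a ^ q"
    unfolding aq[symmetric] Bq by (simp add: algebra_simps)
  finally show ?case
    by (simp only: carlitz.simps(2)[of "Suc d"] a_def E_def)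
qed

lemma carlitz_\<theta>_power: "carlitz d (\<theta> ^ d) = D d \<and> (\<forall>i<d. carlitz d (\<theta> ^ i) = 0)"
proof (induction d)
  case (Suc d)
  have 0: "carlitz (Suc d) (\<theta> ^ i) = 0" if "i \<le> d" for i
  proof (cases "i = d")
    case True
    thus ?thesis using Suc power_q_minus_1_mult[of "D d"] by simp
  next
    case False
    thus ?thesis using Suc that by (simp add: zero_power)
  qed
  have "carlitz (Suc d) (\<theta> * \<theta> ^ d) = (\<theta> ^ (q ^ Suc d) - \<theta>) * D d ^ q"
    unfolding carlitz_\<theta>_mult 0[OF order.refl] using Suc by simp
  thus ?case using 0 by (simp add: D_Suc less_Suc_eq_le del: carlitz.simps)
qed simp

text \<open>
  In the binomial expansion only the power \<open>c\<^bsup>q-1\<^esup>\<close> has a nonzero sum over the finite field.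
\<close>

lemma sum_cst_power_q_minus_1: "(\<Sum>c\<in>UNIV. (w + cst c * z) ^ (q - 1)) = - (z ^ (q - 1))"
proof -
  have "(\<Sum>c\<in>UNIV. c ^ (q - 1)) = (\<Sum>c\<in>UNIV-{0::'a}. c ^ (q - 1))"
    using q_gt_1 by (intro sum.mono_neutral_right) (auto simp: zero_power)
  hence power_sum_eq: "(\<Sum>c\<in>UNIV. c ^ (q - 1)) = (- 1 :: 'a)"
    using sum_nonzero_power_eq_minus_1[of "q - 1", where 'a = 'a] by (simp add: q_def)
  have "(\<Sum>c\<in>UNIV. (w + cst c * z) ^ (q - 1)) =
     (\<Sum>c\<in>UNIV. \<Sum>k\<le>q - 1. of_nat ((q - 1) choose k) * (cst c * z) ^ k * w ^ (q - 1 - k))"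
    by (subst add.commute) (simp only: binomial_ring)
  also have "\<dots> = (\<Sum>k\<le>q - 1. of_nat ((q - 1) choose k) * z ^ k * w ^ (q - 1 - k) * cst (\<Sum>c\<in>UNIV. c ^ k))"
    by (subst sum.swap) (simp add: sum_distrib_left sum_distrib_right cst_sum cst_power power_mult_distrib mult_ac)
  also have "\<dots> = (\<Sum>k\<in>{q - 1}. of_nat ((q - 1) choose k) * z ^ k * w ^ (q - 1 - k) * cst (\<Sum>c\<in>UNIV. c ^ k))"
    by (rule sum.mono_neutral_right) (auto simp: q_def sum_finite_field_power_eq_0)
  also have "\<dots> = - (z ^ (q - 1))"
    by (simp add: power_sum_eq cst_uminus del: One_nat_def)
  finally show ?thesis .
qed

text \<open>
  The additive polynomial \<open>y\<^sup>q - z\<^bsup>q-1\<^esup> y\<close> has the same value \<open>P\<close> at all the translates \<open>y = w + c z\<close>, so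
  that \<open>1/y = (y\<^bsup>q-1\<^esup> - z\<^bsup>q-1\<^esup>)/P\<close>.
\<close>

lemma sum_inverse_translates:
  assumes "w ^ q - z ^ (q - 1) * w \<noteq> 0"
  shows "w + cst c * z \<noteq> 0"
    and "(\<Sum>c\<in>UNIV. 1 / (w + cst c * z)) = - (z ^ (q - 1)) / (w ^ q - z ^ (q - 1) * w)"
proof -
  define P where "P = w ^ q - z ^ (q - 1) * w"
  have P: "(w + cst c * z) * ((w + cst c * z) ^ (q - 1) - z ^ (q - 1)) = P" for c
  proof -
    have "(w + cst c * z) * ((w + cst c * z) ^ (q - 1) - z ^ (q - 1)) =
      (w + cst c * z) ^ (q - 1) * (w + cst c * z) - z ^ (q - 1) * w - cst c * (z ^ (q - 1) * z)"
      by (simp add: algebra_simps)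
    also have "\<dots> = P"
      unfolding power_q_minus_1_mult P_def by (simp add: add_power_q power_mult_distrib)
    finally show ?thesis .
  qed
  have nz: "w + cst c * z \<noteq> 0" for c using P[of c] assms by (auto simp: P_def)
  thus "w + cst c * z \<noteq> 0" .
  have P0: "P \<noteq> 0" using assms by (simp add: P_def)
  have "1 / (w + cst c * z) = ((w + cst c * z) ^ (q - 1) - z ^ (q - 1)) / P" for c
    unfolding P[of c, symmetric] using P[of c] P0 nz[of c] by auto
  hence "(\<Sum>c\<in>UNIV. 1 / (w + cst c * z)) = (\<Sum>c\<in>UNIV. (w + cst c * z) ^ (q - 1) - z ^ (q - 1)) / P"
    by (simp add: sum_divide_distrib)
  also have "(\<Sum>c\<in>(UNIV :: 'a set). (w + cst c * z) ^ (q - 1) - z ^ (q - 1)) = - (z ^ (q - 1))"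
    using of_nat_q unfolding sum_subtractf sum_cst_power_q_minus_1 by (simp add: q_def)
  finally show "(\<Sum>c\<in>UNIV. 1 / (w + cst c * z)) = - (z ^ (q - 1)) / (w ^ q - z ^ (q - 1) * w)"
    by (simp add: P_def)
qed

text \<open>
  The left-hand side is the logarithmic derivative of \<open>e\<^sub>d\<close>, and \<open>D\<^sub>d/\<ell>\<^sub>d\<close> is the constant derivative of
  this additive polynomial. In the induction step the polynomials are grouped by their top
  coefficient \<open>c\<close>, which translates \<open>e\<^sub>d(x)\<close> by \<open>c D\<^sub>d\<close>.
\<close>

lemma sum_inverse_polys_lt:
  assumes "carlitz d x \<noteq> 0"
  shows "(\<Sum>b\<in>polys_lt d. 1 / (x + eval_at b \<theta>)) = D d / (ell d * carlitz d x)"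
  using assms
proof (induction d arbitrary: x)
  case (Suc d)
  define w where "w = carlitz d x"
  define z where "z = D d"
  define P where "P = w ^ q - z ^ (q - 1) * w"
  have P: "carlitz (Suc d) x = P" by (simp add: P_def w_def z_def)
  have P0: "P \<noteq> 0" using Suc.prems unfolding P .
  define B where "B = \<theta> ^ (q ^ Suc d) - \<theta>"
  have B0: "B \<noteq> 0" unfolding B_def by (rule bracket_nonzero)
  have c: "carlitz d (x + cst c * \<theta> ^ d) = w + cst c * z" for c
    using carlitz_\<theta>_power[of d] by (simp add: carlitz_add carlitz_cst_mult w_def z_def)
  note tr = sum_inverse_translates[OF P0[unfolded P_def]]
  have "(\<Sum>b\<in>polys_lt (Suc d). 1 / (x + eval_at b \<theta>)) =
      (\<Sum>c\<in>UNIV. \<Sum>b\<in>polys_lt d. 1 / ((x + cst c * \<theta> ^ d) + eval_at b \<theta>))"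
    unfolding sum_polys_lt_Suc eval_at_add eval_at_monom by (simp add: add_ac)
  also have "\<dots> = (\<Sum>c\<in>UNIV. z / (ell d * (w + cst c * z)))"
  proof (intro sum.cong refl)
    fix e :: 'a
    have "carlitz d (x + cst e * \<theta> ^ d) \<noteq> 0" unfolding c by (rule tr(1))
    from Suc.IH[OF this] show "(\<Sum>b\<in>polys_lt d. 1 / ((x + cst e * \<theta> ^ d) + eval_at b \<theta>)) = z / (ell d * (w + cst e * z))"
      unfolding c z_def .
  qed
  also have "\<dots> = z / ell d * (\<Sum>c\<in>UNIV. 1 / (w + cst c * z))"
    by (simp add: sum_distrib_left)
  also have "\<dots> = - (z ^ (q - 1) * z) / (ell d * P)"
    unfolding tr(2) P_def by simp
  also have "\<dots> = (B * z ^ q) / ((ell d * (- B)) * P)"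
    unfolding power_q_minus_1_mult using B0 by simp
  also have "\<dots> = D (Suc d) / (ell (Suc d) * P)"
    by (simp only: D_Suc ell_Suc B_def z_def minus_diff_eq)
  finally show ?case using P by simp
qed simp

text \<open>
  Carlitz's formula is the case \<open>x = \<theta>\<^sup>d\<close>, where \<open>e\<^sub>d(x) = D\<^sub>d\<close>.
\<close>

lemma sum_inverse_monics_eq_inverse_ell: "power_sum {} 1 t d = 1 / ell d"
proof -
  have "power_sum {} 1 t d = (\<Sum>b\<in>polys_lt d. 1 / (\<theta> ^ d + eval_at b \<theta>))"
    by (simp add: power_sum_def sum_monics eval_at_add eval_at_monom)
  thus ?thesis using carlitz_\<theta>_power[of d] by (simp add: sum_inverse_polys_lt)
qed

lemma trunc_mzv_one_eq: "trunc_mzv [({}, 1)] t N = (\<Sum>d<N. 1 / ell d)"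
  by (simp add: trunc_mzv_Cons sum_inverse_monics_eq_inverse_ell del: One_nat_def)

lemma zeta_one_has_sum: "((\<lambda>a. 1 / eval_at a \<theta>) has_sum mzv [({}, 1)] t) monic_polys"
proof (rule has_sum_nonarchimedean[where B = "\<lambda>N. \<Union>d<N. monics d"])
  have "sum (\<lambda>a. 1 / eval_at a \<theta>) (\<Union>d<N. monics d) = trunc_mzv [({}, 1)] t N" for N
  proof -
    have "sum (\<lambda>a. 1 / eval_at a \<theta>) (\<Union>d<N. monics d) = (\<Sum>d<N. \<Sum>a\<in>monics d. 1 / eval_at a \<theta>)"
      by (intro sum.UNION_disjoint ballI finite_monics) (auto simp: monics_def)
    thus ?thesis by (simp add: trunc_mzv_Cons power_sum_def)
  qed
  moreover have "trunc_mzv [({}, 1)] t \<longlonglongrightarrow> mzv [({}, 1)] t"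
    by (rule trunc_mzv_tendsto_mzv[of "{}"]) (auto simp: admissible_def)
  ultimately show "(\<lambda>N. sum (\<lambda>a. 1 / eval_at a \<theta>) (\<Union>d<N. monics d)) \<longlonglongrightarrow> mzv [({}, 1)] t" by simp
  fix e :: real assume e: "e > 0"
  have "eventually (\<lambda>N. (1/2 :: real) ^ N < e) sequentially"
    using e by (intro order_tendstoD(2)[OF LIMSEQ_power_zero]) auto
  thus "eventually (\<lambda>N. \<forall>a\<in>monic_polys - (\<Union>d<N. monics d). absv (1 / eval_at a \<theta>) \<le> e) sequentially"
  proof eventually_elim
    case (elim N)
    show ?case
    proof
      fix a :: "'a poly" assume "a \<in> monic_polys - (\<Union>d<N. monics d)"
      hence a: "a \<noteq> 0" "degree a \<ge> N" by (auto simp: monic_polys_def monics_def)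
      have "absv (1 / eval_at a \<theta>) = (1/2) ^ degree a"
        using a by (simp add: absv_divide absv_eval_at power_divide)
      also have "\<dots> \<le> (1/2) ^ N" using a by (intro power_decreasing) auto
      finally show "absv (1 / eval_at a \<theta>) \<le> e" using elim by simp
    qed
  qed
qed (simp, force simp: monics_def)

lemma zeta_one_eq_mzv: "zeta_one = mzv [({}, 1)] t"
  unfolding zeta_one_def by (rule infsumI[OF zeta_one_has_sum])

lemma sum_inverse_ell_tendsto: "(\<lambda>N. \<Sum>d<N. 1 / ell d) \<longlonglongrightarrow> zeta_one"
proof -
  have "trunc_mzv [({}, 1)] (\<lambda>_. 0) \<longlonglongrightarrow> zeta_one"
    unfolding zeta_one_eq_mzv[of "\<lambda>_. 0"]
    by (rule trunc_mzv_tendsto_mzv[of "{}"]) (auto simp: admissible_def)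
  moreover have "trunc_mzv [({}, 1)] (\<lambda>_. 0) = (\<lambda>N. \<Sum>d<N. 1 / ell d)" by (rule ext) (rule trunc_mzv_one_eq)
  ultimately show ?thesis by (simp only:)
qed


section \<open>The map \<open>G\<close> on trivial multiple zeta values\<close>

text \<open>
  The contribution of one variable to the coefficients of \<open>F\<close>. The value zero for \<open>n < k\<close> makes the
  restriction \<open>j \<le> i\<close> in these coefficients superfluous.
\<close>

definition inv_ell_twist :: "nat \<Rightarrow> nat \<Rightarrow> 'c" where
  "inv_ell_twist k n = (if k \<le> n then 1 / ell (n - k) ^ (q ^ k) else 0)"

lemma inv_ell_twist_tendsto_0: "inv_ell_twist k \<longlonglongrightarrow> 0"
proof (rule LIMSEQ_offset[of _ k])
  have "power_sum {} 1 (\<lambda>_. 0) \<longlonglongrightarrow> 0" by (rule power_sum_tendsto_0) simp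
  hence "(\<lambda>n. (power_sum {} 1 (\<lambda>_. 0) n) ^ (q ^ k)) \<longlonglongrightarrow> 0 ^ (q ^ k)" by (rule tendsto_pow)
  thus "(\<lambda>n. inv_ell_twist k (n + k)) \<longlonglongrightarrow> 0"
    unfolding sum_inverse_monics_eq_inverse_ell by (simp add: inv_ell_twist_def power_divide zero_power)
qed

lemma absv_inv_ell_twist_le: "absv (inv_ell_twist k n) \<le> 1"
proof -
  have "absv (1 / ell d) \<le> 1" for d
  proof -
    have "absv (power_sum {} 1 (\<lambda>_. 0) d) \<le> 1" unfolding power_sum_def
    proof (rule absv_sum_le)
      fix a :: "'a poly" assume "a \<in> monics d"
      hence "a \<noteq> 0" by (rule monics_nonzero)
      thus "absv ((\<Prod>j\<in>{}. eval_at a 0) / eval_at a \<theta> ^ 1) \<le> 1"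
        by (simp add: absv_divide absv_eval_at)
    qed simp
    thus ?thesis by (simp only: sum_inverse_monics_eq_inverse_ell)
  qed
  hence "absv (1 / ell d) ^ (q ^ k) \<le> 1" for d by (intro power_le_one) auto
  thus ?thesis by (simp add: inv_ell_twist_def absv_divide absv_power power_divide)
qed

lemma sum_inv_ell_twist_tendsto: "(\<lambda>N. \<Sum>n<N. inv_ell_twist k n) \<longlonglongrightarrow> zeta_one ^ (q ^ k)"
proof (rule LIMSEQ_offset[of _ k])
  have "(\<Sum>n<N + k. inv_ell_twist k n) = (\<Sum>d<N. 1 / ell d) ^ (q ^ k)" for N
    by (induction N) (auto simp: inv_ell_twist_def add_power_q_power zero_power power_divide)
  thus "(\<lambda>N. \<Sum>n<N + k. inv_ell_twist k n) \<longlonglongrightarrow> zeta_one ^ (q ^ k)"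
    using tendsto_pow[OF sum_inverse_ell_tendsto, of "q ^ k"] by simp
qed

lemma finite_bounded_multi_idx:
  assumes "finite \<Sigma>"
  shows "finite {j \<in> multi_idx \<Sigma>. \<forall>r\<in>\<Sigma>. j r \<le> B r}"
proof (rule finite_subset)
  show "{j \<in> multi_idx \<Sigma>. \<forall>r\<in>\<Sigma>. j r \<le> B r} \<subseteq>
     {j. \<forall>r. (r \<in> \<Sigma> \<longrightarrow> j r \<in> (\<Union>r\<in>\<Sigma>. {..B r})) \<and> (r \<notin> \<Sigma> \<longrightarrow> j r = 0)}"
    by (auto simp: multi_idx_def)
  show "finite {j. \<forall>r. (r \<in> \<Sigma> \<longrightarrow> j r \<in> (\<Union>r\<in>\<Sigma>. {..B r})) \<and> (r \<notin> \<Sigma> \<longrightarrow> j r = 0)}"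
    using assms by (intro finite_set_of_finite_funs) auto
qed

definition box :: "nat set \<Rightarrow> nat \<Rightarrow> (nat \<Rightarrow> nat) set" where
  "box \<Sigma> N = {i \<in> multi_idx \<Sigma>. \<forall>r\<in>\<Sigma>. i r < N}"

lemma finite_box: "finite \<Sigma> \<Longrightarrow> finite (box \<Sigma> N)"
  by (rule finite_subset[OF _ finite_bounded_multi_idx[of \<Sigma> "\<lambda>_. N"]]) (auto simp: box_def)

lemma sum_box_prod:
  fixes g :: "nat \<Rightarrow> nat \<Rightarrow> 'c"
  assumes "finite \<Sigma>"
  shows "(\<Sum>i\<in>box \<Sigma> N. \<Prod>r\<in>\<Sigma>. g r (i r)) = (\<Prod>r\<in>\<Sigma>. \<Sum>n<N. g r n)"
proof -
  have "(\<Prod>r\<in>\<Sigma>. \<Sum>n<N. g r n) = (\<Sum>i\<in>PiE \<Sigma> (\<lambda>_. {..<N}). \<Prod>r\<in>\<Sigma>. g r (i r))"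
    using assms by (intro prod_sum_PiE) auto
  also have "\<dots> = (\<Sum>i\<in>box \<Sigma> N. \<Prod>r\<in>\<Sigma>. g r (i r))"
    by (rule sum.reindex_bij_witness[of _ "\<lambda>i. restrict i \<Sigma>" "\<lambda>i r. if r \<in> \<Sigma> then i r else 0"])
       (auto simp: box_def multi_idx_def PiE_def extensional_def fun_eq_iff)
  finally show ?thesis by simp
qed

context
  fixes \<Sigma> :: "nat set" and f :: "(nat \<Rightarrow> 'c) \<Rightarrow> 'c" and J :: "(nat \<Rightarrow> nat) set"
  assumes \<Sigma>: "finite \<Sigma>" and J: "finite J" "J \<subseteq> multi_idx \<Sigma>"
    and f_0: "\<And>k. k \<in> multi_idx \<Sigma> - J \<Longrightarrow> f (\<theta>_pow k) = 0"
begin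

definition normalized_value where "normalized_value j = f (\<theta>_pow j) / (\<Prod>r\<in>\<Sigma>. D (j r))"

lemma F_coeff_eq:
  assumes i: "i \<in> multi_idx \<Sigma>"
  shows "F_coeff \<Sigma> f i = (\<Sum>j\<in>J. normalized_value j * (\<Prod>r\<in>\<Sigma>. inv_ell_twist (j r) (i r)))"
proof -
  define I where "I = {j \<in> multi_idx \<Sigma>. \<forall>r. j r \<le> i r}"
  have finI: "finite I"
    by (rule finite_subset[OF _ finite_bounded_multi_idx[OF \<Sigma>, of i]]) (auto simp: I_def)
  have tw: "f (\<theta>_pow j) / ((\<Prod>r\<in>\<Sigma>. D (j r)) * (\<Prod>r\<in>\<Sigma>. ell (i r - j r) ^ (q ^ j r))) =
     normalized_value j * (\<Prod>r\<in>\<Sigma>. inv_ell_twist (j r) (i r))" if "j \<in> I" for j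
  proof -
    have "(\<Prod>r\<in>\<Sigma>. inv_ell_twist (j r) (i r)) = (\<Prod>r\<in>\<Sigma>. 1 / ell (i r - j r) ^ (q ^ j r))"
      using that by (intro prod.cong refl) (auto simp: I_def inv_ell_twist_def)
    thus ?thesis by (simp add: normalized_value_def prod_dividef)
  qed
  have "F_coeff \<Sigma> f i = (\<Sum>j\<in>I. normalized_value j * (\<Prod>r\<in>\<Sigma>. inv_ell_twist (j r) (i r)))"
    unfolding F_coeff_def I_def[symmetric] by (intro sum.cong refl tw)
  also have "\<dots> = (\<Sum>j\<in>I \<inter> J. normalized_value j * (\<Prod>r\<in>\<Sigma>. inv_ell_twist (j r) (i r)))"
    using finI f_0 by (intro sum.mono_neutral_right) (auto simp: I_def normalized_value_def)
  also have "\<dots> = (\<Sum>j\<in>J. normalized_value j * (\<Prod>r\<in>\<Sigma>. inv_ell_twist (j r) (i r)))"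
  proof (rule sum.mono_neutral_left[OF J(1)])
    show "\<forall>j\<in>J - I \<inter> J. normalized_value j * (\<Prod>r\<in>\<Sigma>. inv_ell_twist (j r) (i r)) = 0"
    proof
      fix j assume j: "j \<in> J - I \<inter> J"
      then obtain r where r: "\<not> j r \<le> i r" using J(2) by (auto simp: I_def)
      have "r \<in> \<Sigma>"
      proof (rule ccontr)
        assume "r \<notin> \<Sigma>"
        hence "j r = 0" using j J(2) by (auto simp: multi_idx_def)
        thus False using r by simp
      qed
      hence "(\<Prod>r\<in>\<Sigma>. inv_ell_twist (j r) (i r)) = 0"
        using r \<Sigma> by (auto simp: inv_ell_twist_def)
      thus "normalized_value j * (\<Prod>r\<in>\<Sigma>. inv_ell_twist (j r) (i r)) = 0" by simp
    qed
  qed auto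
  finally show ?thesis .
qed

text \<open>
  Over a box the sum factors into sums in one variable, which tend to powers of \<open>\<zeta>\<^sub>A(1)\<close>. Outside of
  the box one factor of each product is small and the others are at most \<open>1\<close>.
\<close>

lemma F_coeff_has_sum:
  "(F_coeff \<Sigma> f has_sum (\<Sum>j\<in>J. normalized_value j * (\<Prod>r\<in>\<Sigma>. zeta_one ^ (q ^ j r)))) (multi_idx \<Sigma>)"
proof (rule has_sum_nonarchimedean[where B = "box \<Sigma>"])
  have "sum (F_coeff \<Sigma> f) (box \<Sigma> N) = (\<Sum>j\<in>J. normalized_value j * (\<Prod>r\<in>\<Sigma>. \<Sum>n<N. inv_ell_twist (j r) n))" for N
  proof -
    have "sum (F_coeff \<Sigma> f) (box \<Sigma> N) = (\<Sum>i\<in>box \<Sigma> N. \<Sum>j\<in>J. normalized_value j * (\<Prod>r\<in>\<Sigma>. inv_ell_twist (j r) (i r)))"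
      by (intro sum.cong refl F_coeff_eq) (auto simp: box_def)
    also have "\<dots> = (\<Sum>j\<in>J. normalized_value j * (\<Sum>i\<in>box \<Sigma> N. \<Prod>r\<in>\<Sigma>. inv_ell_twist (j r) (i r)))"
      by (subst sum.swap) (simp add: sum_distrib_left)
    also have "\<dots> = (\<Sum>j\<in>J. normalized_value j * (\<Prod>r\<in>\<Sigma>. \<Sum>n<N. inv_ell_twist (j r) n))"
      by (intro sum.cong refl arg_cong[where f = "\<lambda>x. normalized_value _ * x"] sum_box_prod \<Sigma>)
    finally show ?thesis .
  qed
  moreover have "(\<lambda>N. \<Sum>j\<in>J. normalized_value j * (\<Prod>r\<in>\<Sigma>. \<Sum>n<N. inv_ell_twist (j r) n))
     \<longlonglongrightarrow> (\<Sum>j\<in>J. normalized_value j * (\<Prod>r\<in>\<Sigma>. zeta_one ^ (q ^ j r)))"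
    by (intro tendsto_Sum tendsto_times tendsto_const tendsto_Prod sum_inv_ell_twist_tendsto)
  ultimately show "(\<lambda>N. sum (F_coeff \<Sigma> f) (box \<Sigma> N)) \<longlonglongrightarrow> (\<Sum>j\<in>J. normalized_value j * (\<Prod>r\<in>\<Sigma>. zeta_one ^ (q ^ j r)))"
    by simp
next
  fix e :: real assume e: "e > 0"
  have "eventually (\<lambda>N. \<forall>n\<ge>N. absv (normalized_value j) * absv (inv_ell_twist (j r) n) < e) sequentially" for j r
  proof -
    have "(\<lambda>n. normalized_value j * inv_ell_twist (j r) n) \<longlonglongrightarrow> normalized_value j * 0"
      by (intro tendsto_times tendsto_const inv_ell_twist_tendsto_0)
    hence "(\<lambda>n. absv (normalized_value j) * absv (inv_ell_twist (j r) n)) \<longlonglongrightarrow> 0"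
      by (simp add: tendsto_iff_absv absv_mult)
    hence "eventually (\<lambda>n. absv (normalized_value j) * absv (inv_ell_twist (j r) n) < e) sequentially"
      using e by (rule order_tendstoD(2))
    thus ?thesis unfolding eventually_sequentially by (meson order.trans)
  qed
  hence "eventually (\<lambda>N. \<forall>j\<in>J. \<forall>r\<in>\<Sigma>. \<forall>n\<ge>N. absv (normalized_value j) * absv (inv_ell_twist (j r) n) < e) sequentially"
    by (intro eventually_ball_finite ballI J \<Sigma>)
  thus "eventually (\<lambda>N. \<forall>i\<in>multi_idx \<Sigma> - box \<Sigma> N. absv (F_coeff \<Sigma> f i) \<le> e) sequentially"
  proof eventually_elim
    case (elim N)
    show ?case
    proof
      fix i assume "i \<in> multi_idx \<Sigma> - box \<Sigma> N"
      then obtain r where i: "i \<in> multi_idx \<Sigma>" "r \<in> \<Sigma>" "i r \<ge> N" by (auto simp: box_def not_less)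
      show "absv (F_coeff \<Sigma> f i) \<le> e" unfolding F_coeff_eq[OF i(1)]
      proof (rule absv_sum_le)
        fix j assume j: "j \<in> J"
        have "(\<Prod>s\<in>\<Sigma>. absv (inv_ell_twist (j s) (i s))) =
           absv (inv_ell_twist (j r) (i r)) * (\<Prod>s\<in>\<Sigma>-{r}. absv (inv_ell_twist (j s) (i s)))"
          by (rule prod.remove[OF \<Sigma> i(2)])
        also have "\<dots> \<le> absv (inv_ell_twist (j r) (i r)) * 1"
          by (intro mult_left_mono prod_le_1) (auto simp: absv_inv_ell_twist_le)
        finally have "absv (normalized_value j) * (\<Prod>s\<in>\<Sigma>. absv (inv_ell_twist (j s) (i s))) \<le> absv (normalized_value j) * absv (inv_ell_twist (j r) (i r))"
          by (intro mult_left_mono) auto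
        also have "\<dots> < e" using elim j i by auto
        finally show "absv (normalized_value j * (\<Prod>r\<in>\<Sigma>. inv_ell_twist (j r) (i r))) \<le> e"
          by (simp add: absv_mult absv_prod)
      qed (use e in simp)
    qed
  qed
qed (rule finite_box[OF \<Sigma>], force simp: box_def)

text \<open>
  Only the monomials \<open>X\<^sup>m\<close> with \<open>m r = q ^ i r\<close> contribute to the evaluation, and \<open>m\<close> determines \<open>i\<close>.
\<close>

lemma G_eq:
  "G \<Sigma> f = (\<Sum>j\<in>J. f (\<theta>_pow j) / (\<Prod>r\<in>\<Sigma>. D (j r)) * (\<Prod>r\<in>\<Sigma>. zeta_one ^ (q ^ j r)))"
proof -
  define h where "h = (\<lambda>(i :: nat \<Rightarrow> nat) r. if r \<in> \<Sigma> then q ^ i r else 0)"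
  have h_eq: "(\<forall>r\<in>\<Sigma>. q ^ i r = h i' r) \<longleftrightarrow> i = i'" if "i \<in> multi_idx \<Sigma>" "i' \<in> multi_idx \<Sigma>" for i i'
  proof
    assume *: "\<forall>r\<in>\<Sigma>. q ^ i r = h i' r"
    show "i = i'"
    proof
      fix r
      show "i r = i' r"
        using * that q_gt_1 by (cases "r \<in> \<Sigma>") (auto simp: multi_idx_def h_def)
    qed
  qed (auto simp: h_def)
  have inj: "inj_on h (multi_idx \<Sigma>)"
  proof (rule inj_onI)
    fix i i' assume i: "i \<in> multi_idx \<Sigma>" "i' \<in> multi_idx \<Sigma>" "h i = h i'"
    have "\<forall>r\<in>\<Sigma>. q ^ i r = h i' r" unfolding i(3)[symmetric] by (simp add: h_def)
    thus "i = i'" using h_eq i by blast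
  qed
  have F_h: "F \<Sigma> f (h i) = F_coeff \<Sigma> f i" if "i \<in> multi_idx \<Sigma>" for i
  proof -
    have "{i' \<in> multi_idx \<Sigma>. \<forall>r\<in>\<Sigma>. q ^ i' r = h i r} = {i}"
      using h_eq[of _ i] that by auto
    thus ?thesis by (simp add: F_def)
  qed
  have F_0: "F \<Sigma> f m = 0" if "m \<in> multi_idx \<Sigma> - h ` multi_idx \<Sigma>" for m
  proof -
    have "\<not> (\<forall>r\<in>\<Sigma>. q ^ i r = m r)" if i: "i \<in> multi_idx \<Sigma>" for i
    proof
      assume "\<forall>r\<in>\<Sigma>. q ^ i r = m r"
      hence "m = h i" using \<open>m \<in> multi_idx \<Sigma> - h ` multi_idx \<Sigma>\<close> by (auto simp: h_def multi_idx_def)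
      thus False using \<open>m \<in> multi_idx \<Sigma> - h ` multi_idx \<Sigma>\<close> i by auto
    qed
    hence "{i \<in> multi_idx \<Sigma>. \<forall>r\<in>\<Sigma>. q ^ i r = m r} = {}" by blast
    from arg_cong[OF this, of "sum (F_coeff \<Sigma> f)"] show ?thesis by (simp only: F_def sum.empty)
  qed
  let ?s = "\<Sum>j\<in>J. normalized_value j * (\<Prod>r\<in>\<Sigma>. zeta_one ^ (q ^ j r))"
  have "((F \<Sigma> f \<circ> h) has_sum ?s) (multi_idx \<Sigma>)"
    using F_coeff_has_sum by (subst has_sum_cong[of _ _ "F_coeff \<Sigma> f"]) (auto simp: F_h)
  hence "(F \<Sigma> f has_sum ?s) (h ` multi_idx \<Sigma>)" by (simp add: has_sum_reindex[OF inj])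
  moreover have sub: "h ` multi_idx \<Sigma> \<subseteq> multi_idx \<Sigma>" by (auto simp: h_def multi_idx_def)
  have "(F \<Sigma> f has_sum ?s) (h ` multi_idx \<Sigma>) \<longleftrightarrow> (F \<Sigma> f has_sum ?s) (multi_idx \<Sigma>)"
    by (rule has_sum_cong_neutral) (use F_0 sub in blast)+
  ultimately have "(F \<Sigma> f has_sum ?s) (multi_idx \<Sigma>)" by simp
  thus ?thesis unfolding G_def tate_eval_def normalized_value_def by (simp add: infsumI)
qed

end

end


section \<open>The ring of multiple zeta values\<close>

context C_infinity
begin

definition arrays :: "nat set \<Rightarrow> (nat set \<times> nat) list set" where
  "arrays \<Sigma> = {A. admissible \<Sigma> A}"

lemma Z_eq: "Z \<Sigma> = {f. K_comb (mzv ` arrays \<Sigma>) f}"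
proof -
  have "{mzv A | A. admissible \<Sigma> A} = mzv ` arrays \<Sigma>" by (auto simp: arrays_def)
  thus ?thesis by (simp add: Z_def K_span_eq)
qed

lemma Z_wt_eq: "Z_wt \<Sigma> n = {f. K_comb (mzv ` arrays_wt \<Sigma> n) f}"
proof -
  have "{mzv A | A. admissible \<Sigma> A \<and> weight A = n} = mzv ` arrays_wt \<Sigma> n" by (auto simp: arrays_wt_def)
  thus ?thesis by (simp add: Z_wt_def K_span_eq)
qed

lemma arrays_wt_subset_arrays: "arrays_wt \<Sigma> n \<subseteq> arrays \<Sigma>"
  by (auto simp: arrays_wt_def arrays_def)

lemma arrays_imp_arrays_wt: "A \<in> arrays \<Sigma> \<Longrightarrow> A \<in> arrays_wt \<Sigma> (weight A)"
  by (auto simp: arrays_wt_def arrays_def)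

lemma K_comb_mult:
  assumes "K_comb B f" "K_comb B' g" "\<And>b b'. b \<in> B \<Longrightarrow> b' \<in> B' \<Longrightarrow> K_comb C (\<lambda>x. b x * b' x)"
  shows "K_comb C (\<lambda>x. f x * g x)"
  using assms(1)
proof (rule K_comb_map)
  fix b assume b: "b \<in> B"
  show "K_comb C (\<lambda>x. b x * g x)"
    using assms(2) by (rule K_comb_map) (use assms(3)[OF b] in \<open>simp_all add: algebra_simps\<close>)
qed (simp_all add: algebra_simps)

definition MZV :: "'c set" where
  "MZV = {z. K_comb (mzv ` arrays {}) (\<lambda>_. z)}"

lemma carrier_MZV_ring: "carrier MZV_ring = MZV"
  by (simp add: MZV_ring_def MZV_def Z_eq)

lemma trunc_mzv_empty_cong: "admissible {} A \<Longrightarrow> trunc_mzv A t = trunc_mzv A t'"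
proof (induction A)
  case (Cons c A)
  obtain U i where c: "c = (U, i)" by force
  with Cons.prems have "U = {}" "admissible {} A" by (auto simp: admissible_Cons)
  thus ?case using Cons.IH by (intro ext) (simp add: c trunc_mzv_Cons power_sum_def)
next
  case Nil
  thus ?case by (intro ext) simp
qed

lemma mzv_empty_cong: "admissible {} A \<Longrightarrow> mzv A t = mzv A t'"
  unfolding mzv_def sum_decreasing_tuples_eq_trunc_mzv using trunc_mzv_empty_cong[of A t t'] by simp

lemma mzv_in_MZV: "A \<in> arrays {} \<Longrightarrow> mzv A t \<in> MZV"
proof -
  assume A: "A \<in> arrays {}"
  have "K_comb (mzv ` arrays {}) (mzv A)" using A by (intro K_comb_basis) auto
  thus ?thesis unfolding MZV_def using A mzv_empty_cong[of A _ t]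
    by (auto simp: arrays_def elim: K_comb_cong)
qed

lemma MZV_add: "x \<in> MZV \<Longrightarrow> y \<in> MZV \<Longrightarrow> x + y \<in> MZV"
  unfolding MZV_def by (auto intro: K_comb_add)

lemma MZV_scale: "x \<in> MZV \<Longrightarrow> c \<in> K \<Longrightarrow> c * x \<in> MZV"
  unfolding MZV_def by (auto intro: K_comb_scale)

lemma MZV_0: "0 \<in> MZV"
  unfolding MZV_def by (auto intro: K_comb_0)

lemma trunc_mzv_Nil_eq: "trunc_mzv [] t = (\<lambda>_. 1)"
  by (rule ext) simp

lemma mzv_Nil [simp]: "mzv [] t = 1"
proof -
  have "trunc_mzv [] t \<longlonglongrightarrow> mzv [] t" by (rule trunc_mzv_tendsto_mzv[of "{}"]) auto
  thus ?thesis unfolding trunc_mzv_Nil_eq by (metis LIMSEQ_unique tendsto_const)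
qed

lemma MZV_1: "1 \<in> MZV"
  using mzv_in_MZV[of "[]"] by (simp add: arrays_def)

lemma MZV_mult: "x \<in> MZV \<Longrightarrow> y \<in> MZV \<Longrightarrow> x * y \<in> MZV"
proof -
  assume "x \<in> MZV" "y \<in> MZV"
  hence xy: "K_comb (mzv ` arrays {}) (\<lambda>_. x)" "K_comb (mzv ` arrays {}) (\<lambda>_. y)"
    by (auto simp: MZV_def)
  have "K_comb (mzv ` arrays {}) (\<lambda>t. x * y)"
  proof (rule K_comb_mult[OF xy])
    fix b b' assume "b \<in> mzv ` arrays {}" "b' \<in> mzv ` arrays {}"
    then obtain A B where AB: "b = mzv A" "b' = mzv B" "A \<in> arrays_wt {} (weight A)" "B \<in> arrays_wt {} (weight B)"
      using arrays_imp_arrays_wt by blast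
    have "K_comb (mzv ` arrays_wt ({} \<union> {}) (weight A + weight B)) (\<lambda>t. mzv A t * mzv B t)"
      using AB by (intro mzv_mult_mzv) auto
    thus "K_comb (mzv ` arrays {}) (\<lambda>t. b t * b' t)"
      unfolding AB by (rule K_comb_mono) (use arrays_wt_subset_arrays in auto)
  qed
  thus ?thesis by (simp add: MZV_def)
qed

lemma MZV_uminus: "x \<in> MZV \<Longrightarrow> - x \<in> MZV"
  using MZV_scale[of x "-1"] K_uminus[OF K_1] by simp

lemma MZV_sum: "(\<And>i. i \<in> I \<Longrightarrow> f i \<in> MZV) \<Longrightarrow> sum f I \<in> MZV"
  by (induction I rule: infinite_finite_induct) (auto intro: MZV_add MZV_0)

lemma MZV_power: "x \<in> MZV \<Longrightarrow> x ^ n \<in> MZV"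
  by (induction n) (auto intro: MZV_mult MZV_1)

lemma MZV_prod: "(\<And>i. i \<in> I \<Longrightarrow> f i \<in> MZV) \<Longrightarrow> prod f I \<in> MZV"
  by (induction I rule: infinite_finite_induct) (auto intro: MZV_mult MZV_1)

lemma zeta_one_in_MZV: "zeta_one \<in> MZV"
  unfolding zeta_one_eq_mzv[of "\<lambda>_. 0"] by (rule mzv_in_MZV) (simp add: arrays_def admissible_def)

lemma cring_MZV_ring: "cring MZV_ring"
proof (rule cringI)
  show "abelian_group MZV_ring"
  proof (rule abelian_groupI)
    fix x assume "x \<in> carrier MZV_ring"
    thus "\<exists>y\<in>carrier MZV_ring. y \<oplus>\<^bsub>MZV_ring\<^esub> x = \<zero>\<^bsub>MZV_ring\<^esub>"
      unfolding carrier_MZV_ring by (intro bexI[of _ "- x"]) (auto simp: MZV_ring_def MZV_uminus)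
  qed (unfold carrier_MZV_ring, simp_all add: MZV_ring_def MZV_add MZV_0 add_ac)
  show "comm_monoid MZV_ring"
    by (rule comm_monoidI) (unfold carrier_MZV_ring, simp_all add: MZV_ring_def MZV_mult MZV_1 mult_ac)
qed (simp add: MZV_ring_def algebra_simps)


section \<open>Values at \<open>\<theta>\<^bsup>q^k\<^esup>\<close>\<close>

text \<open>
  The truncations of a multiple zeta value at a point \<open>\<theta>\<^bsup>q^k\<^esup>\<close> need not be truncations of arrays: a
  column whose exponent is not positive contributes only finitely many degrees. Combinations of
  arrays up to finitely many terms in \<open>K\<close> are stable under summation against both sorts of columns.
\<close>

definition tame :: "(nat \<Rightarrow> 'c) \<Rightarrow> bool" where
  "tame h \<longleftrightarrow> (\<forall>N. h N \<in> K) \<and>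
     (\<exists>g. K_comb ((\<lambda>A. trunc_mzv A (\<lambda>_. 0)) ` arrays {}) g \<and> eventually (\<lambda>N. h N = g N) sequentially)"

lemma power_sum_empty_in_K: "power_sum {} s t d \<in> K"
  unfolding power_sum_def by (auto intro!: K_sum K_divide K_power K_eval_at)

lemma trunc_mzv_empty_in_K: "admissible {} A \<Longrightarrow> trunc_mzv A t N \<in> K"
proof (induction A arbitrary: N)
  case (Cons c A)
  obtain U i where c: "c = (U, i)" by force
  with Cons.prems have "U = {}" "admissible {} A" by (auto simp: admissible_Cons)
  thus ?case using Cons.IH by (auto simp: c trunc_mzv_Cons intro!: K_sum K_mult power_sum_empty_in_K)
qed simp

lemma K_comb_trunc_mzv_empty_in_K: "K_comb ((\<lambda>A. trunc_mzv A t) ` arrays {}) g \<Longrightarrow> g N \<in> K"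
  by (induction rule: K_comb.induct) (auto simp: arrays_def intro!: K_add K_mult trunc_mzv_empty_in_K)

lemma K_comb_const: "c \<in> K \<Longrightarrow> K_comb ((\<lambda>A. trunc_mzv A t) ` arrays {}) (\<lambda>_. c)"
proof -
  assume c: "c \<in> K"
  have "trunc_mzv [] t \<in> (\<lambda>A. trunc_mzv A t) ` arrays {}" by (auto simp: arrays_def)
  from K_comb_scale[OF K_comb_basis[OF this] c] show ?thesis by simp
qed

lemma tame_1: "tame (\<lambda>_. 1)"
  unfolding tame_def using K_comb_const[of 1 "\<lambda>_. 0"] by auto

text \<open>
  A finite discrepancy in \<open>h\<close> changes the partial sums by an eventually constant element of \<open>K\<close>, a
  multiple of the value of the empty array.
\<close>

lemma tame_sum_power_sum:
  assumes h: "tame h" and s: "s > 0"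
  shows "tame (\<lambda>N. \<Sum>d<N. power_sum {} s (\<lambda>_. 0) d * h d)"
proof -
  let ?B = "(\<lambda>A. trunc_mzv A (\<lambda>_. 0)) ` arrays {}" and ?power_sum = "power_sum {} s (\<lambda>_. 0)"
  from h obtain g N0 where hK: "\<And>N. h N \<in> K" and g: "K_comb ?B g" "\<And>N. N \<ge> N0 \<Longrightarrow> h N = g N"
    by (auto simp: tame_def eventually_sequentially)
  define c where "c = (\<Sum>d<N0. ?power_sum d * (h d - g d))"
  have gK: "g N \<in> K" for N using K_comb_trunc_mzv_empty_in_K[OF g(1)] .
  have "K_comb ?B (\<lambda>N. \<Sum>d<N. ?power_sum d * g d)" using g(1)
  proof (rule K_comb_map)
    fix b assume "b \<in> ?B"
    then obtain A where A: "A \<in> arrays {}" "b = trunc_mzv A (\<lambda>_. 0)" by auto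
    have "(\<lambda>N. \<Sum>d<N. ?power_sum d * b d) = trunc_mzv (({}, s) # A) (\<lambda>_. 0)"
      by (rule ext) (simp add: A trunc_mzv_Cons)
    moreover have "({}, s) # A \<in> arrays {}" using A s by (auto simp: arrays_def admissible_Cons)
    ultimately show "K_comb ?B (\<lambda>N. \<Sum>d<N. ?power_sum d * b d)" by (auto intro: K_comb_basis)
  qed (simp_all add: algebra_simps sum.distrib sum_distrib_left)
  hence "K_comb ?B (\<lambda>N. (\<Sum>d<N. ?power_sum d * g d) + c)"
    by (rule K_comb_add[OF _ K_comb_const]) (auto simp: c_def intro!: K_sum K_mult K_diff power_sum_empty_in_K hK gK)
  moreover have "(\<Sum>d<N. ?power_sum d * h d) = (\<Sum>d<N. ?power_sum d * g d) + c" if "N \<ge> N0" for N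
  proof -
    have "(\<Sum>d<N. ?power_sum d * h d) - (\<Sum>d<N. ?power_sum d * g d) = (\<Sum>d<N. ?power_sum d * (h d - g d))"
      by (simp add: algebra_simps sum_subtractf)
    also have "\<dots> = c" unfolding c_def
      by (rule sum.mono_neutral_right) (use that g(2) in auto)
    finally show ?thesis by (simp add: algebra_simps)
  qed
  ultimately show ?thesis unfolding tame_def eventually_sequentially
    by (intro conjI allI exI[of _ "\<lambda>N. (\<Sum>d<N. ?power_sum d * g d) + c"])
       (auto intro!: K_sum K_mult power_sum_empty_in_K hK)
qed

lemma tame_sum_finite_support:
  assumes h: "tame h" and f: "\<And>d. f d \<in> K" "\<And>d. d \<ge> m \<Longrightarrow> f d = 0"
  shows "tame (\<lambda>N. \<Sum>d<N. f d * h d)"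
proof -
  have hK: "h N \<in> K" for N using h by (simp add: tame_def)
  define c where "c = (\<Sum>d<m. f d * h d)"
  have cK: "c \<in> K" unfolding c_def by (intro K_sum K_mult f hK)
  have "(\<Sum>d<N. f d * h d) = c" if "N \<ge> m" for N
    unfolding c_def by (rule sum.mono_neutral_right) (use that f in auto)
  thus ?thesis unfolding tame_def eventually_sequentially
    by (intro conjI allI exI[of _ "\<lambda>_. c"] K_comb_const cK) (auto intro!: K_sum K_mult f hK)
qed

lemma prod_eval_at_\<theta>_pow: "(\<Prod>j\<in>U. eval_at a (\<theta>_pow k j)) = eval_at a \<theta> ^ (\<Sum>j\<in>U. q ^ k j)"
  by (simp add: \<theta>_pow_def eval_at_power_q_power power_sum)

text \<open>
  At \<open>\<theta>\<^bsup>q^k\<^esup>\<close> the numerator of the column \<open>(U, s)\<close> is \<open>a\<^sup>m\<close> with \<open>m = \<Sum>\<^sub>j q^k\<^sub>j\<close>. For \<open>m < s\<close> this is the column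
  \<open>({}, s - m)\<close>; for \<open>m \<ge> s\<close> it is a sum of nonnegative powers, which is zero in degrees above \<open>m - s\<close>.
\<close>

lemma tame_trunc_mzv_\<theta>_pow:
  assumes "\<forall>c\<in>set A. 0 < snd c"
  shows "tame (trunc_mzv A (\<theta>_pow k))"
  using assms
proof (induction A)
  case Nil
  thus ?case using tame_1 by (simp add: trunc_mzv_Nil_eq)
next
  case (Cons c A)
  obtain U s where c: "c = (U, s)" by force
  define m where "m = (\<Sum>j\<in>U. q ^ k j)"
  have power_sum: "power_sum U s (\<theta>_pow k) d = (\<Sum>a\<in>monics d. eval_at a \<theta> ^ m / eval_at a \<theta> ^ s)" for d
    unfolding power_sum_def prod_eval_at_\<theta>_pow m_def ..
  have tame: "tame (trunc_mzv A (\<theta>_pow k))" using Cons by simp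
  have eq: "trunc_mzv (c # A) (\<theta>_pow k) = (\<lambda>N. \<Sum>d<N. power_sum U s (\<theta>_pow k) d * trunc_mzv A (\<theta>_pow k) d)"
    by (rule ext) (simp add: c trunc_mzv_Cons)
  show ?case
  proof (cases "m < s")
    case True
    have "power_sum U s (\<theta>_pow k) d = power_sum {} (s - m) (\<lambda>_. 0) d" for d
      unfolding power_sum unfolding power_sum_def
    proof (intro sum.cong refl)
      fix a :: "'a poly" assume "a \<in> monics d"
      hence "eval_at a \<theta> \<noteq> 0" using monics_nonzero by simp
      moreover have "eval_at a \<theta> ^ s = eval_at a \<theta> ^ m * eval_at a \<theta> ^ (s - m)"
        using True by (simp flip: power_add)
      ultimately show "eval_at a \<theta> ^ m / eval_at a \<theta> ^ s = (\<Prod>j\<in>{}. eval_at a 0) / eval_at a \<theta> ^ (s - m)"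
        by simp
    qed
    thus ?thesis unfolding eq using tame_sum_power_sum[OF tame, of "s - m"] True by simp
  next
    case False
    have power_sum': "power_sum U s (\<theta>_pow k) d = (\<Sum>a\<in>monics d. eval_at a \<theta> ^ (m - s))" for d
      unfolding power_sum
    proof (intro sum.cong refl)
      fix a :: "'a poly" assume "a \<in> monics d"
      hence "eval_at a \<theta> \<noteq> 0" using monics_nonzero by simp
      thus "eval_at a \<theta> ^ m / eval_at a \<theta> ^ s = eval_at a \<theta> ^ (m - s)"
        using False by (simp add: power_diff)
    qed
    show ?thesis unfolding eq
    proof (rule tame_sum_finite_support[OF tame, where m = "Suc (m - s)"])
      show "power_sum U s (\<theta>_pow k) d \<in> K" for d unfolding power_sum' by (intro K_sum K_power K_eval_at)
      show "power_sum U s (\<theta>_pow k) d = 0" if "d \<ge> Suc (m - s)" for d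
        unfolding power_sum' using that by (intro sum_monics_power_eq_0) auto
    qed
  qed
qed

lemma tame_tendsto_MZV:
  assumes "tame h" "h \<longlonglongrightarrow> z"
  shows "z \<in> MZV"
proof -
  from assms(1) obtain g where g: "K_comb ((\<lambda>A. trunc_mzv A (\<lambda>_. 0)) ` arrays {}) g"
    "eventually (\<lambda>N. h N = g N) sequentially" by (auto simp: tame_def)
  have "\<exists>z. g \<longlonglongrightarrow> z \<and> z \<in> MZV" using g(1)
  proof (induction rule: K_comb.induct)
    case K_comb_0
    show ?case using MZV_0 by blast
  next
    case (K_comb_Cons h c b)
    then obtain z A where *: "h \<longlonglongrightarrow> z" "z \<in> MZV" "A \<in> arrays {}" "b = trunc_mzv A (\<lambda>_. 0)" by auto
    have "trunc_mzv A (\<lambda>_. 0) \<longlonglongrightarrow> mzv A (\<lambda>_. 0)"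
      using * by (intro trunc_mzv_tendsto_mzv[of "{}"]) (auto simp: arrays_def)
    hence "(\<lambda>N. h N + c * b N) \<longlonglongrightarrow> z + c * mzv A (\<lambda>_. 0)"
      unfolding *(4) by (intro tendsto_plus tendsto_times tendsto_const *(1))
    moreover have "z + c * mzv A (\<lambda>_. 0) \<in> MZV"
      using * K_comb_Cons by (intro MZV_add MZV_scale mzv_in_MZV)
    ultimately show ?case by blast
  qed
  then obtain z' where z': "g \<longlonglongrightarrow> z'" "z' \<in> MZV" by blast
  have "h \<longlonglongrightarrow> z'" using z'(1) g(2) by (simp add: tendsto_cong)
  with assms(2) have "z = z'" by (rule LIMSEQ_unique)
  thus ?thesis using z' by simp
qed

lemma Z_value_in_MZV:
  assumes "f \<in> Z \<Sigma>" "finite \<Sigma>"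
  shows "f (\<theta>_pow k) \<in> MZV"
proof -
  have "K_comb (mzv ` arrays \<Sigma>) f" using assms by (simp add: Z_eq)
  thus ?thesis
  proof (induction rule: K_comb.induct)
    case (K_comb_Cons h c b)
    then obtain A where A: "admissible \<Sigma> A" "b = mzv A" by (auto simp: arrays_def)
    have "tame (trunc_mzv A (\<theta>_pow k))"
      using A by (intro tame_trunc_mzv_\<theta>_pow) (auto simp: admissible_def)
    moreover have "trunc_mzv A (\<theta>_pow k) \<longlonglongrightarrow> mzv A (\<theta>_pow k)"
      using A assms by (intro trunc_mzv_tendsto_mzv)
    ultimately have "mzv A (\<theta>_pow k) \<in> MZV" by (rule tame_tendsto_MZV)
    thus ?case using A K_comb_Cons by (intro MZV_add MZV_scale) auto
  qed (rule MZV_0)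
qed


section \<open>The image of \<open>G\<close>\<close>

lemma Z_triv_cases:
  assumes "f \<in> Z_triv \<Sigma>"
  shows "f \<in> Z \<Sigma> \<and> finite {k \<in> multi_idx \<Sigma>. f (\<theta>_pow k) \<noteq> 0}"
proof -
  from assms obtain N h where f: "f = (\<lambda>t. \<Sum>n\<in>N. h n t)" "finite N" "\<forall>n\<in>N. h n \<in> Z_triv_wt \<Sigma> n"
    by (auto simp: Z_triv_def)
  have "K_comb (mzv ` arrays \<Sigma>) (\<lambda>t. \<Sum>n\<in>N. h n t)"
  proof (rule K_comb_sum)
    fix n assume "n \<in> N"
    hence "K_comb (mzv ` arrays_wt \<Sigma> n) (h n)" using f by (auto simp: Z_triv_wt_def Z_wt_eq)
    thus "K_comb (mzv ` arrays \<Sigma>) (h n)" by (rule K_comb_mono) (intro image_mono arrays_wt_subset_arrays)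
  qed
  moreover have "finite {k \<in> multi_idx \<Sigma>. f (\<theta>_pow k) \<noteq> 0}"
  proof (rule finite_subset)
    show "{k \<in> multi_idx \<Sigma>. f (\<theta>_pow k) \<noteq> 0} \<subseteq> (\<Union>n\<in>N. {k \<in> multi_idx \<Sigma>. h n (\<theta>_pow k) \<noteq> 0})"
      by (auto simp: f(1) intro: sum.neutral)
    show "finite (\<Union>n\<in>N. {k \<in> multi_idx \<Sigma>. h n (\<theta>_pow k) \<noteq> 0})"
      using f by (auto simp: Z_triv_wt_def)
  qed
  ultimately show ?thesis by (simp add: f(1) Z_eq)
qed

lemma G_in_ideal:
  assumes "f \<in> Z_triv \<Sigma>" "finite \<Sigma>"
  obtains z where "z \<in> MZV" "G \<Sigma> f = z * zeta_one ^ card \<Sigma>"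
proof -
  define J where "J = {k \<in> multi_idx \<Sigma>. f (\<theta>_pow k) \<noteq> 0}"
  have f: "f \<in> Z \<Sigma>" "finite J" using Z_triv_cases[OF assms(1)] by (auto simp: J_def)
  \<comment> \<open>Each exponent \<open>q ^ j r\<close> is positive, which leaves one factor \<open>\<zeta>\<^sub>A(1)\<close> for each \<open>r \<in> \<Sigma>\<close>.\<close>
  define z where "z = (\<Sum>j\<in>J. f (\<theta>_pow j) / (\<Prod>r\<in>\<Sigma>. D (j r)) * (\<Prod>r\<in>\<Sigma>. zeta_one ^ (q ^ j r - 1)))"
  have "G \<Sigma> f = (\<Sum>j\<in>J. f (\<theta>_pow j) / (\<Prod>r\<in>\<Sigma>. D (j r)) * (\<Prod>r\<in>\<Sigma>. zeta_one ^ (q ^ j r)))"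
    using f by (intro G_eq assms(2)) (auto simp: J_def)
  also have "\<dots> = z * zeta_one ^ card \<Sigma>"
    unfolding z_def sum_distrib_right
  proof (intro sum.cong refl)
    fix j :: "nat \<Rightarrow> nat"
    have "zeta_one ^ (q ^ j r) = zeta_one ^ (q ^ j r - 1) * zeta_one" for r
      by (metis power_minus_mult q_pos zero_less_power)
    hence "(\<Prod>r\<in>\<Sigma>. zeta_one ^ (q ^ j r)) = (\<Prod>r\<in>\<Sigma>. zeta_one ^ (q ^ j r - 1)) * zeta_one ^ card \<Sigma>"
      by (simp add: prod.distrib)
    thus "f (\<theta>_pow j) / (\<Prod>r\<in>\<Sigma>. D (j r)) * (\<Prod>r\<in>\<Sigma>. zeta_one ^ (q ^ j r)) =
      f (\<theta>_pow j) / (\<Prod>r\<in>\<Sigma>. D (j r)) * (\<Prod>r\<in>\<Sigma>. zeta_one ^ (q ^ j r - 1)) * zeta_one ^ card \<Sigma>"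
      by (simp only: mult.assoc)
  qed
  finally have "G \<Sigma> f = z * zeta_one ^ card \<Sigma>" .
  moreover have "z \<in> MZV" unfolding z_def
  proof (intro MZV_sum MZV_mult MZV_prod MZV_power zeta_one_in_MZV)
    fix j
    have "inverse (\<Prod>r\<in>\<Sigma>. D (j r)) * f (\<theta>_pow j) \<in> MZV"
      by (intro MZV_scale Z_value_in_MZV[OF f(1) assms(2)] K_inverse K_prod D_in_K)
    thus "f (\<theta>_pow j) / (\<Prod>r\<in>\<Sigma>. D (j r)) \<in> MZV" by (simp add: divide_inverse mult.commute)
  qed
  ultimately show ?thesis using that by blast
qed

lemma q_minus_1_dvd: "(q - 1) dvd (q ^ k - 1)"
proof (induction k)
  case (Suc k)
  have "q ^ Suc k - 1 = q * (q ^ k - 1) + (q - 1)"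
  proof -
    have "q * 1 \<le> q * q ^ k" by (intro mult_le_mono2) (simp add: Suc_le_eq)
    thus ?thesis using q_gt_1 by (simp add: diff_mult_distrib2)
  qed
  thus ?case using Suc by (metis dvd_add dvd_mult dvd_refl)
qed simp

text \<open>
  A nonzero polynomial is a constant \<open>c\<close> times a monic one, and \<open>c\<^sup>m = 1\<close>. So the sum over monic
  polynomials is the negative of the sum over nonzero ones, while the sum over all polynomials of
  degree less than \<open>N\<close> vanishes. For \<open>m = 0\<close> the difference is the term \<open>0\<^sup>0 = 1\<close>.
\<close>

lemma sum_monics_lt_power:
  assumes "(q - 1) dvd m" "m < N"
  shows "(\<Sum>d<N. \<Sum>a\<in>monics d. eval_at a \<theta> ^ m) = (if m = 0 then 1 else 0)"
proof -
  let ?X = "\<Sum>d<N. \<Sum>a\<in>monics d. eval_at a \<theta> ^ m"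
  have "(\<Sum>n\<in>polys_lt N - {0}. eval_at n \<theta> ^ m) =
     (\<Sum>c\<in>UNIV-{0}. \<Sum>d<N. \<Sum>a\<in>monics d. eval_at (smult c a) \<theta> ^ m)"
    by (rule sum_polys_lt_nonzero)
  also have "\<dots> = cst (\<Sum>c\<in>UNIV-{0}. c ^ m) * ?X"
    unfolding cst_sum sum_distrib_right by (intro sum.cong refl)
      (simp add: eval_at_smult power_mult_distrib cst_power sum_distrib_left)
  also have "(\<Sum>c\<in>UNIV-{0}. c ^ m) = (-1 :: 'a)"
    using assms(1) by (intro sum_nonzero_power_eq_minus_1) (simp add: q_def)
  finally have 1: "?X = - (\<Sum>n\<in>polys_lt N - {0}. eval_at n \<theta> ^ m)" by (simp add: cst_uminus)
  have 2: "(\<Sum>n\<in>polys_lt N. eval_at n \<theta> ^ m) = 0" using assms(2) by (rule sum_polys_lt_power_eq_0)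
  have "0 \<in> (polys_lt N :: 'a poly set)" by (simp add: polys_lt_def)
  hence 3: "(\<Sum>n\<in>polys_lt N. eval_at n \<theta> ^ m) = 0 ^ m + (\<Sum>n\<in>polys_lt N - {0}. eval_at n \<theta> ^ m)"
    by (subst sum.remove[of _ 0]) auto
  have "?X = 0 ^ m" using 1 2[unfolded 3] by (metis eq_neg_iff_add_eq_0)
  thus ?thesis by (cases "m = 0") (simp_all only: zero_power power_0 if_True if_False simp_thms)
qed

text \<open>
  The array of \<open>\<zeta>\<^sub>A(\<Sigma>; |\<Sigma>|)\<close>. A column of weight \<open>0\<close> is not admissible, and for \<open>\<Sigma> = {}\<close> the empty array
  takes its place.
\<close>

definition triv_arr :: "nat set \<Rightarrow> (nat set \<times> nat) list" where
  "triv_arr \<Sigma> = (if \<Sigma> = {} then [] else [(\<Sigma>, card \<Sigma>)])"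

lemma triv_arr_in_arrays_wt: "finite \<Sigma> \<Longrightarrow> triv_arr \<Sigma> \<in> arrays_wt \<Sigma> (card \<Sigma>)"
  by (auto simp: triv_arr_def arrays_wt_Cons arrays_wt_Nil card_gt_0_iff)

text \<open>
  The value is the limit of power sums with exponent \<open>\<Sum>\<^sub>r q^k\<^sub>r - |\<Sigma>| = \<Sum>\<^sub>r (q^k\<^sub>r - 1)\<close>, a multiple of
  \<open>q - 1\<close> that is zero for \<open>k = 0\<close> only.
\<close>

lemma mzv_triv_arr_\<theta>_pow:
  assumes "finite \<Sigma>" "k \<in> multi_idx \<Sigma>"
  shows "mzv (triv_arr \<Sigma>) (\<theta>_pow k) = (if k = (\<lambda>_. 0) then 1 else 0)"
proof (cases "\<Sigma> = {}")
  case True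
  thus ?thesis using assms by (auto simp: triv_arr_def multi_idx_def)
next
  case False
  define m where "m = (\<Sum>r\<in>\<Sigma>. q ^ k r - 1)"
  have dvd: "(q - 1) dvd m" unfolding m_def by (intro dvd_sum q_minus_1_dvd)
  have m0: "m = 0 \<longleftrightarrow> k = (\<lambda>_. 0)"
  proof -
    have "m = 0 \<longleftrightarrow> (\<forall>r\<in>\<Sigma>. q ^ k r - 1 = 0)" using assms(1) by (simp add: m_def)
    also have "\<dots> \<longleftrightarrow> (\<forall>r\<in>\<Sigma>. k r = 0)"
    proof (intro ball_cong refl)
      fix r
      have "q ^ k r > 1" if "k r \<noteq> 0" using that q_gt_1 by (intro one_less_power) auto
      thus "(q ^ k r - 1 = 0) = (k r = 0)" by (cases "k r = 0") (auto simp del: One_nat_def)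
    qed
    also have "\<dots> \<longleftrightarrow> k = (\<lambda>_. 0)" using assms(2) by (auto simp: multi_idx_def fun_eq_iff)
    finally show ?thesis .
  qed
  have sum_eq: "(\<Sum>r\<in>\<Sigma>. q ^ k r) = m + card \<Sigma>"
  proof -
    have "(\<Sum>r\<in>\<Sigma>. q ^ k r) = (\<Sum>r\<in>\<Sigma>. (q ^ k r - 1) + 1)"
      by (intro sum.cong refl) simp
    thus ?thesis unfolding sum.distrib by (simp add: m_def)
  qed
  have power_sum: "power_sum \<Sigma> (card \<Sigma>) (\<theta>_pow k) d = (\<Sum>a\<in>monics d. eval_at a \<theta> ^ m)" for d
    unfolding power_sum_def prod_eval_at_\<theta>_pow sum_eq
    by (intro sum.cong refl) (use monics_nonzero in \<open>auto simp: power_add\<close>)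
  have "trunc_mzv (triv_arr \<Sigma>) (\<theta>_pow k) N = (if m = 0 then 1 else 0)" if "N \<ge> Suc m" for N
    using False that sum_monics_lt_power[OF dvd, of N] by (simp add: triv_arr_def trunc_mzv_Cons power_sum)
  hence "eventually (\<lambda>N. trunc_mzv (triv_arr \<Sigma>) (\<theta>_pow k) N = (if m = 0 then 1 else 0)) sequentially"
    unfolding eventually_sequentially by blast
  hence "trunc_mzv (triv_arr \<Sigma>) (\<theta>_pow k) \<longlonglongrightarrow> (if m = 0 then 1 else 0)" by (rule tendsto_eventually)
  moreover have "trunc_mzv (triv_arr \<Sigma>) (\<theta>_pow k) \<longlonglongrightarrow> mzv (triv_arr \<Sigma>) (\<theta>_pow k)"
    using triv_arr_in_arrays_wt[OF assms(1)] assms(1) by (intro trunc_mzv_tendsto_mzv) (auto simp: arrays_wt_def)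
  ultimately have "mzv (triv_arr \<Sigma>) (\<theta>_pow k) = (if m = 0 then 1 else 0)" by (intro LIMSEQ_unique)
  thus ?thesis by (simp only: m0)
qed

lemma Z_triv_wt_add:
  assumes "f \<in> Z_triv_wt \<Sigma> n" "g \<in> Z_triv_wt \<Sigma> n"
  shows "(\<lambda>t. f t + g t) \<in> Z_triv_wt \<Sigma> n"
proof -
  have "finite {k \<in> multi_idx \<Sigma>. f (\<theta>_pow k) + g (\<theta>_pow k) \<noteq> 0}"
    by (rule finite_subset[of _ "{k \<in> multi_idx \<Sigma>. f (\<theta>_pow k) \<noteq> 0} \<union> {k \<in> multi_idx \<Sigma>. g (\<theta>_pow k) \<noteq> 0}"])
       (use assms in \<open>auto simp: Z_triv_wt_def\<close>)
  thus ?thesis using assms by (auto simp: Z_triv_wt_def Z_wt_eq intro: K_comb_add)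
qed

lemma Z_triv_0: "(\<lambda>_. 0) \<in> Z_triv \<Sigma>"
  unfolding Z_triv_def by (auto intro!: exI[of _ "{}"])

lemma Z_triv_add_wt:
  assumes "f \<in> Z_triv \<Sigma>" "g \<in> Z_triv_wt \<Sigma> n"
  shows "(\<lambda>t. f t + g t) \<in> Z_triv \<Sigma>"
proof -
  from assms(1) obtain N h where f: "f = (\<lambda>t. \<Sum>n\<in>N. h n t)" "finite N" "\<forall>n\<in>N. h n \<in> Z_triv_wt \<Sigma> n"
    by (auto simp: Z_triv_def)
  have zero: "(\<lambda>_. 0) \<in> Z_triv_wt \<Sigma> n" by (auto simp: Z_triv_wt_def Z_wt_eq intro: K_comb_0)
  define h0 where "h0 = (if n \<in> N then h n else (\<lambda>_. 0))"
  define h' where "h' = h(n := \<lambda>t. h0 t + g t)"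
  have h0: "h0 \<in> Z_triv_wt \<Sigma> n" using f zero by (auto simp: h0_def)
  have "f t + g t = (\<Sum>i\<in>insert n N. h' i t)" for t
  proof -
    have "f t = h0 t + (\<Sum>i\<in>N-{n}. h i t)"
      using f(2) by (cases "n \<in> N") (simp_all add: f(1) h0_def sum.remove)
    moreover have "(\<Sum>i\<in>insert n N. h' i t) = h' n t + (\<Sum>i\<in>N-{n}. h' i t)"
      using f(2) by (simp add: sum.insert_remove)
    moreover have "(\<Sum>i\<in>N-{n}. h' i t) = (\<Sum>i\<in>N-{n}. h i t)"
      by (intro sum.cong) (auto simp: h'_def)
    ultimately show ?thesis by (simp add: h'_def algebra_simps)
  qed
  moreover have "h' i \<in> Z_triv_wt \<Sigma> i" if "i \<in> insert n N" for i
    using that f(3) Z_triv_wt_add[OF h0 assms(2)] by (auto simp: h'_def)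
  ultimately show ?thesis unfolding Z_triv_def using f(2)
    by (intro CollectI exI[of _ "insert n N"] exI[of _ h']) auto
qed

lemma finite_support_triv:
  assumes "finite \<Sigma>"
  shows "finite {k \<in> multi_idx \<Sigma>. y k * mzv (triv_arr \<Sigma>) (\<theta>_pow k) \<noteq> 0}"
  by (rule finite_subset[of _ "{\<lambda>_. 0}"]) (auto simp: mzv_triv_arr_\<theta>_pow[OF assms] split: if_splits)

text \<open>
  The factor \<open>z\<close> need not be homogeneous, so it is split into single multiple zeta values, whose
  products with \<open>\<zeta>\<^sub>A(\<Sigma>; |\<Sigma>|)\<close> have a weight.
\<close>

lemma MZV_times_triv_in_Z_triv:
  assumes "z \<in> MZV" "finite \<Sigma>"
  shows "(\<lambda>t. z * mzv (triv_arr \<Sigma>) t) \<in> Z_triv \<Sigma>"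
proof -
  let ?f0 = "mzv (triv_arr \<Sigma>)"
  have "(\<lambda>t. f t * ?f0 t) \<in> Z_triv \<Sigma>" if "K_comb (mzv ` arrays {}) f" for f
    using that
  proof (induction rule: K_comb.induct)
    case K_comb_0
    show ?case using Z_triv_0 by simp
  next
    case (K_comb_Cons h c b)
    then obtain A where A: "A \<in> arrays_wt {} (weight A)" "b = mzv A" using arrays_imp_arrays_wt by blast
    have "K_comb (mzv ` arrays_wt ({} \<union> \<Sigma>) (weight A + card \<Sigma>)) (\<lambda>t. mzv A t * ?f0 t)"
      using A assms by (intro mzv_mult_mzv triv_arr_in_arrays_wt) auto
    hence "K_comb (mzv ` arrays_wt \<Sigma> (weight A + card \<Sigma>)) (\<lambda>t. c * (mzv A t * ?f0 t))"
      using K_comb_Cons by (intro K_comb_scale) auto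
    moreover have "finite {k \<in> multi_idx \<Sigma>. (c * mzv A (\<theta>_pow k)) * ?f0 (\<theta>_pow k) \<noteq> 0}"
      by (rule finite_support_triv[OF assms(2)])
    ultimately have "(\<lambda>t. c * (mzv A t * ?f0 t)) \<in> Z_triv_wt \<Sigma> (weight A + card \<Sigma>)"
      by (simp add: Z_triv_wt_def Z_wt_eq mult.assoc)
    from Z_triv_add_wt[OF K_comb_Cons.IH this] show ?case
      by (simp add: A algebra_simps)
  qed
  from this[of "\<lambda>_. z"] assms show ?thesis by (simp add: MZV_def)
qed

lemma G_MZV_times_triv:
  assumes "finite \<Sigma>"
  shows "G \<Sigma> (\<lambda>t. z * mzv (triv_arr \<Sigma>) t) = z * zeta_one ^ card \<Sigma>"
proof -
  have "G \<Sigma> (\<lambda>t. z * mzv (triv_arr \<Sigma>) t) = (\<Sum>j\<in>{\<lambda>_. 0}. z * mzv (triv_arr \<Sigma>) (\<theta>_pow j) / (\<Prod>r\<in>\<Sigma>. D (j r)) * (\<Prod>r\<in>\<Sigma>. zeta_one ^ (q ^ j r)))"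
    by (rule G_eq[OF assms]) (auto simp: multi_idx_def mzv_triv_arr_\<theta>_pow[OF assms])
  also have "\<dots> = z * zeta_one ^ card \<Sigma>"
    by (simp add: mzv_triv_arr_\<theta>_pow[OF assms] multi_idx_def)
  finally show ?thesis .
qed

lemma image_G:
  assumes "finite \<Sigma>"
  shows "G \<Sigma> ` Z_triv \<Sigma> = Idl\<^bsub>MZV_ring\<^esub> {zeta_one ^ card \<Sigma>}"
proof -
  interpret R: cring MZV_ring by (rule cring_MZV_ring)
  have "zeta_one ^ card \<Sigma> \<in> carrier MZV_ring"
    unfolding carrier_MZV_ring by (intro MZV_power zeta_one_in_MZV)
  hence "Idl\<^bsub>MZV_ring\<^esub> {zeta_one ^ card \<Sigma>} = PIdl\<^bsub>MZV_ring\<^esub> (zeta_one ^ card \<Sigma>)"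
    by (rule R.cgenideal_eq_genideal[symmetric])
  also have "\<dots> = {z * zeta_one ^ card \<Sigma> | z. z \<in> MZV}"
    unfolding cgenideal_def carrier_MZV_ring by (simp add: MZV_ring_def)
  also have "G \<Sigma> ` Z_triv \<Sigma> = \<dots>"
  proof (intro equalityI subsetI)
    fix y assume "y \<in> G \<Sigma> ` Z_triv \<Sigma>"
    thus "y \<in> {z * zeta_one ^ card \<Sigma> | z. z \<in> MZV}" using G_in_ideal[OF _ assms] by blast
  next
    fix y assume "y \<in> {z * zeta_one ^ card \<Sigma> | z. z \<in> MZV}"
    then obtain z where "z \<in> MZV" "y = z * zeta_one ^ card \<Sigma>" by blast
    thus "y \<in> G \<Sigma> ` Z_triv \<Sigma>"
      using MZV_times_triv_in_Z_triv[OF _ assms] G_MZV_times_triv[OF assms, of z] by (metis imageI)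
  qed
  finally show ?thesis by simp
qed

end

theorem theorem0p4:
  fixes \<iota> :: "'a :: finite_field fls \<Rightarrow> 'c :: {field, complete_space}"
    and \<Sigma> :: "nat set"
  assumes "C_infinity \<iota>"
    and "finite \<Sigma>" and "0 \<notin> \<Sigma>"
    and "card \<Sigma> < CARD('a)"
  shows "C_infinity.G \<iota> \<Sigma> ` C_infinity.Z_triv \<iota> \<Sigma> =
    Idl\<^bsub>C_infinity.MZV_ring \<iota>\<^esub> {C_infinity.zeta_one \<iota> ^ card \<Sigma>}"
  using C_infinity.image_G[OF assms(1,2)] .

end
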